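(* Let $k$ be an algebraically closed field of characteristic zero, let $d$ be a positive integer, $\tau,\nu\ge0$ integers, and $t_1,\dots,t_\tau$, $n_1,\dots,n_\nu$ positive integers. If $$\frac{d(d+1)}6\ \ge\ \sum_{i=1}^\tau t_i+\sum_{i=1}^\nu(n_i+1)\ \ge\ 6,$$ then there exists a reduced irreducible curve in $\mathbb P^2_k$ of degree $d$ with $\tau$ tacnodes of orders $t_1,\dots,t_\tau$ and $\nu$ cusps of orders $n_1,\dots,n_\nu$ as its only singularities.
   Context: A tacnode of order $t$ is a plane curve singularity whose cluster of infinitely near singular points consists of $t$ free points, each infinitely near the preceding one, of multiplicities $(2^t)$; i.e. an $A_{2t-1}$ singularity, formally $y^2=x^{2t}$ (for $t=1$, a node). A cusp of order $n$ is a plane curve singularity whose cluster of infinitely near singular points consists of $n+2$ points, each infinitely near the preceding one, with multiplicities $(2^n,1,1)$, the last point being a satellite and the others free; i.e. an $A_{2n}$ singularity, formally $y^2=x^{2n+1}$ (for $n=1$, an ordinary cusp). *)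

theory Defs
  imports
    "HOL-Computational_Algebra.Computational_Algebra"
    "HOL-Library.Sublist"
    Complex_Main
begin

section \<open>Germs of plane curves and their infinitely near points\<close>

text \<open>
  Bivariate polynomials are nested univariate ones: \<open>coeff (coeff f j) i\<close> is the coefficient
  of \<open>x\<^sup>i y\<^sup>j\<close>. Such an \<open>f\<close> stands for the germ at the origin of the curve \<open>f = 0\<close>.
\<close>

abbreviation varx :: "'a::field poly poly" where "varx \<equiv> [:[:0, 1:]:]"
abbreviation vary :: "'a::field poly poly" where "vary \<equiv> [:0, 1:]"
abbreviation const2 :: "'a::field \<Rightarrow> 'a poly poly" where "const2 c \<equiv> [:[:c:]:]"

text \<open>\<open>subst2 f X Y\<close> is \<open>f(X, Y)\<close>.\<close>

definition subst2 ::
  "'a::field poly poly \<Rightarrow> 'a poly poly \<Rightarrow> 'a poly poly \<Rightarrow> 'a poly poly" where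
  "subst2 f X Y = poly (map_poly (\<lambda>a. poly (map_poly const2 a) X) f) Y"

text \<open>Multiplicity at the origin, i.e. the order of vanishing (meaningful for \<open>f \<noteq> 0\<close>).\<close>

definition mult0 :: "'a::field poly poly \<Rightarrow> nat" where
  "mult0 f = (LEAST m. \<exists>i j. i + j = m \<and> coeff (coeff f j) i \<noteq> 0)"

text \<open>
  The points of the exceptional divisor of the blow-up of the origin are the tangent directions:
  \<open>Slope c\<close> is the direction of the line \<open>y = c x\<close>, \<open>Vertical\<close> that of \<open>x = 0\<close>. Local
  coordinates \<open>(x', y')\<close> centred at these points are given by \<open>(x, y) = (x', x' (y' + c))\<close>
  and \<open>(x, y) = (x' y', y')\<close>, with exceptional divisor \<open>x' = 0\<close> and \<open>y' = 0\<close> respectively.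
\<close>

datatype 'a direction = Slope 'a | Vertical

fun strict_transform :: "'a::field direction \<Rightarrow> 'a poly poly \<Rightarrow> 'a poly poly" where
  "strict_transform (Slope c) f = subst2 f varx (varx * (vary + const2 c)) div varx ^ mult0 f"
| "strict_transform Vertical f = subst2 f (varx * vary) vary div vary ^ mult0 f"

text \<open>
  A point equal or infinitely near to the origin is the list of directions, first blow-up first,
  leading to it; \<open>[]\<close> is the origin itself. Thus \<open>q\<close> is infinitely near to \<open>p\<close> (or equal to it)
  iff \<open>prefix p q\<close>.
\<close>

type_synonym 'a inf_near = "'a direction list"

definition mult_at :: "'a::field poly poly \<Rightarrow> 'a inf_near \<Rightarrow> nat" where
  "mult_at f p = mult0 (fold strict_transform p f)"

text \<open>
  In the coordinates above, every irreducible component of the total exceptional divisor that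
  passes through the current point is a coordinate axis. The first (second) flag tells whether
  \<open>x = 0\<close> (respectively \<open>y = 0\<close>) is such a component. A point is satellite if two components
  pass through it, and free otherwise.
\<close>

fun exc_step :: "'a::field direction \<Rightarrow> bool \<times> bool \<Rightarrow> bool \<times> bool" where
  "exc_step (Slope c) (ex, ey) = (True, ey \<and> c = 0)"
| "exc_step Vertical (ex, ey) = (ex, True)"

definition satellite :: "'a::field inf_near \<Rightarrow> bool" where
  "satellite p \<longleftrightarrow> fold exc_step p (False, False) = (True, True)"

text \<open>
  The singular points of the germ, among the points equal or infinitely near to the origin and
  lying on it: those that are multiple, or are satellite, or precede a satellite point of the germ.
\<close>

definition singular_cluster :: "'a::field poly poly \<Rightarrow> 'a inf_near set" where
  "singular_cluster f =
     {p. mult_at f p \<ge> 2} \<union> {p. \<exists>q. prefix p q \<and> satellite q \<and> mult_at f q \<ge> 1}"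

definition is_tacnode :: "nat \<Rightarrow> 'a::field poly poly \<Rightarrow> bool" where
  "is_tacnode t f \<longleftrightarrow>
     (\<exists>q. length q + 1 = t \<and> singular_cluster f = {p. prefix p q} \<and>
          (\<forall>p. prefix p q \<longrightarrow> mult_at f p = 2 \<and> \<not> satellite p))"

definition is_cusp :: "nat \<Rightarrow> 'a::field poly poly \<Rightarrow> bool" where
  "is_cusp n f \<longleftrightarrow>
     (\<exists>q. length q + 1 = n + 2 \<and> singular_cluster f = {p. prefix p q} \<and>
          (\<forall>p. prefix p q \<longrightarrow>
                 mult_at f p = (if length p < n then 2 else 1) \<and> (satellite p \<longleftrightarrow> p = q)))"

section \<open>Projective plane curves\<close>

text \<open>
  Ternary polynomials \<open>F(x, y, z)\<close> are nested likewise, with \<open>z\<close> the outermost variable.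
  A curve of degree \<open>d\<close> is given by a nonzero form of degree \<open>d\<close>. It is reduced and irreducible
  (i.e. integral) iff the form is irreducible.
\<close>

definition homogeneous :: "nat \<Rightarrow> 'a::field poly poly poly \<Rightarrow> bool" where
  "homogeneous d F \<longleftrightarrow> (\<forall>i j l. coeff (coeff (coeff F l) j) i \<noteq> 0 \<longrightarrow> i + j + l = d)"

definition integral_curve :: "nat \<Rightarrow> 'a::field poly poly poly \<Rightarrow> bool" where
  "integral_curve d F \<longleftrightarrow> homogeneous d F \<and> irreducible F"

text \<open>
  Each point of the projective plane has exactly one triple of homogeneous coordinates whose last
  nonzero entry is \<open>1\<close>.
\<close>

definition proj_plane :: "('a::field \<times> 'a \<times> 'a) set" where
  "proj_plane = {(a, b, 1) |a b. True} \<union> {(a, 1, 0) |a. True} \<union> {(1, 0, 0)}"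

definition subst3 ::
  "'a::field poly poly poly \<Rightarrow> 'a poly poly \<Rightarrow> 'a poly poly \<Rightarrow> 'a poly poly \<Rightarrow> 'a poly poly" where
  "subst3 F X Y Z = poly (map_poly (\<lambda>g. subst2 g X Y) F) Z"

text \<open>The equation of the curve in an affine chart, translated so that the point is the origin.\<close>

fun local_eq :: "'a::field poly poly poly \<Rightarrow> 'a \<times> 'a \<times> 'a \<Rightarrow> 'a poly poly" where
  "local_eq F (a, b, c) =
     (if c \<noteq> 0 then subst3 F (varx + const2 (a / c)) (vary + const2 (b / c)) 1
      else if b \<noteq> 0 then subst3 F (varx + const2 (a / b)) 1 vary
      else subst3 F 1 varx vary)"

definition singular_points :: "'a::field poly poly poly \<Rightarrow> ('a \<times> 'a \<times> 'a) set" where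
  "singular_points F = {p \<in> proj_plane. mult0 (local_eq F p) \<ge> 2}"

end

theory Submission imports Defs
begin

text \<open>
  All singularities are placed on one arc \<open>y = \<psi>(x)\<close>: up to the nonvanishing of finitely many
  coefficients, \<open>f\<close> has an \<open>A\<close>-singularity with tangent arc \<open>y = \<psi>(x)\<close> as soon as \<open>f(x, \<psi>(x))\<close> and
  \<open>(\<partial>f/\<partial>y)(x, \<psi>(x))\<close> vanish to suitable orders. For \<open>\<psi> = x\<^sup>p + (x - 1)\<^sup>B\<close> and all points collapsed to
  \<open>x = 1\<close>, all but at most one of these conditions are independent on polynomials of degree \<open>d - 1\<close>, because in characteristic \<open>0\<close> a
  nonzero polynomial with at most \<open>n\<close> terms does not vanish to order \<open>n\<close> at \<open>1\<close>; by semicontinuity they remain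
  independent when the points are spread apart generically. Independence in degree \<open>d - 1\<close> makes the linear
  system of degree \<open>d\<close> free of further base points, also at infinity and among the tangent directions, so by
  Bertini its general member is smooth elsewhere and has exactly the prescribed singularities. It is irreducible
  because independence in degree \<open>d - 3\<close> contradicts Cayley--Bacharach for a splitting of the curve.
\<close>

section \<open>Plane polynomials\<close>

text \<open>The bound is a count. A tacnode of order t imposes 2t + t conditions along the arc, a
  cusp of order n imposes (2n+1) + (n+1), and polynomials of degree at most d - 1 form a space of
  dimension d(d+1)/2; for tacnodes alone equality leaves no room. The obstacle is parity: the
  elimination at the collapsed point works in three layers, in powers of y - x^p, and the first
  layer takes an even number 2B of monomials, so one condition may be lost. The single polynomial
  \<open>e0\<close> carries this defect through the argument. The lower bound 6 forces d \<ge> 6,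
  which is used as follows. Freeness from base points is tested on lines. A line meets the half
  scheme cut out by \<open>g\<close> in length at most 3, so a suitable A (\<psi> - y) + B g
  restricts to the line with degree at most 3; its square lies in the ideal, since M divides g^2,
  and has degree at most 6 on the line. Intersection theory is replaced by elements of least degree
  in y in suitable ideals.\<close>

definition tdeg_le :: "nat \<Rightarrow> 'a::field poly poly \<Rightarrow> bool" where
  "tdeg_le e f \<longleftrightarrow> (\<forall>i j. coeff (coeff f j) i \<noteq> 0 \<longrightarrow> i + j \<le> e)"

definition eval2 :: "'a::field poly poly \<Rightarrow> 'a \<Rightarrow> 'a \<Rightarrow> 'a" where
  "eval2 f a b = poly (poly f [:b:]) a"

abbreviation pdx :: "'a::field poly poly \<Rightarrow> 'a poly poly" where "pdx \<equiv> map_poly pderiv"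

lemma map_poly_hom_add:
  assumes "\<And>a b. h (a + b) = h a + h b" "h 0 = 0"
  shows "map_poly h (p + q) = map_poly h p + map_poly h q"
  by (rule poly_eqI) (simp add: coeff_map_poly assms)

lemma map_poly_hom_mult:
  fixes h :: "'a::comm_semiring_0 \<Rightarrow> 'b::comm_semiring_0"
  assumes "\<And>a b. h (a + b) = h a + h b" "h 0 = 0" "\<And>a b. h (a * b) = h a * h b"
  shows "map_poly h (p * q) = map_poly h p * map_poly h q"
proof (rule poly_eqI)
  fix n
  have "h (sum f A) = (\<Sum>i\<in>A. h (f i))" if "finite A" for f and A :: "nat set"
    using that by (induction A rule: finite_induct) (auto simp: assms)
  then show "coeff (map_poly h (p * q)) n = coeff (map_poly h p * map_poly h q) n"
    by (simp add: coeff_map_poly assms coeff_mult)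
qed

lemma map_poly_hom_prod_power:
  fixes h :: "'a::comm_semiring_1 \<Rightarrow> 'b::comm_semiring_1"
  assumes "\<And>a b. h (a + b) = h a + h b" "h 0 = 0" "\<And>a b. h (a * b) = h a * h b" "h 1 = 1"
  shows "map_poly h (\<Prod>i\<in>A. p i ^ e i) = (\<Prod>i\<in>A. map_poly h (p i) ^ e i)"
proof -
  note mult = map_poly_hom_mult[of h, OF assms(1-3)]
  have pow: "map_poly h (p ^ k) = map_poly h p ^ k" for p k
    by (induction k) (auto simp: mult assms)
  show ?thesis
    by (induction A rule: infinite_finite_induct) (auto simp: mult pow assms)
qed

lemma eval2_add [simp]: "eval2 (f + g) a b = eval2 f a b + eval2 g a b"
  and eval2_diff [simp]: "eval2 (f - g) a b = eval2 f a b - eval2 g a b"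
  and eval2_minus [simp]: "eval2 (- f) a b = - eval2 f a b"
  and eval2_mult [simp]: "eval2 (f * g) a b = eval2 f a b * eval2 g a b"
  and eval2_power [simp]: "eval2 (f ^ n) a b = eval2 f a b ^ n"
  and eval2_smult [simp]: "eval2 (smult c f) a b = poly c a * eval2 f a b"
  and eval2_pCons [simp]: "eval2 (pCons c f) a b = poly c a + b * eval2 f a b"
  and eval2_0 [simp]: "eval2 0 a b = 0"
  and eval2_1 [simp]: "eval2 1 a b = 1"
  by (simp_all add: eval2_def)

lemma poly_poly_eq_eval2: "poly (poly f \<psi>) a = eval2 f a (poly \<psi> a)"
  by (induction f) auto

lemma tdeg_leD: "tdeg_le e f \<Longrightarrow> e < i + j \<Longrightarrow> coeff (coeff f j) i = 0"
  unfolding tdeg_le_def by (meson not_le)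

lemma tdeg_le_mono: "tdeg_le e f \<Longrightarrow> e \<le> e' \<Longrightarrow> tdeg_le e' f"
  unfolding tdeg_le_def by (meson order_trans)

lemma tdeg_le_0 [simp]: "tdeg_le e 0" by (simp add: tdeg_le_def)

lemma tdeg_le_add: "tdeg_le e f \<Longrightarrow> tdeg_le e g \<Longrightarrow> tdeg_le e (f + g)"
  unfolding tdeg_le_def by (metis add.right_neutral coeff_add)

lemma tdeg_le_minus: "tdeg_le e f \<Longrightarrow> tdeg_le e (- f)"
  unfolding tdeg_le_def by auto

lemma tdeg_le_diff: "tdeg_le e f \<Longrightarrow> tdeg_le e g \<Longrightarrow> tdeg_le e (f - g)"
  using tdeg_le_add[of e f "- g"] tdeg_le_minus[of e g] by simp

lemma tdeg_le_mult:
  assumes "tdeg_le e f" "tdeg_le e' g"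
  shows "tdeg_le (e + e') (f * g)"
  unfolding tdeg_le_def
proof (intro allI impI, rule ccontr)
  fix i j
  assume nz: "coeff (coeff (f * g) j) i \<noteq> 0" and "\<not> i + j \<le> e + e'"
  then have gt: "e + e' < i + j" by simp
  have "coeff (coeff f l) m * coeff (coeff g (j - l)) (i - m) = 0" if "l \<le> j" "m \<le> i" for l m
  proof (rule ccontr)
    assume "\<not> ?thesis"
    then have "m + l \<le> e" "(i - m) + (j - l) \<le> e'"
      using assms by (auto simp: tdeg_le_def)
    with gt that show False by linarith
  qed
  then have "coeff (coeff (f * g) j) i = 0"
    unfolding coeff_mult coeff_sum by (intro sum.neutral ballI) auto
  with nz show False by simp
qed

lemma tdeg_le_const:
  assumes "degree c \<le> e"
  shows "tdeg_le e [:c:]"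
  unfolding tdeg_le_def
proof (intro allI impI)
  fix i j assume nz: "coeff (coeff [:c:] j) i \<noteq> 0"
  then have "j = 0" by (cases j) auto
  with nz have "i \<le> degree c" by (auto intro: le_degree)
  with assms \<open>j = 0\<close> show "i + j \<le> e" by simp
qed

lemma tdeg_le_power: "tdeg_le e f \<Longrightarrow> tdeg_le (n * e) (f ^ n)"
proof (induction n)
  case 0
  have "tdeg_le 0 [:1::'a poly:]" by (rule tdeg_le_const) simp
  then show ?case by (simp add: one_pCons)
next
  case (Suc n)
  then show ?case using tdeg_le_mult[of e f "n * e" "f ^ n"] by simp
qed

lemma tdeg_le_smult: "tdeg_le e f \<Longrightarrow> tdeg_le e (smult [:c:] f)"
  unfolding tdeg_le_def by auto

lemma tdeg_le_sum: "(\<And>x. x \<in> A \<Longrightarrow> tdeg_le e (f x)) \<Longrightarrow> tdeg_le e (sum f A)"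
  by (induction A rule: infinite_finite_induct) (auto intro: tdeg_le_add)

lemma tdeg_le_monom: "i + j \<le> e \<Longrightarrow> tdeg_le e (monom (monom c i) j)"
  by (auto simp: tdeg_le_def coeff_monom split: if_splits)

lemma tdeg_le_linear:
  assumes "degree c \<le> 1"
  shows "tdeg_le 1 [:c, [:s:]:]"
proof -
  have "[:c, [:s:]:] = [:c:] + monom (monom s 0) 1" by (simp add: monom_0 monom_altdef)
  then show ?thesis using assms by (metis tdeg_le_add tdeg_le_const tdeg_le_monom add_0 order_refl)
qed

lemma tdeg_le_exists: "\<exists>e. tdeg_le e f"
proof (induction f)
  case (pCons c f)
  then obtain e where e: "tdeg_le e f" by blast
  have "tdeg_le (max (degree c) (Suc e)) (pCons c f)"
    unfolding tdeg_le_def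
  proof (intro allI impI)
    fix i j assume nz: "coeff (coeff (pCons c f) j) i \<noteq> 0"
    show "i + j \<le> max (degree c) (Suc e)"
    proof (cases j)
      case 0 with nz show ?thesis by (auto intro: le_max_iff_disj[THEN iffD2] le_degree)
    next
      case (Suc k)
      with nz e have "i + k \<le> e" by (auto simp: tdeg_le_def)
      with Suc show ?thesis by auto
    qed
  qed
  then show ?case by blast
qed (auto intro: exI[of _ 0])

lemma pderiv_poly:
  "pderiv (poly f \<psi>) = poly (pdx f) \<psi> + poly (pderiv f) \<psi> * pderiv \<psi>"
  by (induction f) (auto simp: map_poly_pCons pderiv_add pderiv_mult pderiv_pCons algebra_simps)

lemma pdx_add: "pdx (f + g) = pdx f + pdx g"
  by (rule map_poly_hom_add) (auto simp: pderiv_add)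

lemma pdx_smult: "pdx (smult c f) = smult (pderiv c) f + smult c (pdx f)"
  by (rule poly_eqI) (simp add: coeff_map_poly pderiv_mult algebra_simps)

lemma pdx_mult: "pdx (f * g) = f * pdx g + g * pdx f"
proof (induction f)
  case (pCons c f)
  have "pdx (pCons 0 h) = pCons 0 (pdx h)" for h :: "'a poly poly"
    by (simp add: map_poly_pCons)
  then show ?case
    using pCons by (simp add: map_poly_pCons pdx_add pdx_smult algebra_simps)
qed simp

lemma poly_taylor2:
  fixes f :: "'a::idom poly"
  shows "\<exists>r. poly f (u + h) = poly f u + h * poly (pderiv f) u + h\<^sup>2 * r"
proof (induction f)
  case (pCons c f)
  then obtain r where r: "poly f (u + h) = poly f u + h * poly (pderiv f) u + h\<^sup>2 * r" by blast
  have "poly (pCons c f) (u + h) = poly (pCons c f) u + h * poly (pderiv (pCons c f)) u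
      + h\<^sup>2 * (poly (pderiv f) u + (u + h) * r)"
    by (simp add: r r[unfolded add.commute[of u h]] pderiv_pCons algebra_simps power2_eq_square)
  then show ?case by blast
qed (auto intro: exI[of _ 0])

lemma poly_taylor1:
  fixes f :: "'a::idom poly"
  shows "\<exists>r. poly f (u + h) = poly f u + h * r"
proof -
  obtain r where "poly f (u + h) = poly f u + h * poly (pderiv f) u + h\<^sup>2 * r"
    using poly_taylor2 by blast
  then have "poly f (u + h) = poly f u + h * (poly (pderiv f) u + h * r)"
    by (simp add: algebra_simps power2_eq_square)
  then show ?thesis by blast
qed

section \<open>Linear algebra: wide systems and generic independence\<close>

lemma underdetermined_system:
  fixes M :: "'j \<Rightarrow> 'i \<Rightarrow> 'a::field"
  assumes "finite I" "finite J" "card I < card J"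
  shows "\<exists>c. (\<exists>j\<in>J. c j \<noteq> 0) \<and> (\<forall>i\<in>I. (\<Sum>j\<in>J. c j * M j i) = 0)"
  using assms
proof (induction I arbitrary: J M rule: finite_induct)
  case empty
  then obtain j0 where "j0 \<in> J" by fastforce
  then show ?case by (intro exI[of _ "\<lambda>j. if j = j0 then 1 else 0"]) auto
next
  case (insert i I)
  show ?case
  proof (cases "\<forall>j\<in>J. M j i = 0")
    case True
    then show ?thesis using insert.IH[of J M] insert.prems insert.hyps by auto
  next
    case False
    then obtain j0 where j0: "j0 \<in> J" "M j0 i \<noteq> 0" by blast
    define J' where "J' = J - {j0}"
    define M' where "M' = (\<lambda>j l. M j l - M j i / M j0 i * M j0 l)"
    have J: "J = insert j0 J'" "j0 \<notin> J'" "finite J'" using j0 insert.prems by (auto simp: J'_def)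
    have "card I < card J'" using insert.prems insert.hyps J by auto
    from insert.IH[OF J(3) this, of M'] obtain c'
      where c': "\<exists>j\<in>J'. c' j \<noteq> 0" "\<forall>l\<in>I. (\<Sum>j\<in>J'. c' j * M' j l) = 0" by blast
    define e where "e = (\<Sum>j\<in>J'. c' j * (M j i / M j0 i))"
    define c where "c = (\<lambda>j. if j = j0 then - e else c' j)"
    have split: "(\<Sum>j\<in>J. c j * M j l) = - e * M j0 l + (\<Sum>j\<in>J'. c' j * M j l)" for l
    proof -
      have "(\<Sum>j\<in>J'. c j * M j l) = (\<Sum>j\<in>J'. c' j * M j l)"
        using J by (intro sum.cong) (auto simp: c_def)
      then show ?thesis using J by (simp add: c_def)
    qed
    have "(\<Sum>j\<in>J. c j * M j l) = (\<Sum>j\<in>J'. c' j * M' j l)" for l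
      unfolding split M'_def e_def
      by (simp add: sum_distrib_right sum_distrib_left sum_subtractf algebra_simps)
    moreover have "(\<Sum>j\<in>J'. c' j * M' j i) = 0" using j0 by (simp add: M'_def)
    ultimately have "\<forall>l\<in>insert i I. (\<Sum>j\<in>J. c j * M j l) = 0" using c' by auto
    moreover have "\<exists>j\<in>J. c j \<noteq> 0" using c'(1) J by (auto simp: c_def)
    ultimately show ?thesis by blast
  qed
qed

text \<open>Gaussian elimination over polynomials in s. A pivot q that is nonzero at s0 removes one
  row, and outside the finitely many roots of q the reduced rows decide independence of the original
  ones.\<close>

lemma independent_specialization:
  fixes w :: "'j \<Rightarrow> 'i \<Rightarrow> 'a::field poly"
  assumes "finite J"
    and "\<And>c. (\<forall>i. (\<Sum>j\<in>J. c j * poly (w j i) s0) = 0) \<Longrightarrow> \<forall>j\<in>J. c j = 0"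
  shows "finite {s. \<exists>c. (\<forall>i. (\<Sum>j\<in>J. c j * poly (w j i) s) = 0) \<and> (\<exists>j\<in>J. c j \<noteq> 0)}"
  using assms
proof (induction J arbitrary: w rule: finite_induct)
  case empty
  then show ?case by simp
next
  case (insert j0 J)
  have "\<exists>i. poly (w j0 i) s0 \<noteq> 0"
  proof (rule ccontr)
    assume "\<not> ?thesis"
    then have "\<forall>i. (\<Sum>j\<in>insert j0 J. (if j = j0 then 1 else 0) * poly (w j i) s0) = 0"
      using insert.hyps by (auto intro!: sum.neutral)
    from insert.prems[OF this] show False by auto
  qed
  then obtain i0 where i0: "poly (w j0 i0) s0 \<noteq> 0" by blast
  define q where "q = w j0 i0"
  define w' where "w' = (\<lambda>j i. q * w j i - w j i0 * w j0 i)"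
  have key: "(\<Sum>j\<in>J. c j * poly (w' j i) s) =
      poly q s * (\<Sum>j\<in>J. c j * poly (w j i) s) - (\<Sum>j\<in>J. c j * poly (w j i0) s) * poly (w j0 i) s"
    for c i s
    by (simp add: w'_def sum_subtractf sum_distrib_left sum_distrib_right algebra_simps)
  have "\<forall>j\<in>J. c j = 0" if c: "\<forall>i. (\<Sum>j\<in>J. c j * poly (w' j i) s0) = 0" for c
  proof -
    \<comment> \<open>Multiplying by q(s0) instead of dividing by it turns a relation among the
      reduced rows into one among the original rows.\<close>
    define c' where "c' = (\<lambda>j. if j = j0 then - (\<Sum>j\<in>J. c j * poly (w j i0) s0) else poly q s0 * c j)"
    have "(\<Sum>j\<in>insert j0 J. c' j * poly (w j i) s0) = (\<Sum>j\<in>J. c j * poly (w' j i) s0)" for i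
    proof -
      have "(\<Sum>j\<in>J. c' j * poly (w j i) s0) = (\<Sum>j\<in>J. poly q s0 * c j * poly (w j i) s0)"
        using insert.hyps by (intro sum.cong) (auto simp: c'_def)
      then show ?thesis
        unfolding key using insert.hyps by (simp add: c'_def sum_distrib_left algebra_simps)
    qed
    then have "\<forall>j\<in>insert j0 J. c' j = 0" using insert.prems[of c'] c by auto
    then show ?thesis using i0 insert.hyps by (auto simp: c'_def q_def split: if_splits)
  qed
  from insert.IH[OF this]
  have "finite ({s. \<exists>c. (\<forall>i. (\<Sum>j\<in>J. c j * poly (w' j i) s) = 0) \<and> (\<exists>j\<in>J. c j \<noteq> 0)} \<union> {s. poly q s = 0})"
    using i0 by (auto simp: q_def intro!: poly_roots_finite)
  moreover have "{s. \<exists>c. (\<forall>i. (\<Sum>j\<in>insert j0 J. c j * poly (w j i) s) = 0) \<and> (\<exists>j\<in>insert j0 J. c j \<noteq> 0)}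
     \<subseteq> {s. \<exists>c. (\<forall>i. (\<Sum>j\<in>J. c j * poly (w' j i) s) = 0) \<and> (\<exists>j\<in>J. c j \<noteq> 0)} \<union> {s. poly q s = 0}"
  proof
    fix s
    assume "s \<in> {s. \<exists>c. (\<forall>i. (\<Sum>j\<in>insert j0 J. c j * poly (w j i) s) = 0) \<and> (\<exists>j\<in>insert j0 J. c j \<noteq> 0)}"
    then obtain c where c: "\<And>i. (\<Sum>j\<in>insert j0 J. c j * poly (w j i) s) = 0" "\<exists>j\<in>insert j0 J. c j \<noteq> 0"
      by blast
    have *: "(\<Sum>j\<in>J. c j * poly (w j i) s) = - c j0 * poly (w j0 i) s" for i
      using c(1)[of i] insert.hyps by (simp add: eq_neg_iff_add_eq_0 add.commute)
    show "s \<in> {s. \<exists>c. (\<forall>i. (\<Sum>j\<in>J. c j * poly (w' j i) s) = 0) \<and> (\<exists>j\<in>J. c j \<noteq> 0)} \<union> {s. poly q s = 0}"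
    proof (cases "poly q s = 0")
      case False
      have "(\<Sum>j\<in>J. c j * poly (w' j i) s) = 0" for i
        unfolding key * by (simp add: q_def)
      moreover have "\<exists>j\<in>J. c j \<noteq> 0"
      proof (rule ccontr)
        assume "\<not> ?thesis"
        then have "c j0 \<noteq> 0" "(\<Sum>j\<in>J. c j * poly (w j i0) s) = 0" using c(2) by auto
        then show False using *[of i0] False by (simp add: q_def)
      qed
      ultimately show ?thesis by blast
    qed simp
  qed
  ultimately show ?case by (rule finite_subset[rotated])
qed

section \<open>Interpolation along an arc\<close>

text \<open>Independence of the conditions is encoded as surjectivity of the restriction to the arc.
  In this form it passes to divisors of G and H and directly yields interpolating curves.\<close>

definition interp :: "nat \<Rightarrow> 'a::field poly \<Rightarrow> 'a poly \<Rightarrow> 'a poly \<Rightarrow> bool" where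
  "interp e \<psi> G H \<longleftrightarrow>
     (\<forall>A B. \<exists>f. tdeg_le e f \<and> G dvd poly f \<psi> - A \<and> H dvd poly (pderiv f) \<psi> - B)"

lemma interp_dvd: "interp e \<psi> G H \<Longrightarrow> G' dvd G \<Longrightarrow> H' dvd H \<Longrightarrow> interp e \<psi> G' H'"
  unfolding interp_def by (meson dvd_trans)

lemma dvd_sum_smult_mod:
  fixes A :: "'j \<Rightarrow> 'a::field poly"
  shows "G dvd (\<Sum>j\<in>J. smult (c j) (A j)) - (\<Sum>j\<in>J. smult (c j) (A j mod G))"
  unfolding sum_subtractf[symmetric] smult_diff_right[symmetric]
  by (intro dvd_sum dvd_smult) (simp add: minus_mod_eq_mult_div)

lemma smult_sum_right: "smult c (sum f A) = (\<Sum>i\<in>A. smult c (f i))"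
  by (rule poly_eqI) (simp add: coeff_sum sum_distrib_left)

lemma all_coeff_eq_0:
  assumes "degree p < n \<or> p = 0" "\<And>i. i < n \<Longrightarrow> coeff p i = 0"
  shows "p = 0"
  using assms by (metis leading_coeff_0_iff)

text \<open>A square system: there are as many unknowns as coefficients in the two remainders. The
  target joins as one more unknown, with index \<open>None\<close>; injectivity forces its
  coefficient in the resulting relation to be nonzero.\<close>

lemma surjective_of_injective:
  fixes A B :: "'j \<Rightarrow> 'a::field poly" and G H :: "'a poly"
  assumes J: "finite J" "card J = degree G + degree H" and nz: "G \<noteq> 0" "H \<noteq> 0"
    and inj: "\<And>c. G dvd (\<Sum>j\<in>J. smult (c j) (A j)) \<Longrightarrow> H dvd (\<Sum>j\<in>J. smult (c j) (B j)) \<Longrightarrow> \<forall>j\<in>J. c j = 0"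
  shows "\<exists>c. G dvd (\<Sum>j\<in>J. smult (c j) (A j)) - P \<and> H dvd (\<Sum>j\<in>J. smult (c j) (B j)) - Q"
proof -
  define J' where "J' = insert None (Some ` J)"
  define A' where "A' = (\<lambda>j. case j of None \<Rightarrow> P | Some j \<Rightarrow> A j)"
  define B' where "B' = (\<lambda>j. case j of None \<Rightarrow> Q | Some j \<Rightarrow> B j)"
  define I :: "(nat + nat) set" where "I = {..<degree G} <+> {..<degree H}"
  define M where "M = (\<lambda>j i. case i of Inl i \<Rightarrow> coeff (A' j mod G) i | Inr i \<Rightarrow> coeff (B' j mod H) i)"
  have "card I < card J'" "finite I" "finite J'"
    using J by (auto simp: I_def J'_def card_Plus card_image)
  from underdetermined_system[OF this(2,3,1), of M] obtain c
    where c: "\<exists>j\<in>J'. c j \<noteq> 0" "\<And>i. i \<in> I \<Longrightarrow> (\<Sum>j\<in>J'. c j * M j i) = 0" by blast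
  have deg: "degree (\<Sum>j\<in>J'. smult (c j) (C j mod K)) < degree K \<or> (\<Sum>j\<in>J'. smult (c j) (C j mod K)) = 0"
    if "K \<noteq> 0" for C and K :: "'a poly"
  proof (cases "degree K = 0")
    case True
    then have "C j mod K = 0" for j using that degree_mod_less[of K "C j"] by auto
    then show ?thesis by simp
  next
    case False
    then have "degree (smult (c j) (C j mod K)) < degree K" for j
      using that degree_mod_less[of K "C j"] by auto
    then show ?thesis using \<open>finite J'\<close> False by (intro disjI1 degree_sum_less) auto
  qed
  have "(\<Sum>j\<in>J'. smult (c j) (A' j mod G)) = 0"
  proof (rule all_coeff_eq_0[OF deg])
    fix i assume "i < degree G"
    then show "coeff (\<Sum>j\<in>J'. smult (c j) (A' j mod G)) i = 0"
      using c(2)[of "Inl i"] by (simp add: InlI I_def M_def coeff_sum)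
  qed (use nz in auto)
  then have GA: "G dvd (\<Sum>j\<in>J'. smult (c j) (A' j))"
    using dvd_sum_smult_mod[of G c A' J'] by simp
  have "(\<Sum>j\<in>J'. smult (c j) (B' j mod H)) = 0"
  proof (rule all_coeff_eq_0[OF deg])
    fix i assume "i < degree H"
    then show "coeff (\<Sum>j\<in>J'. smult (c j) (B' j mod H)) i = 0"
      using c(2)[of "Inr i"] by (simp add: InrI I_def M_def coeff_sum)
  qed (use nz in auto)
  then have HB: "H dvd (\<Sum>j\<in>J'. smult (c j) (B' j))"
    using dvd_sum_smult_mod[of H c B' J'] by simp
  have splitA: "(\<Sum>j\<in>J'. smult (c j) (A' j)) = smult (c None) P + (\<Sum>j\<in>J. smult (c (Some j)) (A j))"
    and splitB: "(\<Sum>j\<in>J'. smult (c j) (B' j)) = smult (c None) Q + (\<Sum>j\<in>J. smult (c (Some j)) (B j))"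
    using J by (simp_all add: J'_def A'_def B'_def sum.reindex)
  have c0: "c None \<noteq> 0"
  proof
    assume "c None = 0"
    then have "\<forall>j\<in>J. c (Some j) = 0" using GA HB by (intro inj) (auto simp: splitA splitB)
    with c(1) \<open>c None = 0\<close> show False by (auto simp: J'_def)
  qed
  define e where "e = (\<lambda>j. - c (Some j) / c None)"
  have *: "(\<Sum>j\<in>J. smult (e j) (X j)) - Y = smult (- 1 / c None) (smult (c None) Y + (\<Sum>j\<in>J. smult (c (Some j)) (X j)))"
    for X :: "'j \<Rightarrow> 'a poly" and Y
    using c0 by (simp add: e_def smult_add_right smult_sum_right sum_negf)
  show ?thesis
    using GA HB unfolding splitA splitB by (intro exI[of _ e] conjI) (simp_all only: * dvd_smult)
qed

section \<open>Spreading a multiple point at x = 1 into distinct points\<close>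

definition clusters :: "nat \<Rightarrow> (nat \<Rightarrow> nat) \<Rightarrow> 'a::field \<Rightarrow> 'a poly" where
  "clusters n e s = (\<Prod>j<n. [:-(1 + s * of_nat j), 1:] ^ e j)"

lemma clusters_monic [simp]: "lead_coeff (clusters n e s) = 1" "clusters n e s \<noteq> 0"
proof -
  show *: "lead_coeff (clusters n e s) = 1" using lead_coeff_prod[of "\<lambda>j. [:-(1 + s * of_nat j), 1:] ^ e j" "{..<n}"]
    by (simp add: clusters_def lead_coeff_power del: minus_add_distrib)
  from * show "clusters n e s \<noteq> 0" by fastforce
qed

lemma degree_clusters: "degree (clusters n e s) = (\<Sum>j<n. e j)"
  unfolding clusters_def by (subst degree_prod_eq_sum_degree) (auto simp: degree_power_eq)

lemma clusters_0: "clusters n e 0 = [:-1, 1:] ^ (\<Sum>j<n. e j)"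
  by (simp add: clusters_def power_sum)

lemma clusters_generic:
  "\<exists>K. \<forall>s. map_poly (\<lambda>c. poly c s) K = clusters n e (s :: 'a::field)"
proof (intro exI allI)
  fix s :: 'a
  define p where "p = (\<lambda>j. [:- [:1, of_nat j:], 1:] :: 'a poly poly)"
  have "map_poly (\<lambda>c. poly c s) (\<Prod>j<n. p j ^ e j) = (\<Prod>j<n. map_poly (\<lambda>c. poly c s) (p j) ^ e j)"
    by (rule map_poly_hom_prod_power) auto
  also have "map_poly (\<lambda>c. poly c s) \<circ> p = (\<lambda>j. [:-(1 + s * of_nat j), 1:])"
    by (auto simp: p_def map_poly_pCons)
  then have "(\<Prod>j<n. map_poly (\<lambda>c. poly c s) (p j) ^ e j) = clusters n e s"
    by (simp add: clusters_def fun_eq_iff)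
  finally show "map_poly (\<lambda>c. poly c s) (\<Prod>j<n. p j ^ e j) = clusters n e s" .
qed

text \<open>Semicontinuity. Interpolation at s = 0 supplies as many functions as there are
  conditions, independent modulo the two ideals. They stay independent for all but finitely many s,
  where the square system is then onto.\<close>

lemma interp_spread:
  fixes \<psi> :: "'a::field poly"
  assumes "interp d \<psi> ([:-1, 1:] ^ (\<Sum>j<n. e j)) ([:-1, 1:] ^ (\<Sum>j<n. e' j))"
  shows "finite {s. \<not> interp d \<psi> (clusters n e s) (clusters n e' s)}"
proof -
  define N where "N = (\<Sum>j<n. e j)"
  define R where "R = (\<Sum>j<n. e' j)"
  let ?X = "[:-1, 1:] :: 'a poly"
  define J :: "(nat + nat) set" where "J = {..<N} <+> {..<R}"
  have "\<forall>j. \<exists>f. tdeg_le d f \<and> ?X ^ N dvd poly f \<psi> - (case j of Inl k \<Rightarrow> monom 1 k | Inr k \<Rightarrow> 0)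
        \<and> ?X ^ R dvd poly (pderiv f) \<psi> - (case j of Inl k \<Rightarrow> 0 | Inr k \<Rightarrow> monom 1 k)"
    using assms unfolding interp_def N_def R_def by blast
  then obtain f where f: "\<And>j. tdeg_le d (f j)"
      "\<And>j. ?X ^ N dvd poly (f j) \<psi> - (case j of Inl k \<Rightarrow> monom 1 k | Inr k \<Rightarrow> 0)"
      "\<And>j. ?X ^ R dvd poly (pderiv (f j)) \<psi> - (case j of Inl k \<Rightarrow> 0 | Inr k \<Rightarrow> monom 1 k)"
    by metis
  define A where "A = (\<lambda>j. poly (f j) \<psi>)"
  define B where "B = (\<lambda>j. poly (pderiv (f j)) \<psi>)"
  have finJ: "finite J" and cardJ: "card J = N + R" by (auto simp: J_def card_Plus)
  have inj0: "\<forall>j\<in>J. c j = 0" if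
      dA: "?X ^ N dvd (\<Sum>j\<in>J. smult (c j) (A j))" and dB: "?X ^ R dvd (\<Sum>j\<in>J. smult (c j) (B j))" for c
  proof -
    have "?X ^ N dvd (\<Sum>j\<in>J. smult (c j) (A j - (case j of Inl k \<Rightarrow> monom 1 k | Inr k \<Rightarrow> 0)))"
      using f(2) by (intro dvd_sum dvd_smult) (auto simp: A_def)
    with dA have "?X ^ N dvd (\<Sum>j\<in>J. smult (c j) (A j))
        - (\<Sum>j\<in>J. smult (c j) (A j - (case j of Inl k \<Rightarrow> monom 1 k | Inr k \<Rightarrow> 0)))" by (rule dvd_diff)
    also have "\<dots> = (\<Sum>k<N. monom (c (Inl k)) k)"
      unfolding sum_subtractf[symmetric] J_def
      by (simp add: sum.Plus smult_diff_right smult_monom)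
    finally have 1: "?X ^ N dvd (\<Sum>k<N. monom (c (Inl k)) k)" .
    have "?X ^ R dvd (\<Sum>j\<in>J. smult (c j) (B j - (case j of Inl k \<Rightarrow> 0 | Inr k \<Rightarrow> monom 1 k)))"
      using f(3) by (intro dvd_sum dvd_smult) (auto simp: B_def)
    with dB have "?X ^ R dvd (\<Sum>j\<in>J. smult (c j) (B j))
        - (\<Sum>j\<in>J. smult (c j) (B j - (case j of Inl k \<Rightarrow> 0 | Inr k \<Rightarrow> monom 1 k)))" by (rule dvd_diff)
    also have "\<dots> = (\<Sum>k<R. monom (c (Inr k)) k)"
      unfolding sum_subtractf[symmetric] J_def
      by (simp add: sum.Plus smult_diff_right smult_monom)
    finally have 2: "?X ^ R dvd (\<Sum>k<R. monom (c (Inr k)) k)" .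
    have small: "\<forall>k<m. g k = 0" if "?X ^ m dvd (\<Sum>k<m. monom (g k) k)" for m and g :: "nat \<Rightarrow> 'a"
    proof -
      have coeff: "coeff (\<Sum>k<m. monom (g k) k) i = (if i < m then g i else 0)" for i
        by (simp add: coeff_sum coeff_monom)
      have "(\<Sum>k<m. monom (g k) k) = 0"
      proof (rule ccontr)
        assume nz: "(\<Sum>k<m. monom (g k) k) \<noteq> 0"
        then have "m \<le> degree (\<Sum>k<m. monom (g k) k)"
          using dvd_imp_degree_le[OF that nz] by (simp add: degree_power_eq)
        then have "lead_coeff (\<Sum>k<m. monom (g k) k) = 0" unfolding coeff by simp
        with nz show False by simp
      qed
      then show ?thesis using coeff by (metis coeff_0)
    qed
    show ?thesis using small[OF 1] small[OF 2] by (auto simp: J_def)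
  qed
  obtain K where K: "\<And>s. map_poly (\<lambda>c. poly c s) K = clusters n e (s :: 'a)"
    using clusters_generic by blast
  obtain K' where K': "\<And>s. map_poly (\<lambda>c. poly c s) K' = clusters n e' (s :: 'a)"
    using clusters_generic by blast
  obtain D where D: "\<And>j. j \<in> J \<Longrightarrow> degree (A j) \<le> D \<and> degree (B j) \<le> D"
  proof
    fix j assume "j \<in> J"
    show "degree (A j) \<le> (\<Sum>j\<in>J. degree (A j) + degree (B j)) \<and> degree (B j) \<le> (\<Sum>j\<in>J. degree (A j) + degree (B j))"
      using member_le_sum[OF \<open>j \<in> J\<close>, of "\<lambda>j. degree (A j) + degree (B j)"] finJ by auto
  qed
  \<comment> \<open>Remainders modulo the moving polynomials are avoided: the quotients, of degree
    at most \<open>D\<close>, become further unknowns, so that divisibility is a linear relation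
    with coefficients polynomial in s.\<close>
  define J2 where "J2 = J <+> ({..D} <+> {..D})"
  define w :: "(nat + nat) + (nat + nat) \<Rightarrow> nat + nat \<Rightarrow> 'a poly" where
    "w = (\<lambda>j i. case j of Inl j \<Rightarrow> (case i of Inl i \<Rightarrow> [:coeff (A j) i:] | Inr i \<Rightarrow> [:coeff (B j) i:])
       | Inr (Inl m) \<Rightarrow> (case i of Inl i \<Rightarrow> coeff (monom 1 m * K) i | Inr i \<Rightarrow> 0)
       | Inr (Inr m) \<Rightarrow> (case i of Inl i \<Rightarrow> 0 | Inr i \<Rightarrow> coeff (monom 1 m * K') i))"
  have ev: "poly (coeff (monom 1 m * L) i) s = coeff (monom 1 m * map_poly (\<lambda>c. poly c s) L) i"
    for m i s and L :: "'a poly poly"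
    by (simp add: coeff_monom_mult coeff_map_poly)
  have msum_mult: "(\<Sum>m\<le>D. monom (g m) m) * G = (\<Sum>m\<le>D. smult (g m) (monom 1 m * G))"
    for g and G :: "'a poly"
    unfolding sum_distrib_right by (intro sum.cong) (auto simp: smult_monom simp flip: mult_smult_left)
  have rel1: "(\<Sum>j\<in>J2. c j * poly (w j (Inl i)) s) =
      coeff ((\<Sum>j\<in>J. smult (c (Inl j)) (A j)) + (\<Sum>m\<le>D. monom (c (Inr (Inl m))) m) * clusters n e s) i" for c s i
    unfolding msum_mult by (simp add: J2_def sum.Plus finJ w_def ev K coeff_sum del: coeff_monom_mult)
  have rel2: "(\<Sum>j\<in>J2. c j * poly (w j (Inr i)) s) =
      coeff ((\<Sum>j\<in>J. smult (c (Inl j)) (B j)) + (\<Sum>m\<le>D. monom (c (Inr (Inr m))) m) * clusters n e' s) i" for c s i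
    unfolding msum_mult by (simp add: J2_def sum.Plus finJ w_def ev K' coeff_sum del: coeff_monom_mult)
  have rel: "(\<forall>i. (\<Sum>j\<in>J2. c j * poly (w j i) s) = 0) \<longleftrightarrow>
      (\<Sum>j\<in>J. smult (c (Inl j)) (A j)) + (\<Sum>m\<le>D. monom (c (Inr (Inl m))) m) * clusters n e s = 0
    \<and> (\<Sum>j\<in>J. smult (c (Inl j)) (B j)) + (\<Sum>m\<le>D. monom (c (Inr (Inr m))) m) * clusters n e' s = 0" for c s
    by (simp add: split_sum_all rel1 rel2 poly_eq_iff)
  have msum: "\<forall>m\<le>D. g m = 0" if "(\<Sum>m\<le>D. monom (g m) m) = 0" for g :: "nat \<Rightarrow> 'a"
  proof -
    have "coeff (\<Sum>k\<le>D. monom (g k) k) i = (if i \<le> D then g i else 0)" for i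
      by (simp add: coeff_sum coeff_monom)
    with that show ?thesis by (metis coeff_0)
  qed
  have "finite {s. \<exists>c. (\<forall>i. (\<Sum>j\<in>J2. c j * poly (w j i) s) = 0) \<and> (\<exists>j\<in>J2. c j \<noteq> 0)}"
  proof (rule independent_specialization[where ?s0.0 = "0::'a"])
    show "finite J2" using finJ by (simp add: J2_def)
    fix c assume "\<forall>i. (\<Sum>j\<in>J2. c j * poly (w j i) 0) = 0"
    then have 1: "(\<Sum>j\<in>J. smult (c (Inl j)) (A j)) + (\<Sum>m\<le>D. monom (c (Inr (Inl m))) m) * ?X ^ N = 0"
      and 2: "(\<Sum>j\<in>J. smult (c (Inl j)) (B j)) + (\<Sum>m\<le>D. monom (c (Inr (Inr m))) m) * ?X ^ R = 0"
      unfolding rel clusters_0 N_def R_def by auto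
    have "?X ^ N dvd (\<Sum>j\<in>J. smult (c (Inl j)) (A j))" "?X ^ R dvd (\<Sum>j\<in>J. smult (c (Inl j)) (B j))"
      using 1 2 unfolding eq_neg_iff_add_eq_0[symmetric] by (simp_all del: mult_minus_left mult_minus_right)
    then have "\<forall>j\<in>J. c (Inl j) = 0" by (rule inj0)
    with 1 2 have "(\<Sum>m\<le>D. monom (c (Inr (Inl m))) m) = 0" "(\<Sum>m\<le>D. monom (c (Inr (Inr m))) m) = 0"
      by auto
    with msum[of "\<lambda>m. c (Inr (Inl m))"] msum[of "\<lambda>m. c (Inr (Inr m))"] \<open>\<forall>j\<in>J. c (Inl j) = 0\<close> show "\<forall>j\<in>J2. c j = 0" by (auto simp: J2_def)
  qed
  moreover have "interp d \<psi> (clusters n e s) (clusters n e' s)"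
    if good: "\<not> (\<exists>c. (\<forall>i. (\<Sum>j\<in>J2. c j * poly (w j i) s) = 0) \<and> (\<exists>j\<in>J2. c j \<noteq> 0))" for s
    unfolding interp_def
  proof (intro allI)
    fix P Q :: "'a poly"
    have inj: "\<forall>j\<in>J. c j = 0" if
      dA: "clusters n e s dvd (\<Sum>j\<in>J. smult (c j) (A j))" and dB: "clusters n e' s dvd (\<Sum>j\<in>J. smult (c j) (B j))" for c
    proof -
      from dA obtain q where q: "(\<Sum>j\<in>J. smult (c j) (A j)) = clusters n e s * q" by blast
      from dB obtain q' where q': "(\<Sum>j\<in>J. smult (c j) (B j)) = clusters n e' s * q'" by blast
      have degq: "degree q \<le> D"
      proof (cases "q = 0")
        case False
        have "degree q \<le> degree (clusters n e s * q)" using False by (simp add: degree_mult_eq)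
        also have "\<dots> \<le> D" unfolding q[symmetric] using finJ D
          by (intro degree_sum_le) (auto intro: order_trans[OF degree_smult_le])
        finally show ?thesis .
      qed simp
      have degq': "degree q' \<le> D"
      proof (cases "q' = 0")
        case False
        have "degree q' \<le> degree (clusters n e' s * q')" using False by (simp add: degree_mult_eq)
        also have "\<dots> \<le> D" unfolding q'[symmetric] using finJ D
          by (intro degree_sum_le) (auto intro: order_trans[OF degree_smult_le])
        finally show ?thesis .
      qed simp
      define c' where "c' = (\<lambda>j. case j of Inl j \<Rightarrow> c j | Inr (Inl m) \<Rightarrow> - coeff q m | Inr (Inr m) \<Rightarrow> - coeff q' m)"
      have "(\<Sum>m\<le>D. monom (- coeff r m) m) = - r" if "degree r \<le> D" for r :: "'a poly"
        using poly_as_sum_of_monoms'[OF that] by (simp add: minus_monom[symmetric] sum_negf)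
      then have "\<forall>i. (\<Sum>j\<in>J2. c' j * poly (w j i) s) = 0"
        unfolding rel by (simp add: c'_def q q' degq degq')
      with good have "\<forall>j\<in>J2. c' j = 0" by blast
      then have "c' (Inl j) = 0" if "j \<in> J" for j using that by (simp add: J2_def InlI)
      then show ?thesis by (simp add: c'_def)
    qed
    have "\<exists>c. clusters n e s dvd (\<Sum>j\<in>J. smult (c j) (A j)) - P \<and> clusters n e' s dvd (\<Sum>j\<in>J. smult (c j) (B j)) - Q"
      by (rule surjective_of_injective[OF finJ _ _ _ inj]) (auto simp: cardJ degree_clusters N_def R_def)
    then obtain c where c: "clusters n e s dvd (\<Sum>j\<in>J. smult (c j) (A j)) - P"
      "clusters n e' s dvd (\<Sum>j\<in>J. smult (c j) (B j)) - Q" by blast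
    define h where "h = (\<Sum>j\<in>J. smult [:c j:] (f j))"
    have "poly h \<psi> = (\<Sum>j\<in>J. smult (c j) (A j))" "poly (pderiv h) \<psi> = (\<Sum>j\<in>J. smult (c j) (B j))"
      by (simp_all add: h_def A_def B_def poly_sum higher_pderiv_sum[of 1, simplified] pderiv_smult)
    moreover have "tdeg_le d h" unfolding h_def by (intro tdeg_le_sum tdeg_le_smult f)
    ultimately show "\<exists>f. tdeg_le d f \<and> clusters n e s dvd poly f \<psi> - P \<and> clusters n e' s dvd poly (pderiv f) \<psi> - Q"
      using c by metis
  qed
  ultimately show ?thesis by - (erule finite_subset[rotated], blast)
qed

section \<open>Interpolation at a single point\<close>

text \<open>Induction on n. Once the power of x is removed the constant term is nonzero, so
  differentiation loses one term along with one order of vanishing at 1. Characteristic 0 enters at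
  the end: a vanishing derivative leaves a constant, which vanishes at 1.\<close>

lemma few_terms_eq_0:
  fixes q :: "'a::field_char_0 poly"
  assumes "[:-1, 1:] ^ n dvd q" "card {i. coeff q i \<noteq> 0} \<le> n"
  shows "q = 0"
  using assms
proof (induction n arbitrary: q)
  have fin: "finite {i. coeff q i \<noteq> 0}" for q :: "'a poly"
    by (rule finite_subset[of _ "{..degree q}"]) (auto intro: le_degree)
  {
    case 0
    then show ?case using fin[of q] by (simp add: poly_eq_iff)
  next
    case (Suc n)
    show ?case
    proof (rule ccontr)
      assume "q \<noteq> 0"
      then obtain r where r: "q = [:-0, 1:] ^ order 0 q * r" "\<not> [:-0, 1:] dvd r"
        using order_decomp[of q 0] by blast
      define k where "k = order 0 q"
      have q: "q = monom 1 k * r" using r by (simp add: k_def monom_altdef)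
      have r0: "coeff r 0 \<noteq> 0" "r \<noteq> 0"
        using r(2) by (auto simp: dvd_iff_poly_eq_0 poly_0_coeff_0)
      have "Suc n \<le> order 1 q" using Suc.prems(1) \<open>q \<noteq> 0\<close> order_divides[of 1 "Suc n" q] by blast
      also have "order 1 q = order 1 r"
        using q \<open>q \<noteq> 0\<close> by (simp add: order_mult order_0I poly_monom)
      finally have dvd: "[:-1, 1:] ^ Suc n dvd r" using order_divides[of 1 "Suc n" r] by simp
      then obtain s where s: "r = [:-1, 1:] ^ Suc n * s" by blast
      have "pderiv r = [:-1, 1:] ^ n * (smult (of_nat (Suc n)) s + [:-1, 1:] * pderiv s)"
        unfolding s pderiv_mult pderiv_power_Suc by (simp add: pderiv_pCons algebra_simps)
      then have dvd': "[:-1, 1:] ^ n dvd pderiv r" by simp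
      have "Suc ` {i. coeff (pderiv r) i \<noteq> 0} \<subseteq> {i. coeff r i \<noteq> 0} - {0}"
        by (auto simp: coeff_pderiv)
      then have "card (Suc ` {i. coeff (pderiv r) i \<noteq> 0}) \<le> card ({i. coeff r i \<noteq> 0} - {0})"
        by (intro card_mono finite_Diff fin)
      also have "\<dots> = card {i. coeff r i \<noteq> 0} - 1"
        using r0 by (simp add: card_Diff_singleton)
      also have "card {i. coeff r i \<noteq> 0} \<le> Suc n"
      proof -
        have "(\<lambda>i. i + k) ` {i. coeff r i \<noteq> 0} \<subseteq> {i. coeff q i \<noteq> 0}"
          by (auto simp: q coeff_monom_mult)
        then have "card ((\<lambda>i. i + k) ` {i. coeff r i \<noteq> 0}) \<le> card {i. coeff q i \<noteq> 0}"
          by (intro card_mono fin)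
        with Suc.prems(2) show ?thesis by (simp add: card_image)
      qed
      finally have "card {i. coeff (pderiv r) i \<noteq> 0} \<le> n" by (simp add: card_image)
      from Suc.IH[OF dvd' this] obtain c where c: "r = [:c:]" using pderiv_iszero by blast
      have "poly r 1 = 0" using dvd s by simp
      with c r0 show False by simp
    qed
  }
qed

definition block :: "(nat \<times> nat) set \<Rightarrow> (nat \<times> nat \<Rightarrow> 'a::field) \<Rightarrow> 'a poly poly" where
  "block E c = (\<Sum>e\<in>E. monom (monom (c e) (fst e)) (snd e))"

text \<open>On y = x^p the monomial x^i y^j becomes x^(i + p j). As i < p, division with remainder
  by p shows that these exponents are distinct, so the restriction has at most as many terms as the
  block and determines its coefficients.\<close>

lemma block_eq_0:
  fixes c :: "nat \<times> nat \<Rightarrow> 'a::field_char_0"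
  assumes E: "finite E" "\<And>e. e \<in> E \<Longrightarrow> fst e < p"
    and dvd: "[:-1, 1:] ^ n dvd poly (block E c) (monom 1 p)" and n: "card E \<le> n"
  shows "\<forall>e\<in>E. c e = 0"
proof -
  define g where "g = (\<lambda>e::nat \<times> nat. fst e + p * snd e)"
  define q where "q = poly (block E c) (monom 1 p)"
  have q: "q = (\<Sum>e\<in>E. monom (c e) (g e))"
    by (simp add: q_def block_def poly_sum poly_monom g_def mult_monom monom_power)
  have "e = e'" if "e \<in> E" "e' \<in> E" "g e = g e'" for e e'
  proof -
    have "g e mod p = fst e" "g e' mod p = fst e'" "g e div p = snd e" "g e' div p = snd e'"
      using E(2)[OF that(1)] E(2)[OF that(2)] by (auto simp: g_def)
    with that(3) show ?thesis by (simp add: prod_eq_iff)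
  qed
  then have coeff: "coeff q (g e) = c e" if "e \<in> E" for e
  proof -
    have "coeff q (g e) = (\<Sum>e'\<in>E. if e' = e then c e else 0)"
      unfolding q coeff_sum coeff_monom using that \<open>\<And>e' e. e \<in> E \<Longrightarrow> e' \<in> E \<Longrightarrow> g e = g e' \<Longrightarrow> e = e'\<close>
      by (intro sum.cong) auto
    then show ?thesis using that E by simp
  qed
  have "{i. coeff q i \<noteq> 0} \<subseteq> g ` E"
  proof
    fix i assume "i \<in> {i. coeff q i \<noteq> 0}"
    then have "(\<Sum>e\<in>E. coeff (monom (c e) (g e)) i) \<noteq> 0" by (simp add: q coeff_sum)
    then obtain e where "e \<in> E" "coeff (monom (c e) (g e)) i \<noteq> 0" by (meson sum.not_neutral_contains_not_neutral)
    then show "i \<in> g ` E" by (auto simp: coeff_monom split: if_splits)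
  qed
  then have "card {i. coeff q i \<noteq> 0} \<le> card (g ` E)" using E by (intro card_mono) auto
  also have "\<dots> \<le> n" using card_image_le[of E g] E n by linarith
  finally have "q = 0" using dvd by (intro few_terms_eq_0) (auto simp: q_def)
  then show ?thesis using coeff by auto
qed

section \<open>Elimination in layers along y = x^p + (x - 1)^B\<close>

context
  fixes p B :: nat and X \<phi> \<psi> :: "'a::field_char_0 poly" and u :: "'a poly poly"
  defines "X \<equiv> [:-1, 1:]" and "\<phi> \<equiv> monom 1 p" and "\<psi> \<equiv> monom 1 p + [:-1, 1:] ^ B"
    and "u \<equiv> [:- monom 1 p, 1:]"
begin

lemma tdeg_le_u: "0 < p \<Longrightarrow> tdeg_le p u"
proof -
  assume "0 < p"
  have "u = monom (monom (-1) p) 0 + monom (monom 1 0) 1"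
    by (simp add: u_def monom_0 monom_altdef minus_monom)
  moreover have "tdeg_le p (monom (monom (-1::'a) p) 0)" "tdeg_le p (monom (monom (1::'a) 0) 1)"
    by (rule tdeg_le_monom; use \<open>0 < p\<close> in simp)+
  ultimately show ?thesis by (simp only: tdeg_le_add)
qed

lemma u_arc: "poly u \<psi> = X ^ B" "pderiv u = 1"
  by (simp_all add: u_def \<psi>_def X_def pderiv_pCons)

text \<open>Let b = (x - 1)^B be the value of u on the arc. By Taylor expansion f - b f_y, taken on
  \<psi>, is c0(x, x^p) modulo b^2: the first-order terms from c0 and from u w cancel.\<close>

lemma layer0:
  assumes f: "f = c0 + u * w + u\<^sup>2 * z"
    and dvd: "X ^ N dvd poly f \<psi>" "X ^ S dvd poly (pderiv f) \<psi>"
    and num: "2 * B \<le> N" "B \<le> S"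
  shows "X ^ (2 * B) dvd poly c0 \<phi>"
proof -
  define b where "b = X ^ B"
  have b2: "X ^ (2 * B) = b\<^sup>2" by (simp add: b_def power_mult mult.commute)
  have \<psi>: "\<psi> = \<phi> + b" by (simp add: \<psi>_def \<phi>_def b_def X_def)
  obtain r where r: "poly c0 \<psi> = poly c0 \<phi> + b * poly (pderiv c0) \<phi> + b\<^sup>2 * r"
    using poly_taylor2 unfolding \<psi> by blast
  obtain r' where r': "poly (pderiv c0) \<psi> = poly (pderiv c0) \<phi> + b * r'"
    using poly_taylor1 unfolding \<psi> by blast
  have F0: "poly f \<psi> = poly c0 \<psi> + b * poly w \<psi> + b\<^sup>2 * poly z \<psi>"
    by (simp add: f u_arc b_def)
  have F1: "poly (pderiv f) \<psi> = poly (pderiv c0) \<psi> + poly w \<psi> + b * poly (pderiv w) \<psi>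
      + 2 * b * poly z \<psi> + b\<^sup>2 * poly (pderiv z) \<psi>"
    by (simp add: f pderiv_add pderiv_mult u_arc b_def power2_eq_square algebra_simps)
  have "poly c0 \<phi> = poly f \<psi> - b * poly (pderiv f) \<psi>
     + b\<^sup>2 * (r' - r + poly (pderiv w) \<psi> + poly z \<psi> + b * poly (pderiv z) \<psi>)"
    unfolding F0 F1 r r' by (simp add: algebra_simps power2_eq_square)
  moreover have "b\<^sup>2 dvd poly f \<psi>" unfolding b2[symmetric] using dvd(1) num(1)
    by (meson dvd_trans le_imp_power_dvd)
  moreover have "b\<^sup>2 dvd b * poly (pderiv f) \<psi>"
    unfolding power2_eq_square b_def using dvd(2) num(2)
    by (intro mult_dvd_mono dvd_refl) (meson dvd_trans le_imp_power_dvd)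
  ultimately show ?thesis unfolding b2 by simp
qed

text \<open>Now f is divisible by b on the arc, and 2 f / b - f_y equals w(x, x^p) modulo b^2. The
  factor 2 removes the contribution of z in order b.\<close>

lemma layer1:
  assumes f: "f = u * w + u\<^sup>2 * z"
    and dvd: "X ^ N dvd poly f \<psi>" "X ^ S dvd poly (pderiv f) \<psi>"
    and num: "B + S \<le> N" "S \<le> 2 * B"
  shows "X ^ S dvd poly w \<phi>"
proof -
  define b where "b = X ^ B"
  have bnz: "b \<noteq> 0" by (simp add: b_def X_def)
  have \<psi>: "\<psi> = \<phi> + b" by (simp add: \<psi>_def \<phi>_def b_def X_def)
  obtain r where r: "poly w \<psi> = poly w \<phi> + b * poly (pderiv w) \<phi> + b\<^sup>2 * r"
    using poly_taylor2 unfolding \<psi> by blast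
  obtain r' where r': "poly (pderiv w) \<psi> = poly (pderiv w) \<phi> + b * r'"
    using poly_taylor1 unfolding \<psi> by blast
  have F0: "poly f \<psi> = b * (poly w \<psi> + b * poly z \<psi>)"
    by (simp add: f u_arc b_def power2_eq_square algebra_simps)
  have F1: "poly (pderiv f) \<psi> = poly w \<psi> + b * poly (pderiv w) \<psi>
      + 2 * b * poly z \<psi> + b\<^sup>2 * poly (pderiv z) \<psi>"
    by (simp add: f pderiv_add pderiv_mult u_arc b_def power2_eq_square algebra_simps)
  have "X ^ (B + S) dvd poly f \<psi>" using dvd(1) num(1) by (meson dvd_trans le_imp_power_dvd)
  then have "b * X ^ S dvd b * (poly w \<psi> + b * poly z \<psi>)" by (simp only: F0 power_add b_def)
  then have 1: "X ^ S dvd poly w \<psi> + b * poly z \<psi>" using bnz by simp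
  have "X ^ S dvd X ^ (2 * B)" using num(2) by (rule le_imp_power_dvd)
  then have 2: "X ^ S dvd b\<^sup>2" by (simp add: b_def power_mult mult.commute)
  have "poly w \<phi> = 2 * (poly w \<psi> + b * poly z \<psi>) - poly (pderiv f) \<psi>
     + b\<^sup>2 * (r' - r + poly (pderiv z) \<psi>)"
    unfolding F1 unfolding r r' by (simp add: algebra_simps power2_eq_square)
  with 1 2 dvd(2) show ?thesis
    by (simp del: distrib_left_numeral)
qed

text \<open>Only f / b^2 = z on the arc is left, and the arc agrees with y = x^p modulo b; hence the
  restriction N \<le> 3 B.\<close>

lemma layer2:
  assumes f: "f = u\<^sup>2 * z" and dvd: "X ^ N dvd poly f \<psi>" and num: "2 * B \<le> N" "N \<le> 3 * B"
  shows "X ^ (N - 2 * B) dvd poly z \<phi>"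
proof -
  define b where "b = X ^ B"
  have bnz: "b \<noteq> 0" by (simp add: b_def X_def)
  have \<psi>: "\<psi> = \<phi> + b" by (simp add: \<psi>_def \<phi>_def b_def X_def)
  obtain r where r: "poly z \<psi> = poly z \<phi> + b * r"
    using poly_taylor1 unfolding \<psi> by blast
  have "N = 2 * B + (N - 2 * B)" using num by simp
  then have "b\<^sup>2 * X ^ (N - 2 * B) = X ^ N"
    by (metis b_def mult.commute power_add power_mult)
  then have "b\<^sup>2 * X ^ (N - 2 * B) dvd b\<^sup>2 * poly z \<psi>"
    using dvd by (simp add: f u_arc b_def)
  then have "X ^ (N - 2 * B) dvd poly z \<phi> + b * r" using bnz r by simp
  moreover have "X ^ (N - 2 * B) dvd b" unfolding b_def using num by (intro le_imp_power_dvd) simp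
  ultimately show ?thesis by (simp add: dvd_add_left_iff)
qed

text \<open>Injectivity is read off layer by layer. Each block has exactly as many monomials as the
  order of vanishing that its layer lemma provides, and the inequalities \<open>num\<close> are
  those that the three layer lemmas demand.\<close>

lemma interp_double:
  assumes p: "0 < p"
    and E0: "finite E0" "card E0 = 2 * B" "\<And>i j. (i, j) \<in> E0 \<Longrightarrow> i < p \<and> i + j \<le> d"
    and E1: "finite E1" "card E1 = S" "\<And>i j. (i, j) \<in> E1 \<Longrightarrow> i < p \<and> i + j + p \<le> d"
    and E2: "finite E2" "card E2 = N - 2 * B" "\<And>i j. (i, j) \<in> E2 \<Longrightarrow> i < p \<and> i + j + 2 * p \<le> d"
    and num: "2 * B \<le> N" "B \<le> S" "B + S \<le> N" "S \<le> 2 * B" "N \<le> 3 * B"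
  shows "interp d \<psi> (X ^ N) (X ^ S)"
  unfolding interp_def
proof (intro allI)
  fix P Q :: "'a poly"
  define J where "J = E0 <+> (E1 <+> E2)"
  define mono where "mono = (\<lambda>e::nat \<times> nat. monom (monom (1::'a) (fst e)) (snd e))"
  define f where "f = (\<lambda>j. case j of Inl e \<Rightarrow> mono e | Inr (Inl e) \<Rightarrow> u * mono e | Inr (Inr e) \<Rightarrow> u\<^sup>2 * mono e)"
  have finJ: "finite J" using E0 E1 E2 by (simp add: J_def)
  have bl: "(\<Sum>e\<in>E. smult [:c e:] (mono e)) = block E c" for E c
    by (simp add: block_def mono_def smult_monom)
  have comb: "(\<Sum>j\<in>J. smult [:c j:] (f j)) = block E0 (\<lambda>e. c (Inl e)) + u * block E1 (\<lambda>e. c (Inr (Inl e)))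
      + u\<^sup>2 * block E2 (\<lambda>e. c (Inr (Inr e)))" for c
    unfolding J_def using E0 E1 E2
    by (simp add: sum.Plus f_def bl[symmetric] sum_distrib_left)
  have deg: "tdeg_le d (f j)" if "j \<in> J" for j
  proof -
    have m: "tdeg_le (fst e + snd e) (mono e)" for e by (simp add: mono_def tdeg_le_monom)
    have "tdeg_le d (mono e)" if "e \<in> E0" for e
      using E0(3)[of "fst e" "snd e"] that by (intro tdeg_le_mono[OF m]) auto
    moreover have "tdeg_le d (u * mono e)" if "e \<in> E1" for e
      using E1(3)[of "fst e" "snd e"] that by (intro tdeg_le_mono[OF tdeg_le_mult[OF tdeg_le_u[OF p] m]]) auto
    moreover have "tdeg_le d (u\<^sup>2 * mono e)" if "e \<in> E2" for e
      using E2(3)[of "fst e" "snd e"] that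
      by (intro tdeg_le_mono[OF tdeg_le_mult[OF tdeg_le_power[OF tdeg_le_u[OF p]] m]]) auto
    ultimately show ?thesis using that by (auto simp: J_def f_def)
  qed
  have comb_arc: "(\<Sum>j\<in>J. smult (c j) (poly (f j) \<psi>)) = poly (\<Sum>j\<in>J. smult [:c j:] (f j)) \<psi>"
    "(\<Sum>j\<in>J. smult (c j) (poly (pderiv (f j)) \<psi>)) = poly (pderiv (\<Sum>j\<in>J. smult [:c j:] (f j))) \<psi>" for c
    by (simp_all add: poly_sum higher_pderiv_sum[of 1, simplified] pderiv_smult)
  have "\<exists>c. X ^ N dvd (\<Sum>j\<in>J. smult (c j) (poly (f j) \<psi>)) - P
      \<and> X ^ S dvd (\<Sum>j\<in>J. smult (c j) (poly (pderiv (f j)) \<psi>)) - Q"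
  proof (rule surjective_of_injective[OF finJ])
    have "card J = 2 * B + (S + (N - 2 * B))" using E0 E1 E2 by (simp add: J_def card_Plus)
    also have "\<dots> = N + S" using num by simp
    finally show "card J = degree (X ^ N) + degree (X ^ S)" by (simp add: X_def degree_power_eq)
    fix c
    assume "X ^ N dvd (\<Sum>j\<in>J. smult (c j) (poly (f j) \<psi>))"
      and "X ^ S dvd (\<Sum>j\<in>J. smult (c j) (poly (pderiv (f j)) \<psi>))"
    then have dvd: "X ^ N dvd poly (\<Sum>j\<in>J. smult [:c j:] (f j)) \<psi>"
      "X ^ S dvd poly (pderiv (\<Sum>j\<in>J. smult [:c j:] (f j))) \<psi>"
      unfolding comb_arc .
    have blz: "block E e = 0" if "\<forall>x\<in>E. e x = (0::'a)" for E e
      using that by (simp add: block_def)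
    have c0: "\<forall>e\<in>E0. c (Inl e) = 0"
    proof (rule block_eq_0)
      show "[:-1, 1:] ^ (2 * B) dvd poly (block E0 (\<lambda>e. c (Inl e))) (monom 1 p)"
        using layer0[OF comb dvd num(1,2)] by (simp add: X_def \<phi>_def)
    qed (use E0 in auto)
    then have comb1: "(\<Sum>j\<in>J. smult [:c j:] (f j)) = u * block E1 (\<lambda>e. c (Inr (Inl e)))
      + u\<^sup>2 * block E2 (\<lambda>e. c (Inr (Inr e)))"
      unfolding comb by (simp add: blz)
    have c1: "\<forall>e\<in>E1. c (Inr (Inl e)) = 0"
    proof (rule block_eq_0)
      show "[:-1, 1:] ^ S dvd poly (block E1 (\<lambda>e. c (Inr (Inl e)))) (monom 1 p)"
        using layer1[OF comb1 dvd num(3,4)] by (simp add: X_def \<phi>_def)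
    qed (use E1 in auto)
    then have comb2: "(\<Sum>j\<in>J. smult [:c j:] (f j)) = u\<^sup>2 * block E2 (\<lambda>e. c (Inr (Inr e)))"
      unfolding comb1 by (simp add: blz)
    have c2: "\<forall>e\<in>E2. c (Inr (Inr e)) = 0"
    proof (rule block_eq_0)
      show "[:-1, 1:] ^ (N - 2 * B) dvd poly (block E2 (\<lambda>e. c (Inr (Inr e)))) (monom 1 p)"
        using layer2[OF comb2 dvd(1) num(1,5)] by (simp add: X_def \<phi>_def)
    qed (use E2 in auto)
    show "\<forall>j\<in>J. c j = 0" using c0 c1 c2 by (auto simp: J_def)
  qed (auto simp: X_def)
  then obtain c where "X ^ N dvd (\<Sum>j\<in>J. smult (c j) (poly (f j) \<psi>)) - P"
      "X ^ S dvd (\<Sum>j\<in>J. smult (c j) (poly (pderiv (f j)) \<psi>)) - Q" by blast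
  then show "\<exists>f. tdeg_le d f \<and> X ^ N dvd poly f \<psi> - P \<and> X ^ S dvd poly (pderiv f) \<psi> - Q"
    unfolding comb_arc by (intro exI[of _ "\<Sum>j\<in>J. smult [:c j:] (f j)"]) (auto intro: tdeg_le_sum tdeg_le_smult deg)
qed

text \<open>The same elimination without the condition on f_y. Since S \<le> 2 B, two layers
  suffice, and agreement of the arc with y = x^p modulo b is enough. It serves the degrees d - 3 and
  2.\<close>

lemma interp_simple:
  assumes p: "0 < p"
    and E0: "finite E0" "card E0 = M" "\<And>i j. (i, j) \<in> E0 \<Longrightarrow> i < p \<and> i + j \<le> d"
    and E1: "finite E1" "card E1 = S - B" "\<And>i j. (i, j) \<in> E1 \<Longrightarrow> i < p \<and> i + j + p \<le> d"
    and num: "M = min B S" "S \<le> 2 * B"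
  shows "interp d \<psi> (X ^ S) 1"
  unfolding interp_def
proof (intro allI)
  fix P Q :: "'a poly"
  define J where "J = E0 <+> E1"
  define mono where "mono = (\<lambda>e::nat \<times> nat. monom (monom (1::'a) (fst e)) (snd e))"
  define f where "f = (\<lambda>j. case j of Inl e \<Rightarrow> mono e | Inr e \<Rightarrow> u * mono e)"
  define b where "b = X ^ B"
  have bnz: "b \<noteq> 0" by (simp add: b_def X_def)
  have \<psi>: "\<psi> = \<phi> + b" by (simp add: \<psi>_def \<phi>_def b_def X_def)
  have finJ: "finite J" using E0 E1 by (simp add: J_def)
  have bl: "(\<Sum>e\<in>E. smult [:c e:] (mono e)) = block E c" for E c
    by (simp add: block_def mono_def smult_monom)
  have comb: "(\<Sum>j\<in>J. smult [:c j:] (f j)) = block E0 (\<lambda>e. c (Inl e)) + u * block E1 (\<lambda>e. c (Inr e))" for c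
    unfolding J_def using E0 E1 by (simp add: sum.Plus f_def bl[symmetric] sum_distrib_left)
  have deg: "tdeg_le d (f j)" if "j \<in> J" for j
  proof -
    have m: "tdeg_le (fst e + snd e) (mono e)" for e by (simp add: mono_def tdeg_le_monom)
    have "tdeg_le d (mono e)" if "e \<in> E0" for e
      using E0(3)[of "fst e" "snd e"] that by (intro tdeg_le_mono[OF m]) auto
    moreover have "tdeg_le d (u * mono e)" if "e \<in> E1" for e
      using E1(3)[of "fst e" "snd e"] that by (intro tdeg_le_mono[OF tdeg_le_mult[OF tdeg_le_u[OF p] m]]) auto
    ultimately show ?thesis using that by (auto simp: J_def f_def)
  qed
  have comb_arc: "(\<Sum>j\<in>J. smult (c j) (poly (f j) \<psi>)) = poly (\<Sum>j\<in>J. smult [:c j:] (f j)) \<psi>" for c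
    by (simp_all add: poly_sum)
  have "\<exists>c. X ^ S dvd (\<Sum>j\<in>J. smult (c j) (poly (f j) \<psi>)) - P \<and> 1 dvd (\<Sum>j\<in>J. smult (c j) 0) - Q"
  proof (rule surjective_of_injective[OF finJ])
    have "card J = S" using E0 E1 num by (simp add: J_def card_Plus)
    then show "card J = degree (X ^ S) + degree (1::'a poly)" by (simp add: X_def degree_power_eq)
    fix c
    assume "X ^ S dvd (\<Sum>j\<in>J. smult (c j) (poly (f j) \<psi>))"
    then have dvd: "X ^ S dvd poly (\<Sum>j\<in>J. smult [:c j:] (f j)) \<psi>"
      unfolding comb_arc .
    have blz: "block E e = 0" if "\<forall>x\<in>E. e x = (0::'a)" for E e
      using that by (simp add: block_def)
    have c0: "\<forall>e\<in>E0. c (Inl e) = 0"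
    proof (rule block_eq_0)
      obtain r where r: "poly (block E0 (\<lambda>e. c (Inl e))) \<psi> = poly (block E0 (\<lambda>e. c (Inl e))) \<phi> + b * r"
        using poly_taylor1 unfolding \<psi> by blast
      have "X ^ M dvd poly (\<Sum>j\<in>J. smult [:c j:] (f j)) \<psi>"
        using dvd num by (meson dvd_trans le_imp_power_dvd min.cobounded2)
      also have "poly (\<Sum>j\<in>J. smult [:c j:] (f j)) \<psi> =
          poly (block E0 (\<lambda>e. c (Inl e))) \<phi> + b * (r + poly (block E1 (\<lambda>e. c (Inr e))) \<psi>)"
        by (simp add: comb r u_arc b_def algebra_simps)
      finally have "X ^ M dvd \<dots>" .
      moreover have "X ^ M dvd b" unfolding b_def using num by (intro le_imp_power_dvd) simp
      ultimately show "[:-1, 1:] ^ M dvd poly (block E0 (\<lambda>e. c (Inl e))) (monom 1 p)"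
        by (simp add: X_def \<phi>_def dvd_add_left_iff)
    qed (use E0 in auto)
    have c1: "\<forall>e\<in>E1. c (Inr e) = 0"
    proof (cases "S \<le> B")
      case True
      then show ?thesis using E1 by auto
    next
      case False
      show ?thesis
      proof (rule block_eq_0)
        obtain r where r: "poly (block E1 (\<lambda>e. c (Inr e))) \<psi> = poly (block E1 (\<lambda>e. c (Inr e))) \<phi> + b * r"
          using poly_taylor1 unfolding \<psi> by blast
        have "b * X ^ (S - B) = X ^ S" using False by (simp add: b_def flip: power_add)
        then have "b * X ^ (S - B) dvd b * poly (block E1 (\<lambda>e. c (Inr e))) \<psi>"
          using dvd c0 by (simp add: comb blz u_arc b_def)
        then have "X ^ (S - B) dvd poly (block E1 (\<lambda>e. c (Inr e))) \<phi> + b * r" using bnz r by simp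
        moreover have "X ^ (S - B) dvd b" unfolding b_def using num by (intro le_imp_power_dvd) simp
        ultimately show "[:-1, 1:] ^ (S - B) dvd poly (block E1 (\<lambda>e. c (Inr e))) (monom 1 p)"
          by (simp add: X_def \<phi>_def dvd_add_left_iff)
      qed (use E1 in auto)
    qed
    show "\<forall>j\<in>J. c j = 0" using c0 c1 by (auto simp: J_def)
  qed (auto simp: X_def)
  then obtain c where "X ^ S dvd (\<Sum>j\<in>J. smult (c j) (poly (f j) \<psi>)) - P" by blast
  then show "\<exists>f. tdeg_le d f \<and> X ^ S dvd poly f \<psi> - P \<and> 1 dvd poly (pderiv f) \<psi> - Q"
    unfolding comb_arc by (intro exI[of _ "\<Sum>j\<in>J. smult [:c j:] (f j)"]) (auto intro: tdeg_le_sum tdeg_le_smult deg)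
qed

end

section \<open>Counting monomials and choosing p and B\<close>

definition staircase :: "nat \<Rightarrow> nat \<Rightarrow> (nat \<times> nat) set" where
  "staircase p e = {(i, j). i < p \<and> i + j \<le> e}"

lemma finite_staircase: "finite (staircase p e)"
  by (rule finite_subset[of _ "{..<p} \<times> {..e}"]) (auto simp: staircase_def)

text \<open>The form of the equation avoids division and subtraction. The bound e + 2 admits one
  empty last column, for which the formula still holds.\<close>

lemma card_staircase:
  assumes "p \<le> e + 2"
  shows "2 * card (staircase p e) + p * p = 2 * p * (e + 1) + p"
  using assms
proof (induction p)
  case 0
  then show ?case by (simp add: staircase_def)
next
  case (Suc p)
  have "staircase (Suc p) e = staircase p e \<union> Pair p ` {j. p + j \<le> e}"
    by (auto simp: staircase_def less_Suc_eq)
  moreover have "{j. p + j \<le> e} = {..<e + 1 - p}" by auto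
  moreover have "staircase p e \<inter> Pair p ` {..<e + 1 - p} = {}" by (auto simp: staircase_def)
  ultimately have "card (staircase (Suc p) e) = card (staircase p e) + (e + 1 - p)"
    by (simp add: card_Un_disjoint finite_staircase card_image inj_on_def)
  then show ?case using Suc by (simp add: algebra_simps)
qed

lemma staircase_subset:
  assumes "m \<le> card (staircase p e)"
  obtains E where "finite E" "card E = m" "\<And>i j. (i, j) \<in> E \<Longrightarrow> i < p \<and> i + j \<le> e"
proof -
  obtain E where "E \<subseteq> staircase p e" "card E = m" "finite E"
    using assms obtain_subset_with_card_n by metis
  then show thesis by (intro that[of E]) (auto simp: staircase_def)
qed

lemma interp_from_counts:
  fixes p B S d :: nat
  assumes d: "2 * p + 1 \<le> d" "p + 3 \<le> d" and p: "0 < p"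
    and n0: "2 * B \<le> card (staircase p (d - 1))"
    and n1: "S \<le> card (staircase p (d - 1 - p))"
    and n2: "2 * S - 1 - 2 * B \<le> card (staircase p (d - 1 - 2 * p)) \<or> 2 * S - 1 - 2 * B = 0"
    and m0: "B \<le> card (staircase p (d - 3))" and m1: "S - B \<le> card (staircase p (d - 3 - p))"
    and num: "B + 1 \<le> S" "S \<le> 2 * B" "2 * S - 1 \<le> 3 * B"
  defines "\<psi> \<equiv> monom 1 p + [:-1, 1:] ^ B :: 'a::field_char_0 poly"
  shows "interp (d - 1) \<psi> ([:-1, 1:] ^ (2 * S - 1)) ([:-1, 1:] ^ S)"
    and "interp (d - 3) \<psi> ([:-1, 1:] ^ S) 1"
proof -
  obtain E0 where E0: "finite E0" "card E0 = 2 * B" "\<And>i j. (i, j) \<in> E0 \<Longrightarrow> i < p \<and> i + j \<le> d - 1"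
    using staircase_subset[OF n0] by blast
  obtain E1 where E1: "finite E1" "card E1 = S" "\<And>i j. (i, j) \<in> E1 \<Longrightarrow> i < p \<and> i + j \<le> d - 1 - p"
    using staircase_subset[OF n1] by blast
  obtain E2 where E2: "finite E2" "card E2 = 2 * S - 1 - 2 * B"
      "\<And>i j. (i, j) \<in> E2 \<Longrightarrow> i < p \<and> i + j \<le> d - 1 - 2 * p"
    using n2 staircase_subset[of "2 * S - 1 - 2 * B" p "d - 1 - 2 * p"] by (metis card.empty empty_iff finite.emptyI)
  show "interp (d - 1) \<psi> ([:-1, 1:] ^ (2 * S - 1)) ([:-1, 1:] ^ S)"
    unfolding \<psi>_def
  proof (rule interp_double[OF p E0 E1(1,2) _ E2(1,2)])
    show "i < p \<and> i + j + p \<le> d - 1" if "(i, j) \<in> E1" for i j using E1(3)[OF that] d by auto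
    show "i < p \<and> i + j + 2 * p \<le> d - 1" if "(i, j) \<in> E2" for i j using E2(3)[OF that] d by auto
  qed (use num in auto)
  obtain D0 where D0: "finite D0" "card D0 = B" "\<And>i j. (i, j) \<in> D0 \<Longrightarrow> i < p \<and> i + j \<le> d - 3"
    using staircase_subset[OF m0] by blast
  obtain D1 where D1: "finite D1" "card D1 = S - B" "\<And>i j. (i, j) \<in> D1 \<Longrightarrow> i < p \<and> i + j \<le> d - 3 - p"
    using staircase_subset[OF m1] by blast
  show "interp (d - 3) \<psi> ([:-1, 1:] ^ S) 1"
    unfolding \<psi>_def
  proof (rule interp_simple[OF p D0 D1(1,2)])
    show "i < p \<and> i + j + p \<le> d - 3" if "(i, j) \<in> D1" for i j using D1(3)[OF that] d by auto
  qed (use num in auto)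
qed

text \<open>Since B \<ge> 4, the arc agrees with y = x^p to order 4 at x = 1, and there 1, x, y, x y
  restrict to four distinct monomials. This later bounds the contact of lines with the
  scheme.\<close>

lemma interp_conics:
  fixes p B :: nat
  assumes "2 \<le> p" "4 \<le> B"
  shows "interp 2 (monom 1 p + [:-1, 1:] ^ B :: 'a::field_char_0 poly) ([:-1, 1:] ^ 4) 1"
  by (rule interp_simple[where M = 4 and ?E0.0 = "{(0,0), (1,0), (0,1), (1,1)}" and ?E1.0 = "{}"])
     (use assms in auto)

lemma interp_exists:
  fixes d :: nat
  assumes "6 \<le> d"
  defines "S \<equiv> d * (d + 1) div 6"
  shows "\<exists>\<psi> :: 'a::field_char_0 poly. interp (d - 1) \<psi> ([:-1, 1:] ^ (2 * S - 1)) ([:-1, 1:] ^ S)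
     \<and> interp (d - 3) \<psi> ([:-1, 1:] ^ S) 1 \<and> interp 2 \<psi> ([:-1, 1:] ^ 4) 1"
proof -
  \<comment> \<open>The demands of the interpolation lemmas in additive form. In each residue class
    of d modulo 3 they become linear inequalities in p and K = p^2.\<close>
  have suff: ?thesis if "2 \<le> p" "4 \<le> B" "2 * p + 1 \<le> d" "p + 3 \<le> d"
    "c0 = card (staircase p (d - 1))" "c1 = card (staircase p (d - 1 - p))"
    "c2 = card (staircase p (d - 1 - 2 * p))" "e0 = card (staircase p (d - 3))"
    "e1 = card (staircase p (d - 3 - p))"
    "2 * B \<le> c0" "S \<le> c1" "2 * S \<le> c2 + 2 * B + 1" "B \<le> e0" "S \<le> e1 + B"
    "B + 1 \<le> S" "S \<le> 2 * B" "2 * S \<le> 3 * B + 1" for p B c0 c1 c2 e0 e1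
  proof -
    have "S - B \<le> e1" "2 * S - 1 - 2 * B \<le> c2" "2 * S - 1 \<le> 3 * B" using that(10-17) by arith+
    then show ?thesis
      using interp_from_counts[of p d B S, where 'a = 'a] interp_conics[of p B, where 'a = 'a] that by auto
  qed
  have "d mod 3 < 3" by simp
  then consider k where "d = 3 * k" | k where "d = 3 * k + 2" | k where "d = 3 * k + 1"
    by (metis One_nat_def Suc_1 add.right_neutral less_Suc_eq mult_div_mod_eq not_less_zero numeral_3_eq_3)
  then show ?thesis
  proof cases
    case 1
    then have k: "2 \<le> k" using assms by simp
    define K where "K = k * k"
    have K: "2 * k \<le> K" "4 \<le> K" using k mult_le_mono[OF k k] by (auto simp: K_def)
    have "even (k * (3 * k + 1))" by simp
    then obtain m where m: "k * (3 * k + 1) = 2 * m" by blast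
    have "d * (d + 1) = 3 * (k * (3 * k + 1))" using 1 by (simp add: algebra_simps)
    then have "S = m" using m by (simp add: S_def)
    then have S: "2 * S = 3 * K + k" using m by (simp add: K_def algebra_simps)
    define B where "B = card (staircase k (d - 1)) div 2"
    have n0: "2 * card (staircase k (d - 1)) = 5 * K + k"
      using card_staircase[of k "d - 1"] 1 k by (simp add: K_def algebra_simps)
    have e1: "d - 1 - k = 2 * k - 1" "d - 1 - 2 * k = k - 1" "d - 3 - k = 2 * k - 3" using 1 k by auto
    have n1: "2 * card (staircase k (d - 1 - k)) = 3 * K + k"
      using card_staircase[of k "d - 1 - k"] 1 k unfolding e1 by (simp add: K_def algebra_simps)
    have n2: "2 * card (staircase k (d - 1 - 2 * k)) = K + k"
      using card_staircase[of k "d - 1 - 2 * k"] 1 k unfolding e1 by (simp add: K_def algebra_simps)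
    obtain l where l: "k = l + 2" using k by (metis add.commute le_Suc_ex)
    have e2: "d - 3 = 3 * l + 3" "d - 3 - k = 2 * l + 1" using 1 l by auto
    have m0: "2 * card (staircase k (d - 3)) + 3 * k = 5 * K"
      using card_staircase[of k "d - 3"] unfolding e2 by (simp add: l K_def algebra_simps)
    have m1: "2 * card (staircase k (d - 3 - k)) + 3 * k = 3 * K"
      using card_staircase[of k "d - 3 - k"] unfolding e2 by (simp add: l K_def algebra_simps)
    have B: "2 * B \<le> card (staircase k (d - 1))" "card (staircase k (d - 1)) \<le> 2 * B + 1"
      unfolding B_def by linarith+
    define c0 c1 c2 f0 f1 where "c0 = card (staircase k (d - 1))" and "c1 = card (staircase k (d - 1 - k))"
      and "c2 = card (staircase k (d - 1 - 2 * k))" and "f0 = card (staircase k (d - 3))"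
      and "f1 = card (staircase k (d - 3 - k))"
    note c = this
    note num = n0[folded c] n1[folded c] n2[folded c] m0[folded c] m1[folded c] B[folded c]
    show ?thesis
      by (rule suff[OF _ _ _ _ c, where B = B]) (use k K S 1 num in linarith)+
  next
    case 2
    then have k: "2 \<le> k" using assms by simp
    define p where "p = k + 1"
    have p: "3 \<le> p" and d: "d = 3 * p - 1" using k 2 by (auto simp: p_def)
    define K where "K = p * p"
    have K: "3 * p \<le> K" using mult_le_mono[OF p order_refl[of p]] by (auto simp: K_def)
    have "even ((k + 1) * (3 * k + 2))" by simp
    then obtain m where m: "(k + 1) * (3 * k + 2) = 2 * m" by blast
    have "d * (d + 1) = 3 * ((k + 1) * (3 * k + 2))" using 2 by (simp add: algebra_simps)
    then have "S = m" using m by (simp add: S_def)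
    then have S: "2 * S + p = 3 * K" using m by (simp add: K_def p_def algebra_simps)
    define B where "B = card (staircase p (d - 1)) div 2"
    have n0: "2 * card (staircase p (d - 1)) + p = 5 * K"
      using card_staircase[of p "d - 1"] 2 k by (simp add: K_def p_def algebra_simps)
    have e1: "d - 1 - p = 2 * k" "d - 1 - 2 * p = k - 1" "d - 3 - p = 2 * k - 2"
      using 2 k by (auto simp: p_def)
    have n1: "2 * card (staircase p (d - 1 - p)) + p = 3 * K"
      using card_staircase[of p "d - 1 - p"] 2 k unfolding e1 by (simp add: K_def p_def algebra_simps)
    have n2: "2 * card (staircase p (d - 1 - 2 * p)) + p = K"
      using card_staircase[of p "d - 1 - 2 * p"] 2 k unfolding e1 by (simp add: K_def p_def algebra_simps)
    obtain l where l: "k = l + 2" using k by (metis add.commute le_Suc_ex)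
    have e2: "d - 3 = 3 * l + 5" "d - 3 - p = 2 * l + 2" using 2 l by (auto simp: p_def)
    have m0: "2 * card (staircase p (d - 3)) + 5 * p = 5 * K"
      using card_staircase[of p "d - 3"] unfolding e2 by (simp add: l p_def K_def algebra_simps)
    have m1: "2 * card (staircase p (d - 3 - p)) + 5 * p = 3 * K"
      using card_staircase[of p "d - 3 - p"] unfolding e2 by (simp add: l p_def K_def algebra_simps)
    have B: "2 * B \<le> card (staircase p (d - 1))" "card (staircase p (d - 1)) \<le> 2 * B + 1"
      unfolding B_def by linarith+
    define c0 c1 c2 f0 f1 where "c0 = card (staircase p (d - 1))" and "c1 = card (staircase p (d - 1 - p))"
      and "c2 = card (staircase p (d - 1 - 2 * p))" and "f0 = card (staircase p (d - 3))"
      and "f1 = card (staircase p (d - 3 - p))"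
    note c = this
    note num = n0[folded c] n1[folded c] n2[folded c] m0[folded c] m1[folded c] B[folded c]
    show ?thesis
      by (rule suff[OF _ _ _ _ c, where B = B]) (use k p_def 2 K S num in linarith)+
  next
    case 3
    then have k: "2 \<le> k" using assms by simp
    define p where "p = k + 1"
    have p: "3 \<le> p" and d: "d = 3 * p - 2" using k 3 by (auto simp: p_def)
    define K where "K = p * p"
    have K: "3 * p \<le> K" using mult_le_mono[OF p order_refl[of p]] by (auto simp: K_def)
    have K4: "p = 3 \<and> K = 9 \<or> 3 * p + 2 \<le> K"
    proof (cases "p = 3")
      case False
      then have "4 * p \<le> K" using p by (simp add: K_def)
      then show ?thesis using p False by linarith
    qed (simp add: K_def)
    have "even (k * (k + 1))" by simp
    then obtain m where m: "k * (k + 1) = 2 * m" by blast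
    have "d * (d + 1) = 9 * (k * (k + 1)) + 2" using 3 by (simp add: algebra_simps)
    then have "d * (d + 1) = 2 + (3 * m) * 6" using m by simp
    then have "S = 3 * m" by (simp add: S_def)
    then have S: "2 * S + 3 * p = 3 * K" using m by (simp add: K_def p_def algebra_simps)
    \<comment> \<open>The subtraction is needed for d = 7: there the first layer has 18 monomials
      and S = 9, so that half of it would violate B + 1 \<le> S.\<close>
    define B where "B = (card (staircase p (d - 1)) - 1) div 2"
    have n0: "2 * card (staircase p (d - 1)) + 3 * p = 5 * K"
      using card_staircase[of p "d - 1"] 3 k by (simp add: K_def p_def algebra_simps)
    have e1: "d - 1 - p = 2 * k - 1" "d - 1 - 2 * p = k - 2" "d - 3 - p = 2 * k - 3"
      using 3 k by (auto simp: p_def)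
    have n1: "2 * card (staircase p (d - 1 - p)) + 3 * p = 3 * K"
      using card_staircase[of p "d - 1 - p"] 3 k unfolding e1 by (simp add: K_def p_def algebra_simps)
    \<comment> \<open>For height k - 2 the formula \<open>card_staircase\<close> reaches only width
      k = p - 1; a lower bound for width p is enough.\<close>
    have "staircase k (k - 2) \<subseteq> staircase p (k - 2)" by (auto simp: staircase_def p_def)
    then have "card (staircase k (k - 2)) \<le> card (staircase p (k - 2))"
      by (intro card_mono finite_staircase)
    moreover have "2 * card (staircase k (k - 2)) + k = k * k"
    proof -
      have "k - 2 + 1 = k - 1" using k by simp
      then have "2 * card (staircase k (k - 2)) + k * k = 2 * k * (k - 1) + k"
        using card_staircase[of k "k - 2"] k by simp
      moreover have "2 * k * (k - 1) + 2 * k = 2 * (k * k)" by (cases k) (auto simp: algebra_simps)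
      ultimately show ?thesis by linarith
    qed
    moreover have "k * k + 2 * p = K + 1" by (simp add: K_def p_def algebra_simps)
    ultimately have n2: "K + 2 \<le> 2 * card (staircase p (d - 1 - 2 * p)) + 3 * p"
      using p_def unfolding e1 by linarith
    obtain l where l: "k = l + 2" using k by (metis add.commute le_Suc_ex)
    have e2: "d - 3 = 3 * l + 4" "d - 3 - p = 2 * l + 1" using 3 l by (auto simp: p_def)
    have m0: "2 * card (staircase p (d - 3)) + 7 * p = 5 * K"
      using card_staircase[of p "d - 3"] unfolding e2 by (simp add: l p_def K_def algebra_simps)
    have m1: "2 * card (staircase p (d - 3 - p)) + 7 * p = 3 * K"
      using card_staircase[of p "d - 3 - p"] unfolding e2 by (simp add: l p_def K_def algebra_simps)
    have B: "2 * B + 1 \<le> card (staircase p (d - 1))" "card (staircase p (d - 1)) \<le> 2 * B + 2"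
      using n0 K p unfolding B_def by linarith+
    define c0 c1 c2 f0 f1 where "c0 = card (staircase p (d - 1))" and "c1 = card (staircase p (d - 1 - p))"
      and "c2 = card (staircase p (d - 1 - 2 * p))" and "f0 = card (staircase p (d - 3))"
      and "f1 = card (staircase p (d - 3 - p))"
    note c = this
    note num = n0[folded c] n1[folded c] n2[folded c] m0[folded c] m1[folded c] B[folded c]
    show ?thesis
      by (rule suff[OF _ _ _ _ c, where B = B]) (use k p_def 3 K K4 S num in linarith)+
  qed
qed

section \<open>The linear system of curves with prescribed singularities\<close>

lemma bezout_of_no_common_root:
  fixes p q :: "'k::alg_closed_field poly"
  assumes "\<And>a. \<not> (poly p a = 0 \<and> poly q a = 0)"
  shows "\<exists>A B. A * p + B * q = 1"
proof -
  define S where "S = {h. h \<noteq> 0 \<and> (\<exists>A B. h = A * p + B * q)}"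
  have "p \<noteq> 0 \<or> q \<noteq> 0" using assms by auto
  then have "p \<in> S \<or> q \<in> S"
    unfolding S_def by (metis (mono_tags, lifting) add.right_neutral add_0 mem_Collect_eq mult_1 mult_zero_left)
  then obtain h where h: "h \<in> S" and min: "\<And>h'. h' \<in> S \<Longrightarrow> degree h \<le> degree h'"
    using ex_has_least_nat[of "\<lambda>h. h \<in> S" _ degree] by metis
  obtain A B where AB: "h = A * p + B * q" "h \<noteq> 0" using h by (auto simp: S_def)
  have dvd: "h dvd f" if "f = A' * p + B' * q" for f A' B'
  proof (rule ccontr)
    assume "\<not> h dvd f"
    then have nz: "f mod h \<noteq> 0" by (simp add: mod_eq_0_iff_dvd)
    define k where "k = f div h"
    have "f mod h = f - k * h" by (simp add: k_def minus_div_mult_eq_mod)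
    then have "f mod h = (A' - k * A) * p + (B' - k * B) * q"
      unfolding AB(1) that by (simp add: algebra_simps)
    with nz have "f mod h \<in> S" by (auto simp: S_def)
    from min[OF this] degree_mod_less[OF AB(2), of f] nz show False by auto
  qed
  have "h dvd p" "h dvd q" using dvd[of p 1 0] dvd[of q 0 1] by auto
  have "degree h = 0"
  proof (rule ccontr)
    assume "degree h \<noteq> 0"
    then obtain a where "poly h a = 0" using alg_closed_imp_poly_has_root[of h] by auto
    then have "poly p a = 0" "poly q a = 0"
      using \<open>h dvd p\<close> \<open>h dvd q\<close> by (auto elim!: dvdE)
    with assms show False by blast
  qed
  then obtain c where c: "h = [:c:]" using degree0_coeffs by blast
  with AB(2) have "c \<noteq> 0" by auto
  have "smult (1 / c) A * p + smult (1 / c) B * q = smult (1 / c) h" by (simp add: AB smult_add_right)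
  also have "\<dots> = 1" using c \<open>c \<noteq> 0\<close> by (simp add: one_pCons)
  finally show ?thesis by blast
qed

lemma degree_poly_arc:
  assumes f: "tdeg_le e f" and l: "degree v \<le> 1"
  shows "degree (poly f v) \<le> e"
  unfolding poly_altdef
proof (rule degree_sum_le)
  fix j assume "j \<in> {..degree f}"
  show "degree (coeff f j * v ^ j) \<le> e"
  proof (cases "coeff f j = 0")
    case False
    then have "degree (coeff f j) + j \<le> e" using f by (auto simp: tdeg_le_def)
    moreover have "degree (v ^ j) \<le> j"
      using degree_power_le[of v j] mult_le_mono1[OF l, of j] by (metis le_trans nat_mult_1)
    ultimately show ?thesis using degree_mult_le[of "coeff f j" "v ^ j"] by linarith
  qed simp
qed simp

lemma division_by_graph: "\<exists>s. f = [:poly f v:] + [:-v, 1:] * s" for f :: "'a::comm_ring_1 poly"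
  using synthetic_div_correct'[of v f] by (metis add.commute)

lemma smult_const_minus: "smult [:- s:] f = - smult [:s:] (f :: 'a::comm_ring_1 poly poly)"
  by (rule poly_eqI) simp

lemma tdeg_le_decomp:
  assumes "tdeg_le (Suc e) f"
  shows "\<exists>c f1 f2. f = [:[:c:]:] + [:[:0, 1:]:] * f1 + [:0, 1:] * f2 \<and> tdeg_le e f1 \<and> tdeg_le e f2"
proof -
  obtain h f2 where f: "f = pCons h f2" by (cases f)
  obtain c h1 where h: "h = pCons c h1" by (cases h)
  have "coeff (coeff f (Suc j)) i = coeff (coeff f2 j) i" for i j by (simp add: f)
  then have "tdeg_le e f2" using assms unfolding tdeg_le_def by (metis Suc_le_mono add_Suc_right)
  moreover have "tdeg_le e [:h1:]"
  proof -
    have "coeff h1 i \<noteq> 0 \<Longrightarrow> i \<le> e" for i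
    proof -
      assume "coeff h1 i \<noteq> 0"
      then have "coeff (coeff f 0) (Suc i) \<noteq> 0" by (simp add: f h)
      then have "Suc i + 0 \<le> Suc e" using assms unfolding tdeg_le_def by blast
      then show ?thesis by simp
    qed
    then have "degree h1 \<le> e" by (cases "h1 = 0") auto
    then show ?thesis by (rule tdeg_le_const)
  qed
  moreover have "f = [:[:c:]:] + [:[:0, 1:]:] * [:h1:] + [:0, 1:] * f2" by (simp add: f h)
  ultimately show ?thesis by blast
qed

text \<open>The curve \<open>f\<close> contains the scheme iff \<open>M\<close> divides \<open>f(x, \<psi>(x))\<close> and \<open>g\<close> divides
  \<open>(\<partial>f/\<partial>y)(x, \<psi>(x))\<close>; the pair \<open>(m j, r j)\<close> is \<open>(2 t, t)\<close> at a tacnode of order \<open>t\<close> and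
  \<open>(2 n + 1, n + 1)\<close> at a cusp of order \<open>n\<close>.\<close>

locale scheme =
  fixes d n :: nat and m r :: "nat \<Rightarrow> nat" and x :: "nat \<Rightarrow> 'k::{alg_closed_field, field_char_0}"
    and \<psi> M g :: "'k poly" and e0 :: "'k poly poly"
  defines "M \<equiv> \<Prod>j<n. [:- x j, 1:] ^ m j" and "g \<equiv> \<Prod>j<n. [:- x j, 1:] ^ r j"
  assumes d6: "6 \<le> d" and inj: "inj_on x {..<n}"
    and mr: "\<And>j. j < n \<Longrightarrow> 0 < r j \<and> r j < m j \<and> (m j = 2 * r j \<or> m j + 1 = 2 * r j)"
    and sum_r: "4 \<le> (\<Sum>j<n. r j)"
    and decomp: "\<And>f. \<exists>p i c. tdeg_le (d - 1) p \<and> M dvd poly i \<psi> \<and> g dvd poly (pderiv i) \<psi>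
        \<and> f = p + i + smult [:c:] e0"
    and cusp_e0: "\<And>j. j < n \<Longrightarrow> m j + 1 = 2 * r j \<Longrightarrow> M dvd poly e0 \<psi> \<and> g dvd poly (pderiv e0) \<psi>"
    and conics: "\<And>k. (\<And>j. j < n \<Longrightarrow> k j \<le> r j) \<Longrightarrow> (\<Sum>j<n. k j) = 4 \<Longrightarrow>
        interp 2 \<psi> (\<Prod>j<n. [:- x j, 1:] ^ k j) 1"
begin

text \<open>The ideal of the scheme. By \<open>decomp\<close>, degree d - 1 and the single element
  \<open>e0\<close> span all polynomials modulo this ideal. By \<open>cusp_e0\<close>, as soon as
  some point is a cusp, \<open>e0\<close> lies in the ideal, so that no condition is lost.\<close>

definition inI :: "'k poly poly \<Rightarrow> bool" where
  "inI f \<longleftrightarrow> M dvd poly f \<psi> \<and> g dvd poly (pderiv f) \<psi>"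

definition \<Lambda> :: "'k poly poly set" where
  "\<Lambda> = {f. tdeg_le d f \<and> inI f}"

abbreviation X :: "nat \<Rightarrow> 'k poly" where "X j \<equiv> [:- x j, 1:]"

lemma g_dvd_M: "g dvd M" unfolding g_def M_def
  by (intro prod_dvd_prod le_imp_power_dvd) (use mr in \<open>auto intro: less_imp_le\<close>)

lemma M_dvd_g2: "M dvd g\<^sup>2"
proof -
  have "g\<^sup>2 = (\<Prod>j<n. X j ^ (2 * r j))"
    unfolding g_def by (simp add: prod_power_distrib flip: power_mult) (simp add: mult.commute)
  then show ?thesis unfolding M_def using mr by (auto intro!: prod_dvd_prod le_imp_power_dvd) fastforce
qed

lemma inI_add: "inI f \<Longrightarrow> inI h \<Longrightarrow> inI (f + h)"
  and inI_diff: "inI f \<Longrightarrow> inI h \<Longrightarrow> inI (f - h)"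
  and inI_smult: "inI f \<Longrightarrow> inI (smult c f)"
  and inI_0: "inI 0"
  by (auto simp: inI_def pderiv_add pderiv_diff pderiv_smult)

lemma inI_mult: "inI f \<Longrightarrow> inI (h * f)"
  using dvd_trans[OF g_dvd_M] unfolding inI_def by (auto simp: pderiv_mult intro!: dvd_add)

text \<open>In degree d the correction by \<open>e0\<close> disappears. Otherwise \<open>e0\<close>
  cannot occur in the decomposition of a polynomial of degree d, so degree d reduces to degree d - 1
  modulo the ideal; by induction every degree, in particular that of \<open>e0\<close>, reduces to
  degree d.\<close>

lemma split_d: "\<exists>p i. tdeg_le d p \<and> inI i \<and> f = p + i"
proof -
  have e0: "\<exists>p i. tdeg_le d p \<and> inI i \<and> e0 = p + i"
  proof (rule ccontr)
    assume no: "\<not> ?thesis"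
    have W: "\<exists>q i. tdeg_le (d - 1) q \<and> inI i \<and> p = q + i" if p: "tdeg_le d p" for p
    proof -
      obtain q i c where q: "tdeg_le (d - 1) q" "inI i" "p = q + i + smult [:c:] e0"
        using decomp[of p] by (auto simp: inI_def)
      have "c = 0"
      proof (rule ccontr)
        assume "c \<noteq> 0"
        then have "e0 = smult [:1/c:] (smult [:c:] e0)" by (simp add: one_pCons[symmetric])
        also have "\<dots> = smult [:1/c:] (p - q) + smult [:-1/c:] i"
          using smult_const_minus[of "1 / c" i] by (subst q(3)) (simp add: smult_diff_right smult_add_right)
        finally have "e0 = smult [:1/c:] (p - q) + smult [:-1/c:] i" .
        moreover have "tdeg_le d (smult [:1/c:] (p - q))"
          using p q(1) by (intro tdeg_le_smult tdeg_le_diff) (auto intro: tdeg_le_mono)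
        ultimately show False using no inI_smult[OF q(2)] by blast
      qed
      with q show ?thesis by auto
    qed
    have "\<exists>q i. tdeg_le d q \<and> inI i \<and> p = q + i" if "tdeg_le e p" for e p
      using that
    proof (induction e arbitrary: p)
      case 0
      then have "tdeg_le d p" by (rule tdeg_le_mono) simp
      then show ?case using inI_0 by (metis add.right_neutral)
    next
      case (Suc e)
      obtain c f1 f2 where f: "p = [:[:c:]:] + [:[:0, 1:]:] * f1 + [:0, 1:] * f2" "tdeg_le e f1" "tdeg_le e f2"
        using tdeg_le_decomp[OF Suc.prems] by blast
      obtain q1 i1 where 1: "tdeg_le (d - 1) q1" "inI i1" "f1 = q1 + i1"
        using Suc.IH[OF f(2)] W by (metis inI_add add.assoc)
      obtain q2 i2 where 2: "tdeg_le (d - 1) q2" "inI i2" "f2 = q2 + i2"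
        using Suc.IH[OF f(3)] W by (metis inI_add add.assoc)
      have d: "d = 1 + (d - 1)" using d6 by simp
      have lin: "tdeg_le 1 ([:[:0, 1:]:] :: 'k poly poly)" "tdeg_le 1 ([:0, 1:] :: 'k poly poly)"
        using tdeg_le_const[of "[:0, 1:] :: 'k poly" 1] tdeg_le_linear[of "0 :: 'k poly" 1] by (simp_all add: one_pCons)
      have "tdeg_le d ([:[:0, 1:]:] * q1)" "tdeg_le d ([:0, 1:] * q2)" "tdeg_le d [:[:c:]:]"
        using tdeg_le_mult[OF lin(1) 1(1)] tdeg_le_mult[OF lin(2) 2(1)] tdeg_le_const[of "[:c:]" d] d by auto
      then have "tdeg_le d ([:[:c:]:] + [:[:0, 1:]:] * q1 + [:0, 1:] * q2)"
        by (intro tdeg_le_add)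
      moreover have "inI ([:[:0, 1:]:] * i1 + [:0, 1:] * i2)" using 1 2 by (intro inI_add inI_mult)
      moreover have "p = ([:[:c:]:] + [:[:0, 1:]:] * q1 + [:0, 1:] * q2) + ([:[:0, 1:]:] * i1 + [:0, 1:] * i2)"
      proof -
        have "C + U * (a + b) + V * (a' + b') = (C + U * a + V * a') + (U * b + V * b')"
          for C U V a b a' b' :: "'k poly poly" by (simp add: algebra_simps)
        then show ?thesis unfolding f 1 2 .
      qed
      ultimately show ?case by blast
    qed
    with tdeg_le_exists[of e0] no show False by blast
  qed
  then obtain p0 i0 where e0: "tdeg_le d p0" "inI i0" "e0 = p0 + i0" by blast
  obtain p i c where f: "tdeg_le (d - 1) p" "inI i" "f = p + i + smult [:c:] e0"
    using decomp[of f] by (auto simp: inI_def)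
  have "tdeg_le d (p + smult [:c:] p0)"
    using f(1) e0(1) by (intro tdeg_le_add tdeg_le_smult) (auto intro: tdeg_le_mono)
  moreover have "inI (i + smult [:c:] i0)" using f e0 by (intro inI_add inI_smult)
  moreover have "f = (p + smult [:c:] p0) + (i + smult [:c:] i0)"
    unfolding f e0 by (simp add: smult_add_right)
  ultimately show ?thesis by blast
qed

text \<open>Otherwise \<open>\<kappa>\<close> would induce a functional \<open>\<eta>\<close> on all polynomials that vanishes in degree \<open>d\<close>.
  Modulo the ideal and degree \<open>d - 1\<close> there is only \<open>e0\<close>, so \<open>\<eta>\<close> vanishes on the multiples of some
  line through \<open>(a, b)\<close>, whence the hypotheses for the vertical and the other lines.\<close>

lemma functional_nonzero:
  fixes \<kappa> :: "'k poly poly \<Rightarrow> 'k"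
  assumes add: "\<And>f h. \<kappa> (f + h) = \<kappa> f + \<kappa> h" and scale: "\<And>c f. \<kappa> (smult [:c:] f) = c * \<kappa> f"
    and kill: "\<And>i. inI i \<Longrightarrow> \<kappa> ([:[:-a, 1:]:] * i) = 0" "\<And>i. inI i \<Longrightarrow> \<kappa> ([:[:-b:], 1:] * i) = 0"
    and vert: "\<exists>i p s. inI i \<and> \<kappa> i \<noteq> 0 \<and> tdeg_le d p \<and> i = p + [:[:-a, 1:]:] * s"
    and slant: "\<And>l. (\<And>j. j < n \<Longrightarrow> m j = 2 * r j) \<Longrightarrow> degree l \<le> 1 \<Longrightarrow> poly l a = b \<Longrightarrow>
        \<exists>i p s. inI i \<and> \<kappa> i \<noteq> 0 \<and> tdeg_le d p \<and> i = p + [:- l, 1:] * s"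
  shows "\<exists>f\<in>\<Lambda>. \<kappa> f \<noteq> 0"
proof (rule ccontr)
  assume "\<not> ?thesis"
  then have zero: "\<kappa> f = 0" if "tdeg_le d f" "inI f" for f using that by (auto simp: \<Lambda>_def)
  have minus: "\<kappa> (f - h) = \<kappa> f - \<kappa> h" for f h
    using add[of "f - h" h] by simp
  obtain P J where PJ: "\<And>f. tdeg_le d (P f)" "\<And>f. inI (J f)" "\<And>f. f = P f + J f"
    using split_d by metis
  define \<eta> where "\<eta> = (\<lambda>f. \<kappa> (J f))"
  have \<eta>: "\<eta> f = \<kappa> i" if "f = p + i" "tdeg_le d p" "inI i" for f p i
  proof -
    have "J f - i = p - P f" using PJ(3)[of f] that(1) by (simp add: algebra_simps)
    then have "tdeg_le d (J f - i)" using that PJ by (simp add: tdeg_le_diff)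
    with zero[of "J f - i"] that PJ show ?thesis by (simp add: \<eta>_def minus inI_diff)
  qed
  have \<eta>_add: "\<eta> (f + h) = \<eta> f + \<eta> h" for f h
  proof -
    have "f + h = (P f + P h) + (J f + J h)" using PJ(3)[of f] PJ(3)[of h] by (metis add.assoc add.left_commute)
    then show ?thesis using \<eta>[of "f + h" "P f + P h" "J f + J h"] PJ by (simp add: tdeg_le_add inI_add add \<eta>_def)
  qed
  have \<eta>_scale: "\<eta> (smult [:c:] f) = c * \<eta> f" for c f
  proof -
    have "smult [:c:] f = smult [:c:] (P f) + smult [:c:] (J f)" using PJ(3)[of f] by (metis smult_add_right)
    then show ?thesis
      using \<eta>[of "smult [:c:] f" "smult [:c:] (P f)" "smult [:c:] (J f)"] PJ by (simp add: tdeg_le_smult inI_smult scale \<eta>_def)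
  qed
  have \<eta>_lin: "\<eta> (l * f) = c * \<eta> (l * e0)"
    if l: "tdeg_le 1 l" "\<And>i. inI i \<Longrightarrow> \<kappa> (l * i) = 0" and f: "tdeg_le (d - 1) p" "inI i" "f = p + i + smult [:c:] e0"
    for l f p i c
  proof -
    have "l * f = (l * p + l * i) + smult [:c:] (l * e0)" unfolding f by (simp add: algebra_simps)
    then have "\<eta> (l * f) = \<eta> (l * p + l * i) + c * \<eta> (l * e0)" by (simp add: \<eta>_add \<eta>_scale)
    moreover have "tdeg_le d (l * p)" using tdeg_le_mult[OF l(1) f(1)] d6 by simp
    then have "\<eta> (l * p + l * i) = 0" using \<eta>[OF refl, of "l * p" "l * i"] l f inI_mult by simp
    ultimately show ?thesis by simp
  qed
  have degs: "tdeg_le 1 [:[:-a, 1:]:]" "tdeg_le 1 [:[:-b:], 1:]"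
    using tdeg_le_const[of "[:-a, 1:]" 1] tdeg_le_linear[of "[:-b:]" 1] by (simp_all add: one_pCons)
  define c1 where "c1 = \<eta> ([:[:-a, 1:]:] * e0)"
  define c2 where "c2 = \<eta> ([:[:-b:], 1:] * e0)"
  have lx: "\<eta> ([:[:-a, 1:]:] * f) = c * c1" and ly: "\<eta> ([:[:-b:], 1:] * f) = c * c2"
    if "tdeg_le (d - 1) p" "inI i" "f = p + i + smult [:c:] e0" for f p i c
    unfolding c1_def c2_def using \<eta>_lin[OF degs(1) kill(1) that] \<eta>_lin[OF degs(2) kill(2) that] by blast+
  have contra: False if "\<And>f. \<eta> (l * f) = 0" "inI i" "\<kappa> i \<noteq> 0" "tdeg_le d p" "i = p + l * s" for l i p s
  proof -
    have "\<eta> i = \<kappa> i" using \<eta>[of i 0 i] that by simp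
    moreover have "\<eta> i = \<eta> p + \<eta> (l * s)" using that(5) \<eta>_add by metis
    moreover have "\<eta> p = 0" using \<eta>[of p p 0] that zero[of 0] by (simp add: inI_0)
    ultimately show False using that by simp
  qed
  show False
  proof (cases "c1 = 0")
    case True
    have "\<eta> ([:[:-a, 1:]:] * f) = 0" for f
      using decomp[of f] lx[of _ _ f] True by (metis inI_def mult_zero_right)
    then show False using vert contra by blast
  next
    case False
    have "m j = 2 * r j" if "j < n" for j
    proof (rule ccontr)
      assume "m j \<noteq> 2 * r j"
      then have "inI e0" using mr[OF that] cusp_e0[OF that] by (auto simp: inI_def)
      then have "c1 = 0" using \<eta>_lin[OF degs(1) kill(1), of 0 e0 e0 0] by (simp add: c1_def)
      with False show False by simp
    qed
    \<comment> \<open>On the multiples of x - a and y - b the functional \<eta> acts through c1 and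
      c2; with this slope y - l is the combination on which the two contributions cancel.\<close>
    moreover define l where "l = [:b - c2 / c1 * a, c2 / c1:]"
    have "degree l \<le> 1" "poly l a = b" by (simp_all add: l_def)
    ultimately obtain i p s where w: "inI i" "\<kappa> i \<noteq> 0" "tdeg_le d p" "i = p + [:- l, 1:] * s"
      using slant by blast
    have "\<eta> ([:- l, 1:] * f) = 0" for f
    proof -
      obtain p i c where f: "tdeg_le (d - 1) p" "inI i" "f = p + i + smult [:c:] e0"
        using decomp[of f] by (auto simp: inI_def)
      have "[:- l, 1:] = [:[:-b:], 1:] + smult [:- c2 / c1:] [:[:-a, 1:]:]"
        by (simp add: l_def)
      then have "[:- l, 1:] * f = [:[:-b:], 1:] * f + smult [:- c2 / c1:] ([:[:-a, 1:]:] * f)"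
        by (simp only: distrib_right mult_smult_left)
      then have "\<eta> ([:- l, 1:] * f) = c * c2 + (- c2 / c1) * (c * c1)"
        by (simp only: \<eta>_add \<eta>_scale lx[OF f] ly[OF f])
      then show ?thesis using False by simp
    qed
    then show False using contra w by blast
  qed
qed

text \<open>The counterpart at infinity. If \<tau> vanished on the system, it would extend to a
  functional \<eta> that is 0 on the ideal and equals \<tau> in degree d. Modulo the ideal and
  degree d - 1 only \<open>e0\<close> remains, so \<eta> kills the multiples of one line l = s among
  the parallels, which \<open>wit\<close> excludes.\<close>

lemma top_functional_nonzero:
  fixes \<tau> :: "'k poly poly \<Rightarrow> 'k"
  assumes add: "\<And>f h. \<tau> (f + h) = \<tau> f + \<tau> h" and scale: "\<And>c f. \<tau> (smult [:c:] f) = c * \<tau> f"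
    and kill: "\<And>p. tdeg_le (d - 1) p \<Longrightarrow> \<tau> p = 0" "\<And>p. tdeg_le (d - 1) p \<Longrightarrow> \<tau> (l * p) = 0"
    and l: "tdeg_le 1 l"
    and nz: "\<exists>p. tdeg_le d p \<and> \<tau> p \<noteq> 0"
    and wit: "\<And>s. \<exists>i p h. inI i \<and> \<tau> p \<noteq> 0 \<and> tdeg_le d p \<and> i = p + (l - [:[:s:]:]) * h"
  shows "\<exists>f\<in>\<Lambda>. \<tau> f \<noteq> 0"
proof (rule ccontr)
  assume "\<not> ?thesis"
  then have zero: "\<tau> f = 0" if "tdeg_le d f" "inI f" for f using that by (auto simp: \<Lambda>_def)
  have minus: "\<tau> (f - h) = \<tau> f - \<tau> h" for f h using add[of "f - h" h] by simp
  obtain P J where PJ: "\<And>f. tdeg_le d (P f)" "\<And>f. inI (J f)" "\<And>f. f = P f + J f"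
    using split_d by metis
  define \<eta> where "\<eta> = (\<lambda>f. \<tau> (P f))"
  have \<eta>: "\<eta> f = \<tau> p" if "f = p + i" "tdeg_le d p" "inI i" for f p i
  proof -
    have "P f - p = i - J f" using PJ(3)[of f] that(1) by (simp add: algebra_simps)
    then have "inI (P f - p)" using that PJ by (simp add: inI_diff)
    with zero[of "P f - p"] that PJ show ?thesis by (simp add: \<eta>_def minus tdeg_le_diff)
  qed
  have \<eta>_add: "\<eta> (f + h) = \<eta> f + \<eta> h" for f h
  proof -
    have "f + h = (P f + P h) + (J f + J h)" using PJ(3)[of f] PJ(3)[of h] by (metis add.assoc add.left_commute)
    then show ?thesis using \<eta>[of "f + h" "P f + P h" "J f + J h"] PJ by (simp add: tdeg_le_add inI_add add \<eta>_def)
  qed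
  have \<eta>_scale: "\<eta> (smult [:c:] f) = c * \<eta> f" for c f
  proof -
    have "smult [:c:] f = smult [:c:] (P f) + smult [:c:] (J f)" using PJ(3)[of f] by (metis smult_add_right)
    then show ?thesis
      using \<eta>[of "smult [:c:] f" "smult [:c:] (P f)" "smult [:c:] (J f)"] PJ by (simp add: tdeg_le_smult inI_smult scale \<eta>_def)
  qed
  have main: "\<eta> f = c * \<eta> e0" "\<eta> (l * f) = c * \<eta> (l * e0)"
    if f: "tdeg_le (d - 1) p" "inI i" "f = p + i + smult [:c:] e0" for f p i c
  proof -
    have p: "tdeg_le d p" using f(1) by (rule tdeg_le_mono) simp
    have "\<eta> (p + i) = 0" using \<eta>[OF refl p f(2)] kill(1)[OF f(1)] by simp
    then show "\<eta> f = c * \<eta> e0" unfolding f by (simp add: \<eta>_add \<eta>_scale)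
    have "l * f = (l * p + l * i) + smult [:c:] (l * e0)" unfolding f by (simp add: algebra_simps)
    then have "\<eta> (l * f) = \<eta> (l * p + l * i) + c * \<eta> (l * e0)" by (simp add: \<eta>_add \<eta>_scale)
    moreover have "tdeg_le d (l * p)" using tdeg_le_mult[OF l(1) f(1)] d6 by simp
    then have "\<eta> (l * p + l * i) = 0" using \<eta>[OF refl, of "l * p" "l * i"] kill f inI_mult by simp
    ultimately show "\<eta> (l * f) = c * \<eta> (l * e0)" by simp
  qed
  have c0: "\<eta> e0 \<noteq> 0"
  proof
    assume "\<eta> e0 = 0"
    obtain p where p: "tdeg_le d p" "\<tau> p \<noteq> 0" using nz by blast
    have "\<eta> p = 0" using decomp[of p] main(1)[of _ _ p] \<open>\<eta> e0 = 0\<close> by (metis inI_def mult_zero_right)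
    then show False using \<eta>[of p p 0] p inI_0 by simp
  qed
  define s where "s = \<eta> (l * e0) / \<eta> e0"
  have 0: "\<eta> ((l - [:[:s:]:]) * f) = 0" for f
  proof -
    obtain p i c where f: "tdeg_le (d - 1) p" "inI i" "f = p + i + smult [:c:] e0"
      using decomp[of f] by (auto simp: inI_def)
    have "(l - [:[:s:]:]) * f = l * f + smult [:- s:] f" by (simp add: algebra_simps smult_const_minus)
    then show ?thesis using main[OF f] c0 by (simp add: \<eta>_add \<eta>_scale s_def)
  qed
  obtain i p h where w: "inI i" "\<tau> p \<noteq> 0" "tdeg_le d p" "i = p + (l - [:[:s:]:]) * h" using wit by blast
  have "\<eta> i = 0" using \<eta>[of i 0 i] w zero[of 0] by (simp add: inI_0)
  moreover have "\<eta> i = \<eta> p + \<eta> ((l - [:[:s:]:]) * h)" using w(4) \<eta>_add by metis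
  moreover have "\<eta> p = \<tau> p" using \<eta>[of p p 0] w inI_0 by simp
  ultimately show False using 0 w by simp
qed

end

lemma order_linear_power_mult:
  assumes "poly q a \<noteq> 0"
  shows "order a ([:- a, 1:] ^ k * q) = k"
proof -
  have "q \<noteq> 0" using assms by auto
  then have "order a ([:- a, 1:] ^ k * q) = order a ([:- a, 1:] ^ k) + order a q"
    by (intro order_mult) auto
  then show ?thesis using order_power_n_n[of a k] order_0I[OF assms] by simp
qed

lemma prod_linear_power_dvd:
  assumes "finite A" "inj_on x A" "\<And>j. j \<in> A \<Longrightarrow> [:- x j, 1:] ^ k j dvd (h :: 'a::idom poly)"
  shows "(\<Prod>j\<in>A. [:- x j, 1:] ^ k j) dvd h"
  using assms
proof (induction A rule: finite_induct)
  case (insert a A)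
  then obtain q where q: "h = (\<Prod>j\<in>A. [:- x j, 1:] ^ k j) * q" by (auto elim: dvdE)
  show ?case
  proof (cases "q = 0")
    case False
    have nz: "poly (\<Prod>j\<in>A. [:- x j, 1:] ^ k j) (x a) \<noteq> 0"
      using insert by (auto simp: poly_prod inj_on_def)
    then have nz': "(\<Prod>j\<in>A. [:- x j, 1:] ^ k j) \<noteq> 0" by auto
    have "k a \<le> order (x a) h" using insert.prems(2)[of a] False nz' q by (simp add: order_divides)
    also have "order (x a) h = order (x a) q"
      using q False nz' order_0I[OF nz] by (simp add: order_mult)
    finally have "[:- x a, 1:] ^ k a dvd q" by (simp add: order_divides)
    then show ?thesis using insert.hyps unfolding q by (simp add: mult.commute mult_dvd_mono)
  qed (use q in simp)
qed simp

lemma sum_le_exact: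
  fixes k :: "nat \<Rightarrow> nat"
  assumes "s \<le> (\<Sum>j<n. k j)"
  shows "\<exists>k'. (\<forall>j<n. k' j \<le> k j) \<and> (\<Sum>j<n. k' j) = s"
  using assms
proof (induction n arbitrary: s)
  case (Suc n)
  show ?case
  proof (cases "s \<le> (\<Sum>j<n. k j)")
    case True
    then obtain k' where "\<forall>j<n. k' j \<le> k j" "(\<Sum>j<n. k' j) = s" using Suc.IH by blast
    then show ?thesis by (intro exI[of _ "k'(n := 0)"]) (auto simp: less_Suc_eq)
  next
    case False
    then show ?thesis using Suc.prems
      by (intro exI[of _ "k(n := s - (\<Sum>j<n. k j))"]) (auto simp: less_Suc_eq)
  qed
qed simp

section \<open>Local coefficients and the elements of the ideal that test them\<close>

context scheme
begin

text \<open>Substituting \<open>y = \<psi> + v (x - x j)\<^sup>r\<close> in a curve of the system, the lowest term at a tacnode is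
  \<open>(cA + cB v + cC v\<^sup>2) (x - x j)\<^sup>m\<close>.\<close>

definition cA :: "nat \<Rightarrow> 'k poly poly \<Rightarrow> 'k" where
  "cA j f = poly (poly f \<psi> div X j ^ m j) (x j)"
definition cB :: "nat \<Rightarrow> 'k poly poly \<Rightarrow> 'k" where
  "cB j f = poly (poly (pderiv f) \<psi> div X j ^ r j) (x j)"
definition cC :: "nat \<Rightarrow> 'k poly poly \<Rightarrow> 'k" where
  "cC j f = poly (poly (pderiv (pderiv f)) \<psi>) (x j) / 2"

lemma cABC_add: "cA j (f + h) = cA j f + cA j h" "cB j (f + h) = cB j f + cB j h"
    "cC j (f + h) = cC j f + cC j h"
  by (simp_all add: cA_def cB_def cC_def pderiv_add poly_div_add_left add_divide_distrib)

lemma cABC_smult: "cA j (smult [:c:] f) = c * cA j f" "cB j (smult [:c:] f) = c * cB j f"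
    "cC j (smult [:c:] f) = c * cC j f"
  by (simp_all add: cA_def cB_def cC_def pderiv_smult div_smult_left)

lemma cA_eq: "poly f \<psi> = X j ^ m j * q \<Longrightarrow> cA j f = poly q (x j)"
  and cB_eq: "poly (pderiv f) \<psi> = X j ^ r j * q \<Longrightarrow> cB j f = poly q (x j)"
  by (simp_all add: cA_def cB_def)

lemma split_at:
  assumes "j < n"
  obtains Mj gj where "M = X j ^ m j * Mj" "g = X j ^ r j * gj" "poly Mj (x j) \<noteq> 0" "poly gj (x j) \<noteq> 0"
    "gj = (\<Prod>l\<in>{..<n} - {j}. X l ^ r l)" "gj dvd Mj"
proof
  have *: "{..<n} = insert j ({..<n} - {j})" using assms by auto
  show "M = X j ^ m j * (\<Prod>l\<in>{..<n} - {j}. X l ^ m l)" "g = X j ^ r j * (\<Prod>l\<in>{..<n} - {j}. X l ^ r l)"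
    unfolding M_def g_def by (subst *, subst prod.insert, auto)+
  show "poly (\<Prod>l\<in>{..<n} - {j}. X l ^ m l) (x j) \<noteq> 0" "poly (\<Prod>l\<in>{..<n} - {j}. X l ^ r l) (x j) \<noteq> 0"
    using assms inj by (auto simp: poly_prod inj_on_def)
  show "(\<Prod>l\<in>{..<n} - {j}. X l ^ r l) dvd (\<Prod>l\<in>{..<n} - {j}. X l ^ m l)"
    by (intro prod_dvd_prod le_imp_power_dvd) (use mr in \<open>auto intro: less_imp_le\<close>)
qed simp

lemma inI_at:
  assumes "inI f" "j < n"
  obtains q0 q1 where "poly f \<psi> = X j ^ m j * q0" "poly (pderiv f) \<psi> = X j ^ r j * q1"
    "cA j f = poly q0 (x j)" "cB j f = poly q1 (x j)"
proof -
  obtain Mj gj where "M = X j ^ m j * Mj" "g = X j ^ r j * gj" using split_at[OF assms(2)] by metis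
  then obtain q0 q1 where "poly f \<psi> = X j ^ m j * q0" "poly (pderiv f) \<psi> = X j ^ r j * q1"
    using assms(1) unfolding inI_def by (metis dvdE mult.assoc)
  then show thesis using that cA_eq cB_eq by blast
qed

text \<open>Multiplication by a function vanishing at the point raises the orders along the arc; for
  y - \<psi>(x j) this uses r j < m j. It provides the hypotheses \<open>kill\<close> of
  \<open>functional_nonzero\<close>.\<close>

lemma coefficients_vanish:
  assumes i: "inI i" and j: "j < n"
  shows "cA j ([:[:- x j, 1:]:] * i) = 0" "cB j ([:[:- x j, 1:]:] * i) = 0" "cC j ([:[:- x j, 1:]:] * i) = 0"
    and "cA j ([:[:- poly \<psi> (x j):], 1:] * i) = 0" "cB j ([:[:- poly \<psi> (x j):], 1:] * i) = 0"
      "cC j ([:[:- poly \<psi> (x j):], 1:] * i) = 0"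
proof -
  obtain q0 q1 where q: "poly i \<psi> = X j ^ m j * q0" "poly (pderiv i) \<psi> = X j ^ r j * q1"
    using inI_at[OF i j] by metis
  have P: "poly ([:h:] * f) \<psi> = h * poly f \<psi>" "pderiv ([:h:] * i) = [:h:] * pderiv i" for h and f :: "'k poly poly"
    by (simp_all add: pderiv_smult)
  have "poly ([:[:- x j, 1:]:] * i) \<psi> = X j ^ m j * (X j * q0)"
    "poly (pderiv ([:[:- x j, 1:]:] * i)) \<psi> = X j ^ r j * (X j * q1)"
    by (simp_all only: P q mult.left_commute)
  from cA_eq[OF this(1)] cB_eq[OF this(2)]
  show "cA j ([:[:- x j, 1:]:] * i) = 0" "cB j ([:[:- x j, 1:]:] * i) = 0" by simp_all
  show "cC j ([:[:- x j, 1:]:] * i) = 0" by (simp add: cC_def pderiv_smult)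
  have "poly (\<psi> - [:poly \<psi> (x j):]) (x j) = 0" by simp
  then obtain D where D: "\<psi> - [:poly \<psi> (x j):] = X j * D" by (metis dvdE poly_eq_0_iff_dvd)
  have "poly [:[:- poly \<psi> (x j):], 1:] \<psi> = \<psi> - [:poly \<psi> (x j):]"
    by (rule poly_eqI) (simp add: coeff_pCons split: nat.split)
  note L = this[unfolded D]
  have dL: "pderiv [:[:- poly \<psi> (x j):], 1:] = 1" by (simp add: pderiv_pCons)
  have "m j = r j + Suc (m j - r j - 1)" using mr[OF j] by linarith
  then obtain e where e: "m j = r j + Suc e" by blast
  have "poly ([:[:- poly \<psi> (x j):], 1:] * i) \<psi> = X j ^ m j * (X j * D * q0)"
    by (simp only: poly_mult L q) (simp add: algebra_simps)
  from cA_eq[OF this] show "cA j ([:[:- poly \<psi> (x j):], 1:] * i) = 0" by simp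
  have "poly (pderiv ([:[:- poly \<psi> (x j):], 1:] * i)) \<psi> = X j ^ r j * (X j * (D * q1 + X j ^ e * q0))"
    by (simp only: pderiv_mult poly_add poly_mult L q dL e) (simp add: algebra_simps power_add)
  from cB_eq[OF this] show "cB j ([:[:- poly \<psi> (x j):], 1:] * i) = 0" by simp
  have "poly (poly (pderiv i) \<psi>) (x j) = 0" using mr[OF j] by (simp add: q)
  moreover have "poly (poly [:[:- poly \<psi> (x j):], 1:] \<psi>) (x j) = 0" by (simp only: L) simp
  ultimately show "cC j ([:[:- poly \<psi> (x j):], 1:] * i) = 0"
    unfolding cC_def pderiv_mult pderiv_add dL by simp
qed

text \<open>Its square form puts it into the ideal, since M divides g^2. On a line y = l it is the
  square of A (\<psi> - l) + B g, so Bezout coefficients A and B reduce it there to the square of a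
  greatest common divisor.\<close>

definition sq :: "'k poly \<Rightarrow> 'k poly \<Rightarrow> 'k poly poly" where
  "sq A B = ([:- A:] * [:- \<psi>, 1:] + [:B * g:])\<^sup>2"

lemma sq_arc: "poly (sq A B) \<psi> = (B * g)\<^sup>2" "poly (pderiv (sq A B)) \<psi> = - 2 * A * B * g"
    "poly (pderiv (pderiv (sq A B))) \<psi> = 2 * A\<^sup>2"
  by (simp_all add: sq_def power2_eq_square pderiv_mult pderiv_add pderiv_pCons pderiv_smult
      pderiv_minus pderiv_diff algebra_simps)

lemma inI_sq: "inI (sq A B)"
  unfolding inI_def sq_arc using M_dvd_g2 by (auto simp: power_mult_distrib)

lemma poly_sq_line: "poly (sq A B) l = (A * (\<psi> - l) + B * g)\<^sup>2"
  by (simp add: sq_def algebra_simps)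

lemma tdeg_square_line: "tdeg_le d ([:[:c:], 1:]\<^sup>2 :: 'k poly poly)"
  using tdeg_le_power[OF tdeg_le_linear[of "[:c:]" 1], of 2] d6
  by (auto simp: one_pCons intro: tdeg_le_mono)

lemma graph_square_vertical:
  "inI ([:- \<psi>, 1:]\<^sup>2)"
  "\<exists>s. [:- \<psi>, 1:]\<^sup>2 = [:[:- poly \<psi> a:], 1:]\<^sup>2 + [:[:- a, 1:]:] * s"
proof -
  show "inI ([:- \<psi>, 1:]\<^sup>2)"
    by (simp add: inI_def power2_eq_square pderiv_mult pderiv_pCons)
  have "poly (\<psi> - [:poly \<psi> a:]) a = 0" by simp
  then obtain D where D: "\<psi> - [:poly \<psi> a:] = [:- a, 1:] * D" by (metis dvdE poly_eq_0_iff_dvd)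
  define u where "u = [:[:- poly \<psi> a:], 1:]"
  have "[:[:- a, 1:] * D:] = [:\<psi>:] - [:[:poly \<psi> a:]:]" unfolding D[symmetric] by simp
  then have "[:- \<psi>, 1:] = u - [:[:- a, 1:] * D:]" by (simp add: u_def)
  also have "[:[:- a, 1:] * D:] = [:[:- a, 1:]:] * [:D:]" by simp
  finally have "[:- \<psi>, 1:] = u - [:[:- a, 1:]:] * [:D:]" .
  then have "[:- \<psi>, 1:]\<^sup>2 = u\<^sup>2 + [:[:- a, 1:]:] * ([:[:- a, 1:]:] * [:D:]\<^sup>2 - 2 * [:D:] * u)"
    by (simp only:) (simp add: power2_eq_square algebra_simps)
  then show "\<exists>s. [:- \<psi>, 1:]\<^sup>2 = [:[:- poly \<psi> a:], 1:]\<^sup>2 + [:[:- a, 1:]:] * s"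
    unfolding u_def by blast
qed

text \<open>\<gamma> is the greatest common divisor of \<psi> - l and g. If they had a common
  divisor of degree 4, a conic with values x^3 on it would restrict to the line with degree at most
  2, and its difference from x^3 would be a nonzero cubic divisible by a quartic.\<close>

lemma line_gcd:
  assumes l: "degree l \<le> 1"
  obtains A B \<gamma> where "A * (\<psi> - l) + B * g = \<gamma>" "degree \<gamma> \<le> 3" "\<gamma> \<noteq> 0" "\<psi> \<noteq> l"
    "\<And>a. poly \<gamma> a = 0 \<Longrightarrow> \<exists>j<n. a = x j \<and> poly \<psi> a = poly l a"
    "\<And>j. j < n \<Longrightarrow> order (x j) \<gamma> = min (order (x j) (\<psi> - l)) (r j)"
proof -
  have no4: False if k: "\<And>j. j < n \<Longrightarrow> k j \<le> r j" "(\<Sum>j<n. k j) = 4"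
    and dv: "(\<Prod>j<n. X j ^ k j) dvd \<psi> - l" for k
  proof -
    let ?G = "\<Prod>j<n. X j ^ k j"
    obtain f where f: "tdeg_le 2 f" "?G dvd poly f \<psi> - monom 1 3"
      using conics[OF k] unfolding interp_def by blast
    obtain s where s: "poly f (l + (\<psi> - l)) = poly f l + (\<psi> - l) * s" using poly_taylor1 by blast
    have "?G dvd poly f \<psi> - monom 1 3 - (\<psi> - l) * s" using dvd_diff[OF f(2) dvd_mult2[OF dv]] .
    also have "poly f \<psi> - monom 1 3 - (\<psi> - l) * s = poly f l - monom 1 3" using s by (simp add: algebra_simps)
    finally have dvd: "?G dvd poly f l - monom 1 3" .
    have dl: "degree (poly f l) \<le> 2" by (rule degree_poly_arc[OF f(1) l])
    then have "degree (poly f l - monom 1 3) \<le> 3" by (intro degree_diff_le) (auto simp: degree_monom_eq)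
    moreover have "coeff (poly f l - monom 1 3) 3 \<noteq> 0" using dl by (simp add: coeff_eq_0)
    then have "poly f l - monom 1 3 \<noteq> 0" by auto
    moreover have "degree ?G = 4"
      using k(2) by (subst degree_prod_eq_sum_degree) (auto simp: degree_power_eq)
    ultimately show False using dvd_imp_degree_le[OF dvd] by simp
  qed
  have nz: "\<psi> \<noteq> l"
  proof
    assume "\<psi> = l"
    obtain k where "\<forall>j<n. k j \<le> r j" "(\<Sum>j<n. k j) = 4" using sum_le_exact[OF sum_r] by blast
    with no4[of k] \<open>\<psi> = l\<close> show False by simp
  qed
  define k where "k = (\<lambda>j. min (order (x j) (\<psi> - l)) (r j))"
  define \<gamma> where "\<gamma> = (\<Prod>j<n. X j ^ k j)"
  have k_dvd: "X j ^ k j dvd \<psi> - l" for j using nz by (simp add: order_divides k_def)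
  have "(\<Sum>j<n. k j) \<le> 3"
  proof (rule ccontr)
    assume "\<not> ?thesis"
    then obtain k' where k': "\<forall>j<n. k' j \<le> k j" "(\<Sum>j<n. k' j) = 4"
      using sum_le_exact[of 4 k n] by auto
    show False
    proof (rule no4[of k'])
      show "(\<Prod>j<n. X j ^ k' j) dvd \<psi> - l"
      proof (rule prod_linear_power_dvd)
        show "X j ^ k' j dvd \<psi> - l" if "j \<in> {..<n}" for j
          using k'(1) that by (intro dvd_trans[OF le_imp_power_dvd k_dvd]) auto
      qed (use inj in auto)
      show "k' j \<le> r j" if "j < n" for j using k'(1) that by (fastforce simp: k_def)
    qed (rule k'(2))
  qed
  then have deg: "degree \<gamma> \<le> 3"
    unfolding \<gamma>_def by (subst degree_prod_eq_sum_degree) (auto simp: degree_power_eq)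
  have \<gamma>nz: "\<gamma> \<noteq> 0" by (simp add: \<gamma>_def)
  have "\<gamma> dvd \<psi> - l" unfolding \<gamma>_def using k_dvd inj by (intro prod_linear_power_dvd) auto
  then obtain h1 where h1: "\<psi> - l = \<gamma> * h1" by blast
  have "g = \<gamma> * (\<Prod>j<n. X j ^ (r j - k j))"
    unfolding g_def \<gamma>_def prod.distrib[symmetric] power_add[symmetric]
    by (intro prod.cong) (auto simp: k_def)
  then obtain g1 where g1: "g = \<gamma> * g1" "g1 = (\<Prod>j<n. X j ^ (r j - k j))" by blast
  have ord: "order (x j) \<gamma> = k j" if "j < n" for j
  proof -
    have *: "{..<n} = insert j ({..<n} - {j})" using that by auto
    have "\<gamma> = X j ^ k j * (\<Prod>l\<in>{..<n} - {j}. X l ^ k l)"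
      unfolding \<gamma>_def by (subst *, subst prod.insert, auto)
    moreover have "poly (\<Prod>l\<in>{..<n} - {j}. X l ^ k l) (x j) \<noteq> 0"
      using that inj by (auto simp: poly_prod inj_on_def)
    ultimately show ?thesis by (simp add: order_linear_power_mult)
  qed
  have "\<not> (poly h1 a = 0 \<and> poly g1 a = 0)" for a
  proof
    assume a: "poly h1 a = 0 \<and> poly g1 a = 0"
    then obtain j where j: "j < n" "a = x j" "k j < r j" unfolding g1 by (auto simp: poly_prod)
    have "h1 \<noteq> 0" using h1 nz by auto
    then have "order a h1 > 0" using a by (simp add: order_gt_0_iff)
    moreover have "order a (\<psi> - l) = k j + order a h1"
      unfolding h1 using j ord \<open>h1 \<noteq> 0\<close> \<gamma>nz by (simp add: order_mult)
    ultimately show False using j by (auto simp: k_def min_def split: if_splits)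
  qed
  from bezout_of_no_common_root[OF this] obtain A B where AB: "A * h1 + B * g1 = 1" by blast
  have "A * (\<psi> - l) + B * g = \<gamma> * (A * h1 + B * g1)" unfolding h1 g1(1) by (simp add: algebra_simps)
  then have "A * (\<psi> - l) + B * g = \<gamma>" by (simp add: AB)
  moreover have "\<exists>j<n. a = x j \<and> poly \<psi> a = poly l a" if root: "poly \<gamma> a = 0" for a
  proof -
    obtain j where "j < n" "a = x j" using root by (auto simp: \<gamma>_def poly_prod)
    moreover have "poly (\<psi> - l) a = 0" unfolding h1 using root by simp
    ultimately show ?thesis by auto
  qed
  ultimately show thesis using that deg \<gamma>nz nz ord by (auto simp: k_def)
qed

text \<open>This is where d \<ge> 6 is decisive: \<gamma>^2 has degree at most 6.\<close>

lemma sq_line_witness: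
  assumes "A * (\<psi> - l) + B * g = \<gamma>" "degree \<gamma> \<le> 3"
  shows "tdeg_le d [:\<gamma>\<^sup>2:]" "\<exists>s. sq A B = [:\<gamma>\<^sup>2:] + [:- l, 1:] * s"
proof -
  have "degree (\<gamma>\<^sup>2) \<le> d" using assms(2) d6 degree_power_le[of \<gamma> 2] by linarith
  then show "tdeg_le d [:\<gamma>\<^sup>2:]" by (rule tdeg_le_const)
  show "\<exists>s. sq A B = [:\<gamma>\<^sup>2:] + [:- l, 1:] * s"
    using division_by_graph[of "sq A B" l] by (simp add: poly_sq_line assms)
qed

lemma M_vertical: "\<exists>s. [:M:] = [:[:poly M a:]:] + [:[:- a, 1:]:] * s"
proof -
  have "M = [:- a, 1:] * synthetic_div M a + [:poly M a:]" by (rule synthetic_div_correct'[symmetric])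
  then have "[:M:] = [:[:poly M a:]:] + [:[:- a, 1:]:] * [:synthetic_div M a:]" by (simp add: add.commute)
  then show ?thesis by blast
qed

lemma inI_M: "inI [:M:]" by (simp add: inI_def)

text \<open>Test elements: (y - \<psi>)^2 for a vertical line through some x j, M for the other
  vertical lines, and \<open>sq\<close> for slanted lines. The latter restricts to \<gamma>^2, which
  vanishes only where the line meets the arc at a point of the scheme.\<close>

lemma base_point_free:
  assumes q: "\<And>j. j < n \<Longrightarrow> \<not> (a = x j \<and> b = poly \<psi> (x j))"
  shows "\<exists>f\<in>\<Lambda>. eval2 f a b \<noteq> 0"
proof (rule functional_nonzero[where a = a and b = b])
  show "\<exists>i p s. inI i \<and> eval2 i a b \<noteq> 0 \<and> tdeg_le d p \<and> i = p + [:[:- a, 1:]:] * s"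
  proof (cases "\<exists>j<n. a = x j")
    case True
    then have "b \<noteq> poly \<psi> a" using q by auto
    obtain s where "[:- \<psi>, 1:]\<^sup>2 = [:[:- poly \<psi> a:], 1:]\<^sup>2 + [:[:- a, 1:]:] * s"
      using graph_square_vertical by blast
    moreover have "eval2 ([:- \<psi>, 1:]\<^sup>2) a b \<noteq> 0" using \<open>b \<noteq> poly \<psi> a\<close> by simp
    ultimately show ?thesis using tdeg_square_line graph_square_vertical(1) by blast
  next
    case False
    then have "poly M a \<noteq> 0" by (auto simp: M_def poly_prod)
    moreover obtain s where "[:M:] = [:[:poly M a:]:] + [:[:- a, 1:]:] * s" using M_vertical by blast
    moreover have "tdeg_le d [:[:poly M a:]:]" by (rule tdeg_le_const) simp
    moreover have "eval2 [:M:] a b = poly M a" by simp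
    ultimately show ?thesis using inI_M by (metis (no_types))
  qed
  fix l assume l: "degree l \<le> 1" "poly l a = b"
  obtain A B \<gamma> where w: "A * (\<psi> - l) + B * g = \<gamma>" "degree \<gamma> \<le> 3"
      "\<And>a. poly \<gamma> a = 0 \<Longrightarrow> \<exists>j<n. a = x j \<and> poly \<psi> a = poly l a"
    using line_gcd[OF l(1)] by metis
  have "poly \<gamma> a \<noteq> 0" using w(3)[of a] q l(2) by metis
  have "eval2 (sq A B) a b = poly (poly (sq A B) l) a" by (simp add: poly_poly_eq_eval2 l)
  also have "\<dots> \<noteq> 0" using \<open>poly \<gamma> a \<noteq> 0\<close> by (simp add: poly_sq_line w)
  finally show "\<exists>i p s. inI i \<and> eval2 i a b \<noteq> 0 \<and> tdeg_le d p \<and> i = p + [:- l, 1:] * s"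
    using inI_sq sq_line_witness[OF w(1,2)] by blast
qed simp_all

text \<open>On the vertical line M itself is a test element: a multiple of x - x j with nonzero
  \<open>cA\<close>. Slanted lines do not arise, because the scheme contains a cusp.\<close>

lemma cusp_coefficient:
  assumes j: "j < n" and c: "m j + 1 = 2 * r j"
  shows "\<exists>f\<in>\<Lambda>. cA j f \<noteq> 0"
proof (rule functional_nonzero[where a = "x j" and b = "poly \<psi> (x j)"])
  obtain Mj where Mj: "M = X j ^ m j * Mj" "poly Mj (x j) \<noteq> 0" using split_at[OF j] by metis
  have "cA j [:M:] = poly Mj (x j)" by (rule cA_eq) (simp add: Mj)
  moreover have "poly M (x j) = 0" using mr[OF j] by (simp add: Mj)
  then obtain s where "[:M:] = 0 + [:[:- x j, 1:]:] * s" using M_vertical[of "x j"] by auto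
  ultimately show "\<exists>i p s. inI i \<and> cA j i \<noteq> 0 \<and> tdeg_le d p \<and> i = p + [:[:- x j, 1:]:] * s"
    using inI_M Mj(2) tdeg_le_0 by metis
qed (use coefficients_vanish[OF _ j] c mr[OF j] j in \<open>auto simp: cABC_add cABC_smult\<close>)

text \<open>It makes the general member exactly double at the points. A slanted line with contact at
  least r j is tested by (y - l)(y - \<psi>) times the remaining factors of g. For smaller contact
  the Bezout coefficient A is nonzero at x j, and \<open>cC\<close> of the square is A(x
  j)^2.\<close>

lemma second_derivative_coefficient:
  assumes j: "j < n"
  shows "\<exists>f\<in>\<Lambda>. cC j f \<noteq> 0"
proof (rule functional_nonzero[where a = "x j" and b = "poly \<psi> (x j)"])
  obtain s where "[:- \<psi>, 1:]\<^sup>2 = [:[:- poly \<psi> (x j):], 1:]\<^sup>2 + [:[:- x j, 1:]:] * s"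
    using graph_square_vertical by blast
  moreover have "cC j ([:- \<psi>, 1:]\<^sup>2) = 1"
    by (simp add: cC_def power2_eq_square pderiv_mult pderiv_add pderiv_pCons)
  ultimately show "\<exists>i p s. inI i \<and> cC j i \<noteq> 0 \<and> tdeg_le d p \<and> i = p + [:[:- x j, 1:]:] * s"
    using tdeg_square_line graph_square_vertical(1) by (metis zero_neq_one)
  fix l assume l: "degree l \<le> 1" "poly l (x j) = poly \<psi> (x j)"
  obtain A B \<gamma> where w: "A * (\<psi> - l) + B * g = \<gamma>" "degree \<gamma> \<le> 3" "\<gamma> \<noteq> 0" "\<psi> \<noteq> l"
      "\<And>j. j < n \<Longrightarrow> order (x j) \<gamma> = min (order (x j) (\<psi> - l)) (r j)"
    using line_gcd[OF l(1)] by metis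
  define k where "k = order (x j) (\<psi> - l)"
  obtain h where h: "\<psi> - l = X j ^ k * h" "poly h (x j) \<noteq> 0"
    using order_decomp[of "\<psi> - l" "x j"] w(4) by (auto simp: k_def poly_eq_0_iff_dvd)
  obtain gj where gj: "g = X j ^ r j * gj" "poly gj (x j) \<noteq> 0" using split_at[OF j] by metis
  show "\<exists>i p s. inI i \<and> cC j i \<noteq> 0 \<and> tdeg_le d p \<and> i = p + [:- l, 1:] * s"
  proof (cases "r j \<le> k")
    case True
    define i where "i = [:- l, 1:] * ([:- \<psi>, 1:] * [:gj:])"
    have "g dvd (\<psi> - l) * gj" unfolding gj(1) h(1) using True
      by (intro mult_dvd_mono) (auto intro: dvd_mult2 le_imp_power_dvd)
    moreover have "poly (pderiv i) \<psi> = (\<psi> - l) * gj"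
      by (simp add: i_def pderiv_mult pderiv_pCons algebra_simps)
    ultimately have "inI i" by (simp add: inI_def i_def)
    moreover have "cC j i = poly gj (x j)"
      by (simp add: cC_def i_def pderiv_mult pderiv_add pderiv_pCons pderiv_smult pderiv_diff pderiv_minus algebra_simps)
    moreover have "i = 0 + [:- l, 1:] * ([:- \<psi>, 1:] * [:gj:])" by (simp add: i_def)
    ultimately show ?thesis using gj(2) tdeg_le_0 by metis
  next
    case False
    have "A \<noteq> 0 \<and> poly A (x j) \<noteq> 0"
    proof (rule ccontr)
      assume "\<not> ?thesis"
      then have "poly A (x j) = 0" by auto
      then obtain A' where A': "A = X j * A'" by (metis dvdE poly_eq_0_iff_dvd)
      have "r j = Suc k + (r j - Suc k)" using False by linarith
      then obtain e where e: "r j = Suc k + e" by blast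
      have "\<gamma> = X j ^ Suc k * (A' * h + B * X j ^ e * gj)"
        unfolding w(1)[symmetric] h(1) gj(1) A' e by (simp add: algebra_simps power_add)
      then have "Suc k \<le> order (x j) \<gamma>" using w(3) order_divides[of "x j" "Suc k" \<gamma>] by simp
      then show False using w(5)[OF j] False by (simp add: k_def)
    qed
    moreover have "cC j (sq A B) = (poly A (x j))\<^sup>2" by (simp add: cC_def sq_arc)
    ultimately show ?thesis using inI_sq sq_line_witness[OF w(1,2)] by (metis power_not_zero)
  qed
qed (use coefficients_vanish[OF _ j] in \<open>auto simp: cABC_add cABC_smult\<close>)

text \<open>It keeps the tangent forms free of common roots. A line of contact below r j, or whose
  contact coefficient q(x j) differs from -v, is tested by the multiple of y - l in
  \<open>line\<close>. Otherwise the square has value (A q + B gj)^2 at x j, nonzero because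
  \<gamma> has order exactly r j.\<close>

lemma tangent_coefficient:
  assumes j: "j < n" and t: "m j = 2 * r j"
  shows "\<exists>f\<in>\<Lambda>. cA j f + cB j f * v + cC j f * v\<^sup>2 \<noteq> 0"
proof (rule functional_nonzero[where a = "x j" and b = "poly \<psi> (x j)"])
  obtain Mj gj where Mj: "M = X j ^ m j * Mj" "g = X j ^ r j * gj" "poly Mj (x j) \<noteq> 0" "poly gj (x j) \<noteq> 0" "gj dvd Mj"
    using split_at[OF j] by metis
  have "cA j [:M:] = poly Mj (x j)" "cB j [:M:] = 0" "cC j [:M:] = 0"
    using cA_eq[of "[:M:]" j Mj] by (simp_all add: Mj cB_def cC_def)
  moreover have "poly M (x j) = 0" using mr[OF j] by (simp add: Mj)
  then obtain s where "[:M:] = 0 + [:[:- x j, 1:]:] * s" using M_vertical[of "x j"] by auto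
  ultimately show "\<exists>i p s. inI i \<and> cA j i + cB j i * v + cC j i * v\<^sup>2 \<noteq> 0 \<and> tdeg_le d p \<and> i = p + [:[:- x j, 1:]:] * s"
    using inI_M Mj(3) tdeg_le_0 by (metis add.right_neutral mult_zero_left)
  fix l assume l: "degree l \<le> 1" "poly l (x j) = poly \<psi> (x j)"
  obtain A B \<gamma> where w: "A * (\<psi> - l) + B * g = \<gamma>" "degree \<gamma> \<le> 3" "\<gamma> \<noteq> 0" "\<psi> \<noteq> l"
      "\<And>j. j < n \<Longrightarrow> order (x j) \<gamma> = min (order (x j) (\<psi> - l)) (r j)"
    using line_gcd[OF l(1)] by metis
  define k where "k = order (x j) (\<psi> - l)"
  obtain h where h: "\<psi> - l = X j ^ k * h" "poly h (x j) \<noteq> 0"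
    using order_decomp[of "\<psi> - l" "x j"] w(4) by (auto simp: k_def poly_eq_0_iff_dvd)
  have line: "inI i" "cA j i = poly (q * Mj) (x j)" "cB j i = poly (X j ^ e * Mj) (x j)" "cC j i = 0"
    "i = 0 + [:- l, 1:] * [:X j ^ (r j + e) * Mj:]"
    if i: "i = [:- l, 1:] * [:X j ^ (r j + e) * Mj:]" and q: "(\<psi> - l) * X j ^ e = X j ^ r j * q" for i e q
  proof -
    have 1: "poly i \<psi> = X j ^ m j * (q * Mj)"
    proof -
      have "poly i \<psi> = ((\<psi> - l) * X j ^ e) * X j ^ r j * Mj" by (simp add: i algebra_simps power_add)
      then show ?thesis unfolding q t by (simp add: algebra_simps flip: power_add mult_2)
    qed
    have 2: "poly (pderiv i) \<psi> = X j ^ r j * (X j ^ e * Mj)"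
      by (simp add: i pderiv_mult pderiv_pCons pderiv_smult power_add algebra_simps)
    show "cA j i = poly (q * Mj) (x j)" "cB j i = poly (X j ^ e * Mj) (x j)"
      by (rule cA_eq[OF 1], rule cB_eq[OF 2])
    show "cC j i = 0" by (simp add: cC_def i pderiv_mult pderiv_pCons pderiv_smult pderiv_add pderiv_diff pderiv_minus)
    show "inI i" unfolding inI_def 1 2 Mj(1) unfolding Mj(2) using Mj(5) by (auto intro!: mult_dvd_mono)
    show "i = 0 + [:- l, 1:] * [:X j ^ (r j + e) * Mj:]" by (simp add: i)
  qed
  show "\<exists>i p s. inI i \<and> cA j i + cB j i * v + cC j i * v\<^sup>2 \<noteq> 0 \<and> tdeg_le d p \<and> i = p + [:- l, 1:] * s"
  proof (cases "k < r j")
    case True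
    define e where "e = r j - k"
    have "(\<psi> - l) * X j ^ e = X j ^ r j * h" using True by (simp add: h(1) e_def flip: power_add)
    note L = line[OF refl this]
    have "cA j ([:- l, 1:] * [:X j ^ (r j + e) * Mj:]) + cB j ([:- l, 1:] * [:X j ^ (r j + e) * Mj:]) * v
        + cC j ([:- l, 1:] * [:X j ^ (r j + e) * Mj:]) * v\<^sup>2 \<noteq> 0"
      unfolding L(2-4) using h(2) Mj(3) True by (simp add: e_def power_0_left)
    then show ?thesis using L(1,5) tdeg_le_0 by metis
  next
    case False
    define q where "q = X j ^ (k - r j) * h"
    have q: "\<psi> - l = X j ^ r j * q" using False by (simp add: h(1) q_def flip: power_add mult.assoc)
    then have "(\<psi> - l) * X j ^ 0 = X j ^ r j * q" by simp
    note L = line[OF refl this]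
    show ?thesis
    proof (cases "poly q (x j) + v = 0")
      case False
      have "cA j ([:- l, 1:] * [:X j ^ (r j + 0) * Mj:]) + cB j ([:- l, 1:] * [:X j ^ (r j + 0) * Mj:]) * v
        + cC j ([:- l, 1:] * [:X j ^ (r j + 0) * Mj:]) * v\<^sup>2 = (poly q (x j) + v) * poly Mj (x j)"
        unfolding L(2-4) by (simp add: algebra_simps)
      also have "\<dots> \<noteq> 0" using False Mj(3) by simp
      finally show ?thesis using L(1,5) tdeg_le_0 by metis
    next
      case True
      then have v: "v = - poly q (x j)" by (simp add: add_eq_0_iff)
      have \<gamma>: "\<gamma> = X j ^ r j * (A * q + B * gj)"
        unfolding w(1)[symmetric] q Mj(2) by (simp add: algebra_simps)
      have nz: "poly (A * q + B * gj) (x j) \<noteq> 0"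
      proof
        assume "poly (A * q + B * gj) (x j) = 0"
        then obtain s where "A * q + B * gj = X j * s" by (metis dvdE poly_eq_0_iff_dvd)
        then have "\<gamma> = X j ^ Suc (r j) * s" using \<gamma> by (simp only: power_Suc2 mult.assoc)
        then have "Suc (r j) \<le> order (x j) \<gamma>" using w(3) order_divides[of "x j" "Suc (r j)" \<gamma>] by simp
        then show False using w(5)[OF j] by simp
      qed
      have "poly (sq A B) \<psi> = X j ^ m j * (B * gj)\<^sup>2" "poly (pderiv (sq A B)) \<psi> = X j ^ r j * (- 2 * A * B * gj)"
        unfolding sq_arc Mj(2) t by (simp_all only: power_mult_distrib power_mult[symmetric] ac_simps)
      then have "cA j (sq A B) = poly ((B * gj)\<^sup>2) (x j)" "cB j (sq A B) = poly (- 2 * A * B * gj) (x j)"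
        using cA_eq cB_eq by blast+
      moreover have "cC j (sq A B) = poly (A\<^sup>2) (x j)" by (simp add: cC_def sq_arc)
      ultimately have "cA j (sq A B) + cB j (sq A B) * v + cC j (sq A B) * v\<^sup>2 = (poly (A * q + B * gj) (x j))\<^sup>2"
        by (simp add: v algebra_simps power2_eq_square)
      then have "cA j (sq A B) + cB j (sq A B) * v + cC j (sq A B) * v\<^sup>2 \<noteq> 0" using nz by simp
      then show ?thesis using inI_sq sq_line_witness[OF w(1,2)] by blast
    qed
  qed
qed (use coefficients_vanish[OF _ j] in \<open>auto simp: cABC_add cABC_smult algebra_simps\<close>)

end

text \<open>The homogeneous part of degree e at x = 1. If f has degree e, the roots are the slopes
  of its points at infinity, and the vertical direction is one of these points iff the coefficient
  of y^e vanishes.\<close>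

definition top_form :: "nat \<Rightarrow> 'a::field poly poly \<Rightarrow> 'a poly" where
  "top_form e f = (\<Sum>j\<le>e. monom (coeff (coeff f j) (e - j)) j)"

lemma coeff_top_form: "coeff (top_form e f) j = (if j \<le> e then coeff (coeff f j) (e - j) else 0)"
proof (cases "j \<le> e")
  case True
  then have "coeff (top_form e f) j = (\<Sum>i\<le>e. if i = j then coeff (coeff f i) (e - i) else 0)"
    unfolding top_form_def coeff_sum coeff_monom by simp
  also have "\<dots> = coeff (coeff f j) (e - j)" using True by simp
  finally show ?thesis using True by simp
next
  case False
  then have "coeff (top_form e f) j = (\<Sum>i\<le>e. 0)"
    unfolding top_form_def coeff_sum coeff_monom by (intro sum.cong) auto
  with False show ?thesis by simp
qed

lemma degree_top_form: "degree (top_form e f) \<le> e"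
  by (rule degree_le) (simp add: coeff_top_form)

lemma top_form_add: "top_form e (f + h) = top_form e f + top_form e h"
  and top_form_smult: "top_form e (smult [:c:] f) = smult c (top_form e f)"
  by (rule poly_eqI; simp add: coeff_top_form)+

lemma top_form_0:
  assumes "tdeg_le e' f" "e' < e"
  shows "top_form e f = 0"
  using assms by (intro poly_eqI) (auto simp: coeff_top_form intro: tdeg_leD)

lemma top_form_mult:
  assumes "tdeg_le e f" "tdeg_le e' h"
  shows "top_form (e + e') (f * h) = top_form e f * top_form e' h"
proof (rule poly_eqI)
  fix j
  show "coeff (top_form (e + e') (f * h)) j = coeff (top_form e f * top_form e' h) j"
  proof (cases "j \<le> e + e'")
    case True
    have inner: "(\<Sum>m\<le>e + e' - j. coeff (coeff f l) m * coeff (coeff h (j - l)) (e + e' - j - m))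
        = coeff (top_form e f) l * coeff (top_form e' h) (j - l)" if "l \<le> j" for l
    proof (cases "l \<le> e \<and> j - l \<le> e'")
      case ok: True
      have "coeff (coeff f l) m * coeff (coeff h (j - l)) (e + e' - j - m) = 0"
        if "m \<le> e + e' - j" "m \<noteq> e - l" for m
      proof (cases "e < m + l")
        case False
        then have "e' < (e + e' - j - m) + (j - l)" using that ok True \<open>l \<le> j\<close> by linarith
        then show ?thesis using tdeg_leD[OF assms(2)] by simp
      qed (use tdeg_leD[OF assms(1)] in simp)
      then have 1: "(\<Sum>m\<le>e + e' - j. coeff (coeff f l) m * coeff (coeff h (j - l)) (e + e' - j - m))
        = (\<Sum>m\<in>{e - l}. coeff (coeff f l) m * coeff (coeff h (j - l)) (e + e' - j - m))"
        using ok True that by (intro sum.mono_neutral_right) auto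
      have 2: "e + e' - j - (e - l) = e' - (j - l)" using ok that True by linarith
      have "(\<Sum>m\<in>{e - l}. coeff (coeff f l) m * coeff (coeff h (j - l)) (e + e' - j - m))
        = coeff (coeff f l) (e - l) * coeff (coeff h (j - l)) (e + e' - j - (e - l))" by simp
      then show ?thesis unfolding 1 2 using ok by (simp only: coeff_top_form if_True)
    next
      case False
      have "coeff (coeff f l) m * coeff (coeff h (j - l)) k = 0" for m k
        using False tdeg_leD[OF assms(1), of m l] tdeg_leD[OF assms(2), of k "j - l"] by fastforce
      then have "(\<Sum>m\<le>e + e' - j. coeff (coeff f l) m * coeff (coeff h (j - l)) (e + e' - j - m)) = 0"
        by (intro sum.neutral) simp
      then show ?thesis using False by (simp only: coeff_top_form) auto
    qed
    have "coeff (top_form (e + e') (f * h)) j = (\<Sum>l\<le>j. \<Sum>m\<le>e + e' - j.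
        coeff (coeff f l) m * coeff (coeff h (j - l)) (e + e' - j - m))"
      using True by (simp add: coeff_top_form coeff_mult coeff_sum)
    also have "\<dots> = coeff (top_form e f * top_form e' h) j"
      unfolding coeff_mult by (intro sum.cong refl inner) simp
    finally show ?thesis .
  next
    case False
    have "degree (top_form e f * top_form e' h) \<le> e + e'"
      using degree_mult_le[of "top_form e f" "top_form e' h"] degree_top_form[of e f] degree_top_form[of e' h] by linarith
    with False show ?thesis by (simp add: coeff_top_form coeff_eq_0)
  qed
qed

lemma top_form_const: "degree c \<le> e \<Longrightarrow> top_form e [:c:] = [:coeff c e:]"
  by (rule poly_eqI) (auto simp: coeff_top_form coeff_pCons split: nat.splits)

section \<open>The system along the line at infinity\<close>

context scheme
begin

text \<open>The test element is \<open>sq\<close> for the line y = s + y0 x, multiplied by the power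
  of x that brings \<gamma>^2 up to degree exactly d.\<close>

lemma top_nonzero_slope: "\<exists>f\<in>\<Lambda>. poly (top_form d f) y0 \<noteq> 0"
proof (rule top_functional_nonzero[where l = "[:[:0, - y0:], 1:]"])
  have lin: "tdeg_le 1 [:[:0, - y0:], 1:]" using tdeg_le_linear[of "[:0, - y0:]" 1] by (simp add: one_pCons)
  then show "tdeg_le 1 [:[:0, - y0:], 1:]" .
  have d: "1 + (d - 1) = d" using d6 by simp
  fix p :: "'k poly poly" assume p: "tdeg_le (d - 1) p"
  show "poly (top_form d p) y0 = 0" using top_form_0[OF p] d6 by simp
  have "top_form 1 [:[:0, - y0:], 1:] = [:- y0, 1:]"
    by (rule poly_eqI) (auto simp: coeff_top_form coeff_pCons le_Suc_eq split: nat.splits)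
  then have "top_form d ([:[:0, - y0:], 1:] * p) = [:- y0, 1:] * top_form (d - 1) p"
    using top_form_mult[OF lin p] d by simp
  then show "poly (top_form d ([:[:0, - y0:], 1:] * p)) y0 = 0" by simp
next
  have "tdeg_le d [:monom 1 d :: 'k poly:]" by (rule tdeg_le_const) (simp add: degree_monom_le)
  moreover have "top_form d [:monom 1 d :: 'k poly:] = [:1:]" by (subst top_form_const) (auto simp: degree_monom_le)
  ultimately show "\<exists>p. tdeg_le d p \<and> poly (top_form d p) y0 \<noteq> 0" by (metis one_neq_zero poly_1 one_pCons)
next
  fix s
  define L where "L = [:s, y0:]"
  have "degree L \<le> 1" by (simp add: L_def)
  from line_gcd[OF this] obtain A B \<gamma> where w: "A * (\<psi> - L) + B * g = \<gamma>" "degree \<gamma> \<le> 3" "\<gamma> \<noteq> 0" by metis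
  obtain h where h: "sq A B = [:\<gamma>\<^sup>2:] + [:- L, 1:] * h" using sq_line_witness[OF w(1,2)] by blast
  define k where "k = d - 2 * degree \<gamma>"
  have k: "2 * degree \<gamma> + k = d" using w(2) d6 by (simp add: k_def)
  define p where "p = [:monom 1 k * \<gamma>\<^sup>2:]"
  have "degree (monom 1 k * \<gamma>\<^sup>2) = d" using k w(3) by (simp add: degree_mult_eq degree_power_eq degree_monom_eq)
  moreover from this have "coeff (monom 1 k * \<gamma>\<^sup>2) d \<noteq> 0" using w(3) by (metis leading_coeff_0_iff mult_eq_0_iff monom_eq_0_iff one_neq_zero power_not_zero)
  ultimately have "tdeg_le d p" "poly (top_form d p) y0 \<noteq> 0" by (simp_all add: p_def tdeg_le_const top_form_const)
  moreover have "inI ([:monom 1 k:] * sq A B)" by (intro inI_mult inI_sq)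
  moreover have "[:monom 1 k:] * sq A B = p + ([:[:0, - y0:], 1:] - [:[:s:]:]) * ([:monom 1 k:] * h)"
  proof -
    have "[:- L, 1:] = [:[:0, - y0:], 1:] - [:[:s:]:]" by (simp add: L_def)
    moreover have "[:monom 1 k:] * sq A B = [:monom 1 k:] * [:\<gamma>\<^sup>2:] + [:- L, 1:] * ([:monom 1 k:] * h)"
      unfolding h by (simp only: distrib_left mult.left_commute)
    ultimately show ?thesis by (simp add: p_def)
  qed
  ultimately show "\<exists>i p h. inI i \<and> poly (top_form d p) y0 \<noteq> 0 \<and> tdeg_le d p \<and> i = p + ([:[:0, - y0:], 1:] - [:[:s:]:]) * h"
    by blast
qed (simp_all add: top_form_add top_form_smult)

text \<open>The test element is y^(d-2) (y - \<psi>)^2, which on the line x = s becomes monic of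
  degree d in y with constant coefficients.\<close>

lemma top_nonzero_vertical: "\<exists>f\<in>\<Lambda>. coeff (top_form d f) d \<noteq> 0"
proof (rule top_functional_nonzero[where l = "[:[:0, 1:]:]"])
  show "tdeg_le 1 ([:[:0, 1:]:] :: 'k poly poly)" by (rule tdeg_le_const) simp
  fix p :: "'k poly poly" assume p: "tdeg_le (d - 1) p"
  show "coeff (top_form d p) d = 0" using top_form_0[OF p] d6 by simp
  show "coeff (top_form d ([:[:0, 1:]:] * p)) d = 0" by (simp add: coeff_top_form)
next
  have "tdeg_le d (monom (monom 1 0) d :: 'k poly poly)" by (rule tdeg_le_monom) simp
  moreover have "coeff (top_form d (monom (monom 1 0) d :: 'k poly poly)) d \<noteq> 0" by (simp add: coeff_top_form)
  ultimately show "\<exists>p. tdeg_le d p \<and> coeff (top_form d (p :: 'k poly poly)) d \<noteq> 0" by blast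
next
  fix s
  obtain h where h: "[:- \<psi>, 1:]\<^sup>2 = [:[:- poly \<psi> s:], 1:]\<^sup>2 + [:[:- s, 1:]:] * h"
    using graph_square_vertical by blast
  define p where "p = monom 1 (d - 2) * [:[:- poly \<psi> s:], 1:]\<^sup>2"
  have "tdeg_le (d - 2) (monom (monom 1 0) (d - 2) :: 'k poly poly)" by (rule tdeg_le_monom) simp
  moreover have "tdeg_le 2 ([:[:- poly \<psi> s:], 1:]\<^sup>2)"
    using tdeg_le_power[OF tdeg_le_linear[of "[:- poly \<psi> s:]" 1], of 2] by (simp add: one_pCons)
  ultimately have "tdeg_le (d - 2 + 2) p" unfolding p_def by (intro tdeg_le_mult) (simp_all add: monom_0 one_pCons)
  moreover have "d - 2 + 2 = d" using d6 by linarith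
  ultimately have "tdeg_le d p" by (simp only:)
  moreover have "coeff p d = 1"
  proof -
    have "coeff p d = coeff ([:[:- poly \<psi> s:], 1:]\<^sup>2) 2" unfolding p_def coeff_monom_mult using d6 by simp
    also have "\<dots> = 1" by (simp add: power2_eq_square numeral_2_eq_2)
    finally show ?thesis .
  qed
  then have "coeff (top_form d p) d \<noteq> 0" by (simp add: coeff_top_form)
  moreover have "inI (monom 1 (d - 2) * [:- \<psi>, 1:]\<^sup>2)" by (intro inI_mult graph_square_vertical)
  moreover have "monom 1 (d - 2) * [:- \<psi>, 1:]\<^sup>2 = p + ([:[:0, 1:]:] - [:[:s:]:]) * (monom 1 (d - 2) * h)"
  proof -
    have "[:[:0, 1:]:] - [:[:s:]:] = [:[:- s, 1:]:]" by simp
    then show ?thesis unfolding h p_def by (simp only: distrib_left mult.left_commute)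
  qed
  ultimately show "\<exists>i p h. inI i \<and> coeff (top_form d p) d \<noteq> 0 \<and> tdeg_le d p \<and> i = p + ([:[:0, 1:]:] - [:[:s:]:]) * h"
    by blast
qed (simp_all add: top_form_add top_form_smult)

end

section \<open>Pencils of plane curves\<close>

definition slice :: "'a::field \<Rightarrow> 'a poly poly \<Rightarrow> 'a poly" where
  "slice a f = map_poly (\<lambda>c. poly c a) f"

lemma coeff_slice: "coeff (slice a f) j = poly (coeff f j) a"
  by (simp add: slice_def coeff_map_poly)

lemma poly_slice: "poly (slice a f) b = eval2 f a b"
  by (induction f) (auto simp: slice_def map_poly_pCons)

lemma slice_add: "slice a (f + h) = slice a f + slice a h"
  and slice_diff: "slice a (f - h) = slice a f - slice a h"
  and pderiv_slice: "pderiv (slice a f) = slice a (pderiv f)"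
  by (rule poly_eqI; simp add: coeff_slice coeff_pderiv)+

lemma slice_mult: "slice a (f * h) = slice a f * slice a h"
  unfolding slice_def by (rule map_poly_hom_mult) auto

lemma pseudo_division:
  fixes g :: "'a::idom poly"
  assumes "g \<noteq> 0"
  shows "\<exists>a q r. a \<noteq> 0 \<and> smult a f = g * q + r \<and> (r = 0 \<or> degree r < degree g)"
  using pseudo_mod[OF assms, of f] by blast

text \<open>The ideal of \<open>f\<close> and \<open>h\<close> becomes principal after inverting a polynomial in \<open>x\<close>.\<close>

lemma generically_principal:
  fixes f h :: "'a::idom poly"
  assumes "f \<noteq> 0 \<or> h \<noteq> 0"
  obtains R A B where "R \<noteq> 0" "R = A * f + B * h"
    "\<And>A B. \<exists>c Q. c \<noteq> 0 \<and> smult c (A * f + B * h) = R * Q"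
proof -
  define S where "S = {R. R \<noteq> 0 \<and> (\<exists>A B. R = A * f + B * h)}"
  have "f = 1 * f + 0 * h" "h = 0 * f + 1 * h" by simp_all
  then have "f \<in> S \<or> h \<in> S" using assms unfolding S_def by blast
  then obtain R where R: "R \<in> S" and min: "\<And>R'. R' \<in> S \<Longrightarrow> degree R \<le> degree R'"
    using ex_has_least_nat[of "\<lambda>R. R \<in> S" _ degree] by metis
  obtain A B where AB: "R = A * f + B * h" "R \<noteq> 0" using R by (auto simp: S_def)
  have "\<exists>c Q. c \<noteq> 0 \<and> smult c (A' * f + B' * h) = R * Q" for A' B'
  proof -
    obtain c Q r where c: "c \<noteq> 0" "smult c (A' * f + B' * h) = R * Q + r" "r = 0 \<or> degree r < degree R"
      using pseudo_division[OF AB(2)] by metis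
    have "r = smult c (A' * f + B' * h) - R * Q" using c(2) by simp
    also have "\<dots> = (smult c A' - A * Q) * f + (smult c B' - B * Q) * h"
      unfolding AB(1) by (simp add: algebra_simps smult_add_right)
    finally have "r = 0" using c(3) min[of r] unfolding S_def by (metis (mono_tags, lifting) mem_Collect_eq not_le)
    with c show ?thesis by auto
  qed
  with AB show thesis using that by blast
qed

text \<open>Compare orders at y, where v is a unit: for u \<noteq> 0 the left side has the order of
  u minus 1, by characteristic 0, and the right side at least the order of u.\<close>

lemma eq_0_of_log_derivative:
  fixes u v :: "'a::field_char_0 poly"
  assumes eq: "v * pderiv u = u * pderiv v" and "poly u y = 0" "poly v y \<noteq> 0"
  shows "u = 0"
proof (rule ccontr)
  assume "u \<noteq> 0"
  have "pderiv u \<noteq> 0"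
  proof
    assume "pderiv u = 0"
    then obtain c where "u = [:c:]" unfolding pderiv_eq_0_iff using degree0_coeffs by blast
    with assms(2) \<open>u \<noteq> 0\<close> show False by simp
  qed
  moreover have "v \<noteq> 0" using assms(3) by auto
  ultimately have nz: "v * pderiv u \<noteq> 0" by simp
  have "order y v = 0" using assms(3) by (rule order_0I)
  then have "order y (pderiv u) = order y u + order y (pderiv v)"
    using order_mult[OF nz, of y] order_mult[OF nz[unfolded eq], of y] eq by simp
  moreover have "order y u = Suc (order y (pderiv u))" using order_pderiv[OF \<open>u \<noteq> 0\<close> assms(2)] .
  ultimately show False by simp
qed

text \<open>A double root y of u + c v is a root of the Wronskian W, and v(y) \<noteq> 0 recovers c
  from y. That u has a root at which v does not vanish makes W nonzero.\<close>

lemma pencil_double_roots: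
  fixes u v :: "'k::{alg_closed_field, field_char_0} poly"
  assumes "0 < degree u" and coprime: "\<And>y. poly u y = 0 \<Longrightarrow> poly v y \<noteq> 0"
  shows "finite {c. \<exists>y. poly (u + smult c v) y = 0 \<and> poly (pderiv (u + smult c v)) y = 0}"
proof -
  define W where "W = v * pderiv u - u * pderiv v"
  obtain y0 where y0: "poly u y0 = 0" using alg_closed_imp_poly_has_root assms(1) by blast
  have "W \<noteq> 0"
  proof
    assume "W = 0"
    then have "u = 0" using eq_0_of_log_derivative[of v u y0] y0 coprime by (simp add: W_def)
    with assms(1) show False by simp
  qed
  have "{c. \<exists>y. poly (u + smult c v) y = 0 \<and> poly (pderiv (u + smult c v)) y = 0}
      \<subseteq> (\<lambda>y. - poly u y / poly v y) ` {y. poly W y = 0}"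
  proof safe
    fix c y assume y: "poly (u + smult c v) y = 0" "poly (pderiv (u + smult c v)) y = 0"
    have e: "poly u y = - (c * poly v y)" "poly (pderiv u) y = - (c * poly (pderiv v) y)"
      using y by (auto simp: pderiv_add pderiv_smult add_eq_0_iff2)
    have "poly W y = 0" by (simp add: W_def e)
    moreover have "poly v y \<noteq> 0" using coprime[of y] e by auto
    then have "c = - poly u y / poly v y" using e(1) by (simp add: field_simps)
    ultimately show "c \<in> (\<lambda>y. - poly u y / poly v y) ` {y. poly W y = 0}" by blast
  qed
  then show ?thesis using poly_roots_finite[OF \<open>W \<noteq> 0\<close>] finite_subset by blast
qed

text \<open>On a curve \<open>G = 0\<close> containing infinitely many of the singular points, \<open>f / h\<close> has derivative \<open>0\<close>
  along the Hamiltonian derivation \<open>D\<close> of \<open>G\<close>, so that near a singular point \<open>f + c h\<close> and \<open>G\<close> would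
  have a common component, although only one value of \<open>f / h\<close> is allowed there.\<close>

lemma pencil_singular_points:
  fixes f h :: "'k::field_char_0 poly poly"
  assumes f: "coeff f d = [:c0:]" "c0 \<noteq> 0" and h: "coeff h d = [:c1:]"
  shows "finite {c. \<exists>a b. eval2 (f + smult [:c:] h) a b = 0 \<and> eval2 (pdx (f + smult [:c:] h)) a b = 0
      \<and> eval2 (pderiv (f + smult [:c:] h)) a b = 0 \<and> eval2 h a b \<noteq> 0}" (is "finite ?bad")
proof (rule ccontr)
  assume inf: "infinite ?bad"
  define F where "F = (\<lambda>c. f + smult [:c:] h)"
  \<comment> \<open>Removing this value keeps the coefficient of y^d in F c nonzero, so that F c
    vanishes on no vertical line.\<close>
  define B where "B = ?bad - {- c0 / c1}"
  have infB: "infinite B" using inf by (simp add: B_def)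
  have "\<forall>c\<in>B. \<exists>p. eval2 (F c) (fst p) (snd p) = 0 \<and> eval2 (pdx (F c)) (fst p) (snd p) = 0
      \<and> eval2 (pderiv (F c)) (fst p) (snd p) = 0 \<and> eval2 h (fst p) (snd p) \<noteq> 0"
    by (auto simp: B_def F_def)
  then obtain p where p: "\<And>c. c \<in> B \<Longrightarrow> eval2 (F c) (fst (p c)) (snd (p c)) = 0 \<and> eval2 (pdx (F c)) (fst (p c)) (snd (p c)) = 0
      \<and> eval2 (pderiv (F c)) (fst (p c)) (snd (p c)) = 0 \<and> eval2 h (fst (p c)) (snd (p c)) \<noteq> 0"
    by metis
  define ev where "ev = (\<lambda>c G. eval2 G (fst (p c)) (snd (p c)))"
  have ev: "ev c (G + G') = ev c G + ev c G'" "ev c (G - G') = ev c G - ev c G'" "ev c (G * G') = ev c G * ev c G'"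
    "ev c (smult s G) = poly s (fst (p c)) * ev c G" for c G G' s
    by (simp_all add: ev_def)
  have z: "ev c (F c) = 0" "ev c (pdx (F c)) = 0" "ev c (pderiv (F c)) = 0" "ev c h \<noteq> 0" if "c \<in> B" for c
    using p[OF that] by (simp_all add: ev_def)
  have uniq: "c' = c" if "c \<in> B" "ev c (F c') = 0" for c c'
  proof -
    have "ev c (F c') = ev c (F c) + (c' - c) * ev c h" by (simp add: F_def ev algebra_simps)
    with that z show ?thesis by simp
  qed
  \<comment> \<open>These are the numerators of the partial derivatives of f / h. They do not depend
    on c when f is replaced by F c, and so vanish at all the points p c at once.\<close>
  define Wx where "Wx = h * pdx f - f * pdx h"
  define Wy where "Wy = h * pderiv f - f * pderiv h"
  have W: "Wx = h * pdx (F c) - F c * pdx h" "Wy = h * pderiv (F c) - F c * pderiv h" for c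
    unfolding Wx_def Wy_def F_def
    by (simp_all add: pdx_add pdx_smult pderiv_add pderiv_smult pderiv_pCons algebra_simps)
  have W0: "ev c Wx = 0" "ev c Wy = 0" if "c \<in> B" for c
    using z[OF that] by (simp_all add: W(1)[of c] W(2)[of c] ev)
  have slice_W: "slice (fst (p c)) Wy \<noteq> 0" if "c \<in> B" for c
  proof
    assume "slice (fst (p c)) Wy = 0"
    then have "slice (fst (p c)) h * pderiv (slice (fst (p c)) (F c)) = slice (fst (p c)) (F c) * pderiv (slice (fst (p c)) h)"
      unfolding W(2)[of c] by (simp add: slice_diff slice_mult pderiv_slice)
    then have "slice (fst (p c)) (F c) = 0"
      by (rule eq_0_of_log_derivative[where y = "snd (p c)"]) (use z[OF that] in \<open>simp_all add: poly_slice ev_def\<close>)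
    then have "coeff (slice (fst (p c)) (F c)) d = 0" by simp
    then have "c0 + c * c1 = 0" by (simp add: coeff_slice F_def f h mult.commute)
    then have "c = - c0 / c1" using f(2) by (cases "c1 = 0") (auto simp: field_simps add_eq_0_iff)
    with that show False by (simp add: B_def)
  qed
  have fin_x: "finite {c \<in> B. fst (p c) = a}" for a
  proof (cases "\<exists>c\<in>B. fst (p c) = a")
    case True
    then have nz: "slice a Wy \<noteq> 0" using slice_W by blast
    have "(\<lambda>c. snd (p c)) ` {c \<in> B. fst (p c) = a} \<subseteq> {y. poly (slice a Wy) y = 0}"
      using W0(2) by (auto simp: poly_slice ev_def)
    then have "finite ((\<lambda>c. snd (p c)) ` {c \<in> B. fst (p c) = a})"
      using poly_roots_finite[OF nz] finite_subset by blast
    moreover have "inj_on (\<lambda>c. snd (p c)) {c \<in> B. fst (p c) = a}"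
    proof (rule inj_onI)
      fix c c' assume "c \<in> {c \<in> B. fst (p c) = a}" "c' \<in> {c \<in> B. fst (p c) = a}" "snd (p c) = snd (p c')"
      then have "c \<in> B" "ev c (F c') = 0" using z(1)[of c'] by (auto simp: ev_def)
      then show "c = c'" using uniq[of c c'] by simp
    qed
    ultimately show ?thesis using finite_imageD by blast
  next
    case False
    then have "{c \<in> B. fst (p c) = a} = {}" by blast
    then show ?thesis by (simp only: finite.emptyI)
  qed
  have fin_poly: "finite {c \<in> B. poly P (fst (p c)) = 0}" if "P \<noteq> 0" for P
  proof -
    have "{c \<in> B. poly P (fst (p c)) = 0} = (\<Union>a\<in>{a. poly P a = 0}. {c \<in> B. fst (p c) = a})" by auto
    then show ?thesis using poly_roots_finite[OF that] fin_x by simp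
  qed
  \<comment> \<open>Curves through infinitely many of the points. For G of least degree in y,
    everything that vanishes at all the chosen points on G is a multiple of G up to a factor in
    x.\<close>
  define S where "S = {G. G \<noteq> 0 \<and> infinite {c \<in> B. ev c G = 0}}"
  have "Wy \<in> S"
  proof -
    obtain c where "c \<in> B" using infB by (metis ex_in_conv finite.emptyI)
    then have "Wy \<noteq> 0" using slice_W by (auto simp: slice_def)
    moreover have "{c \<in> B. ev c Wy = 0} = B" using W0 by auto
    ultimately show ?thesis using infB by (simp add: S_def)
  qed
  then obtain G where G: "G \<in> S" and min: "\<And>G'. G' \<in> S \<Longrightarrow> degree G \<le> degree G'"
    using ex_has_least_nat[of "\<lambda>R. R \<in> S" _ degree] by metis
  define C where "C = {c \<in> B. ev c G = 0}"
  have infC: "infinite C" and Gnz: "G \<noteq> 0" and CB: "C \<subseteq> B" using G by (auto simp: S_def C_def)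
  have small: "finite {c \<in> C. ev c R = 0}" if "R \<noteq> 0" "degree R < degree G" for R
  proof (rule ccontr)
    assume "\<not> ?thesis"
    moreover have "{c \<in> C. ev c R = 0} \<subseteq> {c \<in> B. ev c R = 0}" using CB by auto
    ultimately have "R \<in> S" using that finite_subset unfolding S_def by blast
    with min that(2) show False by fastforce
  qed
  have degG: "0 < degree G"
  proof (rule ccontr)
    assume "\<not> ?thesis"
    then obtain P where P: "G = [:P:]" using degree0_coeffs by blast
    then have "P \<noteq> 0" using Gnz by auto
    have "C = {c \<in> B. poly P (fst (p c)) = 0}" by (simp add: C_def P ev_def)
    with fin_poly[OF \<open>P \<noteq> 0\<close>] infC show False by simp
  qed
  have div: "\<exists>s Q. s \<noteq> 0 \<and> smult s E = G * Q" if "\<And>c. c \<in> C \<Longrightarrow> ev c E = 0" for E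
  proof -
    obtain s Q r where s: "s \<noteq> 0" "smult s E = G * Q + r" "r = 0 \<or> degree r < degree G"
      using pseudo_division[OF Gnz] by metis
    have "ev c r = 0" if "c \<in> C" for c
    proof -
      have "ev c (smult s E) = ev c (G * Q + r)" using s(2) by simp
      then show ?thesis using that \<open>\<And>c. c \<in> C \<Longrightarrow> ev c E = 0\<close> by (simp add: ev C_def)
    qed
    then have "{c \<in> C. ev c r = 0} = C" by auto
    with infC small[of r] s(3) have "r = 0" by auto
    with s show ?thesis by auto
  qed
  obtain s1 Q1 where s1: "s1 \<noteq> 0" "smult s1 Wx = G * Q1" using div[of Wx] W0 CB by blast
  obtain s2 Q2 where s2: "s2 \<noteq> 0" "smult s2 Wy = G * Q2" using div[of Wy] W0 CB by blast
  have "finite {c \<in> C. ev c (pderiv G) = 0}"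
    using degG by (intro small) (auto simp: pderiv_eq_0_iff degree_pderiv)
  moreover have "finite {c \<in> C. poly (s1 * s2) (fst (p c)) = 0}"
    by (rule finite_subset[OF _ fin_poly[of "s1 * s2"]]) (use s1(1) s2(1) CB in auto)
  ultimately have "infinite (C - ({c \<in> C. ev c (pderiv G) = 0} \<union> {c \<in> C. poly (s1 * s2) (fst (p c)) = 0}))"
    using infC by simp
  then obtain c where c: "c \<in> C" "ev c (pderiv G) \<noteq> 0" "poly s1 (fst (p c)) \<noteq> 0" "poly s2 (fst (p c)) \<noteq> 0"
    by (auto dest!: infinite_imp_nonempty)
  then have cB: "c \<in> B" and cG: "ev c G = 0" by (auto simp: C_def)
  \<comment> \<open>R is a greatest common divisor of F c and G up to factors in x. If it involved
    y, it would vanish at infinitely many of the points, and then so would F c, against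
    \<open>uniq\<close>.\<close>
  obtain R A A' where R: "R \<noteq> 0" "R = A * F c + A' * G" "\<And>A B. \<exists>s Q. s \<noteq> 0 \<and> smult s (A * F c + B * G) = R * Q"
    using generically_principal[of "F c" G] Gnz by metis
  define K where "K = {A * F c + A' * G | A A'. True}"
  have Kadd: "u + v \<in> K" if uv: "u \<in> K" "v \<in> K" for u v
  proof -
    obtain a a' b b' where "u = a * F c + a' * G" "v = b * F c + b' * G" using uv by (auto simp: K_def)
    then have "u + v = (a + b) * F c + (a' + b') * G" by (simp add: algebra_simps)
    then show ?thesis unfolding K_def by blast
  qed
  have Kmult: "u * v \<in> K" if v: "v \<in> K" for u v
  proof -
    obtain a a' where "v = a * F c + a' * G" using v by (auto simp: K_def)
    then have "u * v = (u * a) * F c + (u * a') * G" by (simp add: algebra_simps)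
    then show ?thesis unfolding K_def by blast
  qed
  have KF: "F c \<in> K" and KG: "G \<in> K"
  proof -
    have "F c = 1 * F c + 0 * G" "G = 0 * F c + 1 * G" by simp_all
    then show "F c \<in> K" "G \<in> K" unfolding K_def by blast+
  qed
  have K0: "ev c u = 0" if "u \<in> K" for u using that z(1)[OF cB] cG by (auto simp: K_def ev)
  have degR: "degree R = 0"
  proof (rule ccontr)
    assume "degree R \<noteq> 0"
    obtain s Q where s: "s \<noteq> 0" "smult s G = R * Q" using R(3)[of 0 1] by auto
    have "Q \<noteq> 0" using s Gnz by auto
    have "degree G = degree R + degree Q"
      using s R(1) \<open>Q \<noteq> 0\<close> degree_mult_eq[of R Q] degree_smult_eq[of s G] by simp
    then have "finite {c \<in> C. ev c Q = 0}" using \<open>degree R \<noteq> 0\<close> \<open>Q \<noteq> 0\<close> small by simp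
    moreover have "C \<subseteq> {c \<in> C. ev c Q = 0} \<union> {c \<in> C. ev c R = 0}"
    proof
      fix b assume b: "b \<in> C"
      have "ev b (smult s G) = ev b (R * Q)" using s by simp
      then show "b \<in> {c \<in> C. ev c Q = 0} \<union> {c \<in> C. ev c R = 0}" using b by (auto simp: ev C_def)
    qed
    ultimately have infR: "infinite {c \<in> C. ev c R = 0}" using infC by (meson finite_Un finite_subset)
    obtain s' Q' where s': "s' \<noteq> 0" "smult s' (F c) = R * Q'" using R(3)[of 1 0] by auto
    have "{b \<in> C. ev b R = 0} \<subseteq> {b \<in> B. poly s' (fst (p b)) = 0} \<union> {c}"
    proof
      fix b assume b: "b \<in> {b \<in> C. ev b R = 0}"
      have "ev b (smult s' (F c)) = ev b (R * Q')" using s' by simp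
      then have "poly s' (fst (p b)) = 0 \<or> ev b (F c) = 0" using b by (simp add: ev)
      then show "b \<in> {b \<in> B. poly s' (fst (p b)) = 0} \<union> {c}" using b uniq[of b c] CB by auto
    qed
    with infR fin_poly[OF s'(1)] finite_subset show False by blast
  qed
  \<comment> \<open>Polynomials in x that belong to the ideal K locally at p c. Up to the unit w the
    derivation D preserves K, so the derivative of P qualifies with P. This contradicts least degree
    unless P is constant, and a nonzero constant is excluded since K vanishes at p c.\<close>
  define T where "T = {P. P \<noteq> 0 \<and> (\<exists>u. ev c u \<noteq> 0 \<and> u * [:P:] \<in> K)}"
  obtain P0 where "R = [:P0:]" using degR degree0_coeffs by blast
  moreover have "1 * R \<in> K" "ev c 1 \<noteq> 0" using R(2) by (auto simp: K_def ev_def)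
  ultimately have "P0 \<in> T" using R(1) unfolding T_def by force
  then obtain P where P: "P \<in> T" and minP: "\<And>P'. P' \<in> T \<Longrightarrow> degree P \<le> degree P'"
    using ex_has_least_nat[of "\<lambda>R. R \<in> T" _ degree] by metis
  obtain u where u: "P \<noteq> 0" "ev c u \<noteq> 0" "u * [:P:] \<in> K" using P by (auto simp: T_def)
  define D where "D = (\<lambda>E. pderiv G * pdx E - pdx G * pderiv E)"
  have D_mult: "D (E * E') = E * D E' + E' * D E" for E E'
    by (simp add: D_def pdx_mult pderiv_mult algebra_simps)
  have D_add: "D (E + E') = D E + D E'" for E E' by (simp add: D_def pdx_add pderiv_add algebra_simps)
  have DG: "D G = 0" by (simp add: D_def)
  define e1 e2 where "e1 = [:s1:]" and "e2 = [:s2:]"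
  have e: "e1 * Wx = G * Q1" "e2 * Wy = G * Q2" using s1 s2 by (simp_all add: e1_def e2_def)
  define w where "w = e1 * e2 * h"
  have w: "ev c w \<noteq> 0" using c z(4)[OF cB] by (simp add: w_def ev_def e1_def e2_def)
  have wD: "w * D (F c) \<in> K"
  proof -
    have "w * D (F c) = e1 * e2 * (pderiv G * (h * pdx (F c)) - pdx G * (h * pderiv (F c)))"
      by (simp add: w_def D_def algebra_simps)
    also have "\<dots> = e1 * e2 * (pderiv G * (Wx + F c * pdx h) - pdx G * (Wy + F c * pderiv h))"
      by (simp add: W(1)[of c] W(2)[of c])
    also have "\<dots> = (e1 * e2 * D h) * F c + e2 * pderiv G * (e1 * Wx) - e1 * pdx G * (e2 * Wy)"
      by (simp add: D_def algebra_simps)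
    also have "\<dots> = (e1 * e2 * D h) * F c + (e2 * pderiv G * Q1 - e1 * pdx G * Q2) * G"
      unfolding e by (simp add: algebra_simps)
    finally show ?thesis unfolding K_def by blast
  qed
  have "w * D v \<in> K" if vK: "v \<in> K" for v
  proof -
    obtain a a' where v: "v = a * F c + a' * G" using vK by (auto simp: K_def)
    have "w * D v = (w * D a) * F c + a * (w * D (F c)) + (w * D a') * G"
      unfolding v D_add D_mult DG by (simp add: algebra_simps)
    then show ?thesis using Kadd Kmult KF KG wD by simp
  qed
  then have "w * D (u * [:P:]) \<in> K" using u by blast
  moreover have "(u * w * u * pderiv G) * [:pderiv P:] = u * (w * D (u * [:P:])) + (- (w * D u)) * (u * [:P:])"
  proof -
    have "D [:P:] = pderiv G * [:pderiv P:]" by (simp add: D_def map_poly_pCons pderiv_pCons)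
    then show ?thesis unfolding D_mult by (simp add: algebra_simps)
  qed
  ultimately have "(u * w * u * pderiv G) * [:pderiv P:] \<in> K" using Kadd Kmult u(3) by metis
  moreover have "ev c (u * w * u * pderiv G) \<noteq> 0" using u w c by (simp add: ev)
  moreover have dP: "degree P \<noteq> 0"
  proof
    assume "degree P = 0"
    then obtain k where k: "P = [:k:]" using degree0_coeffs by blast
    have "ev c (u * [:P:]) = 0" using K0 u(3) by blast
    with u(1,2) show False by (simp add: ev_def k)
  qed
  then have "pderiv P \<noteq> 0" by (simp add: pderiv_eq_0_iff)
  ultimately have "pderiv P \<in> T" unfolding T_def by blast
  from minP[OF this] dP show False by (simp add: degree_pderiv)
qed

section \<open>Exact degrees and elimination\<close>

lemma tdeg_le_pred:
  assumes "tdeg_le e u" "top_form e u = 0"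
  shows "tdeg_le (e - 1) u" "e = 0 \<Longrightarrow> u = 0"
proof -
  have lt: "i + j < e" if nz: "coeff (coeff u j) i \<noteq> 0" for i j
  proof -
    have "i + j \<le> e" using assms(1) nz by (auto simp: tdeg_le_def)
    moreover have "i + j \<noteq> e"
    proof
      assume "i + j = e"
      then have "coeff (top_form e u) j = coeff (coeff u j) i" by (auto simp: coeff_top_form)
      with assms(2) nz show False by simp
    qed
    ultimately show ?thesis by simp
  qed
  then show "tdeg_le (e - 1) u" unfolding tdeg_le_def by fastforce
  show "u = 0" if "e = 0"
    by (intro poly_eqI) (use lt that in fastforce)
qed

lemma exact_degree:
  assumes "f \<noteq> 0"
  obtains e where "tdeg_le e f" "top_form e f \<noteq> 0"
proof -
  define e where "e = (LEAST e. tdeg_le e f)"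
  have e: "tdeg_le e f" unfolding e_def using tdeg_le_exists by (rule LeastI_ex)
  have "top_form e f \<noteq> 0"
  proof
    assume 0: "top_form e f = 0"
    then have "e \<noteq> 0" using tdeg_le_pred(2)[OF e] assms by blast
    have "e \<le> e - 1" unfolding e_def[symmetric] by (subst (1) e_def, rule Least_le, rule tdeg_le_pred(1)[OF e 0])
    with \<open>e \<noteq> 0\<close> show False by simp
  qed
  with e that show thesis by blast
qed

lemma exact_degree_unique:
  assumes "tdeg_le e f" "top_form e f \<noteq> 0" "tdeg_le e' f" "top_form e' f \<noteq> 0"
  shows "e = e'"
  using assms top_form_0 by (metis linorder_neqE_nat)

lemma top_form_of_multiple:
  fixes f R Q :: "'a::field poly poly"
  assumes f: "tdeg_le d f" "top_form d f \<noteq> 0" and eq: "smult c f = R * Q" and "c \<noteq> 0"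
    and R: "tdeg_le e R" "top_form e R \<noteq> 0"
  obtains e' where "tdeg_le e' Q" "smult (lead_coeff c) (top_form d f) = top_form e R * top_form e' Q"
proof -
  have "f \<noteq> 0" using f(2) by (auto simp: top_form_def)
  then have "Q \<noteq> 0" using eq \<open>c \<noteq> 0\<close> by auto
  then obtain e' where e': "tdeg_le e' Q" "top_form e' Q \<noteq> 0" using exact_degree by blast
  have 1: "tdeg_le (degree c + d) ([:c:] * f)" by (intro tdeg_le_mult tdeg_le_const f) simp
  have 2: "top_form (degree c + d) ([:c:] * f) = smult (lead_coeff c) (top_form d f)"
    using top_form_mult[OF tdeg_le_const[OF order_refl] f(1), of c] by (simp add: top_form_const)
  have 3: "tdeg_le (e + e') (R * Q)" "top_form (e + e') (R * Q) = top_form e R * top_form e' Q"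
    using tdeg_le_mult[OF R(1) e'(1)] top_form_mult[OF R(1) e'(1)] .
  have eq': "[:c:] * f = R * Q" using eq by simp
  have "degree c + d = e + e'"
    using exact_degree_unique[of "degree c + d" "R * Q" "e + e'"] 1 2 3 eq' f(2) R(2) e'(2) \<open>c \<noteq> 0\<close> by simp
  with 2 3 eq' e' that show thesis by simp
qed

text \<open>Take R in the ideal dividing f and h up to factors in x. Its top form divides both top
  forms up to constants, so it is constant. The cofactor of R in f then already has degree d in y,
  and f has no more, which leaves R without y.\<close>

lemma eliminant:
  fixes f h :: "'k::alg_closed_field poly poly"
  assumes f: "tdeg_le d f" "coeff (top_form d f) d \<noteq> 0" and h: "tdeg_le e0 h" and d: "0 < d"
    and coprime: "\<And>y. poly (top_form d f) y = 0 \<Longrightarrow> poly (top_form e0 h) y \<noteq> 0"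
  shows "\<exists>P A B. P \<noteq> 0 \<and> [:P:] = A * f + B * h"
proof -
  have degf: "degree (top_form d f) = d"
    using f(2) degree_top_form[of d f] by (metis le_antisym le_degree)
  then obtain y0 where "poly (top_form d f) y0 = 0" using d alg_closed_imp_poly_has_root by force
  then have nz: "top_form e0 h \<noteq> 0" "top_form d f \<noteq> 0" using coprime f(2) by force+
  then have "f \<noteq> 0" by (auto simp: top_form_def)
  then obtain R A B where R: "R \<noteq> 0" "R = A * f + B * h"
      "\<And>A B. \<exists>c Q. c \<noteq> 0 \<and> smult c (A * f + B * h) = R * Q"
    using generically_principal[of f h] by metis
  obtain e where e: "tdeg_le e R" "top_form e R \<noteq> 0" using exact_degree R(1) by blast
  obtain c Q where c: "c \<noteq> 0" "smult c f = R * Q" using R(3)[of 1 0] by auto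
  obtain c' Q' where c': "c' \<noteq> 0" "smult c' h = R * Q'" using R(3)[of 0 1] by auto
  obtain e1 where e1: "tdeg_le e1 Q" "smult (lead_coeff c) (top_form d f) = top_form e R * top_form e1 Q"
    using top_form_of_multiple[OF f(1) nz(2) c(2,1) e] by blast
  obtain e2 where e2: "smult (lead_coeff c') (top_form e0 h) = top_form e R * top_form e2 Q'"
    using top_form_of_multiple[OF h nz(1) c'(2,1) e] by blast
  have "degree (top_form e R) = 0"
  proof (rule ccontr)
    assume "degree (top_form e R) \<noteq> 0"
    then obtain y where y: "poly (top_form e R) y = 0" using alg_closed_imp_poly_has_root by blast
    have "lead_coeff c * poly (top_form d f) y = 0" "lead_coeff c' * poly (top_form e0 h) y = 0"
      using arg_cong[OF e1(2), of "\<lambda>p. poly p y"] arg_cong[OF e2, of "\<lambda>p. poly p y"] y by simp_all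
    then show False using c(1) c'(1) coprime by simp
  qed
  moreover have "degree (smult (lead_coeff c) (top_form d f)) = d" using c(1) degf by simp
  moreover have "top_form e1 Q \<noteq> 0" using e1(2) nz c(1) by auto
  ultimately have "degree (top_form e1 Q) = d" using e1(2) e(2) by (simp add: degree_mult_eq)
  moreover have "degree (top_form e1 Q) \<le> degree Q"
    by (rule degree_le) (auto simp: coeff_top_form coeff_eq_0)
  moreover have "degree R + degree Q \<le> d"
  proof -
    have "degree f \<le> d" using f(1) by (intro degree_le allI impI poly_eqI) (auto intro: tdeg_leD)
    moreover have "Q \<noteq> 0" using c \<open>f \<noteq> 0\<close> by auto
    then have "degree f = degree R + degree Q"
      using c R(1) degree_mult_eq[of R Q] degree_smult_eq[of c f] by simp
    ultimately show ?thesis by simp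
  qed
  ultimately have "degree R = 0" by simp
  then obtain P where P: "R = [:P:]" using degree0_coeffs by blast
  then show ?thesis using R(1,2) by (metis pCons_eq_0_iff)
qed

lemma slice_nonzero:
  assumes f: "tdeg_le d f" "coeff (top_form d f) d \<noteq> 0"
  shows "slice a f \<noteq> 0"
proof
  assume "slice a f = 0"
  then have "poly (coeff f d) a = 0" by (metis coeff_0 coeff_slice)
  moreover have "coeff f d = [:coeff (coeff f d) 0:]"
    using f(1) by (intro poly_eqI) (auto simp: coeff_pCons intro: tdeg_leD split: nat.split)
  ultimately have "coeff (coeff f d) 0 = 0" by (metis poly_const_conv)
  with f(2) show False by (simp add: coeff_top_form)
qed

lemma finite_common_zeros:
  fixes f h :: "'k::alg_closed_field poly poly"
  assumes f: "tdeg_le d f" "coeff (top_form d f) d \<noteq> 0" and h: "tdeg_le e0 h" and d: "0 < d"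
    and coprime: "\<And>y. poly (top_form d f) y = 0 \<Longrightarrow> poly (top_form e0 h) y \<noteq> 0"
  shows "finite {(a, b). eval2 f a b = 0 \<and> eval2 h a b = 0}"
proof -
  obtain P A B where P: "P \<noteq> 0" "[:P:] = A * f + B * h" using eliminant[OF assms] by blast
  have "{(a, b). eval2 f a b = 0 \<and> eval2 h a b = 0} \<subseteq> (SIGMA a:{a. poly P a = 0}. {b. poly (slice a f) b = 0})"
  proof clarify
    fix a b assume 0: "eval2 f a b = 0" "eval2 h a b = 0"
    have "eval2 [:P:] a b = 0" unfolding P(2) using 0 by simp
    then show "a \<in> {a. poly P a = 0} \<and> b \<in> {b. poly (slice a f) b = 0}" using 0 by (simp add: poly_slice)
  qed
  moreover have "finite (SIGMA a:{a. poly P a = 0}. {b. poly (slice a f) b = 0})"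
    using slice_nonzero[OF f] P(1) by (intro finite_SigmaI poly_roots_finite)
  ultimately show ?thesis by (rule finite_subset)
qed

lemma finite_linear_zeros: "a \<noteq> 0 \<Longrightarrow> finite {c. a + c * b = 0}" for a b :: "'a::field"
proof -
  assume "a \<noteq> 0"
  then have "[:a, b:] \<noteq> 0" by simp
  from poly_roots_finite[OF this] show ?thesis by (simp add: mult.commute)
qed

definition plane_linear :: "('a::field poly poly \<Rightarrow> 'a) \<Rightarrow> bool" where
  "plane_linear \<phi> \<longleftrightarrow> (\<forall>f h. \<phi> (f + h) = \<phi> f + \<phi> h) \<and> (\<forall>c f. \<phi> (smult [:c:] f) = c * \<phi> f)"

section \<open>A Bertini theorem for the linear system\<close>

context scheme
begin

lemma \<Lambda>_add: "f \<in> \<Lambda> \<Longrightarrow> h \<in> \<Lambda> \<Longrightarrow> f + h \<in> \<Lambda>"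
  and \<Lambda>_smult: "f \<in> \<Lambda> \<Longrightarrow> smult [:c:] f \<in> \<Lambda>"
  by (auto simp: \<Lambda>_def intro: tdeg_le_add tdeg_le_smult inI_add inI_smult)

lemma generic_member:
  assumes "finite \<Phi>" "\<And>\<phi>. \<phi> \<in> \<Phi> \<Longrightarrow> plane_linear \<phi> \<and> (\<exists>f\<in>\<Lambda>. \<phi> f \<noteq> 0)"
  shows "\<exists>f\<in>\<Lambda>. \<forall>\<phi>\<in>\<Phi>. \<phi> f \<noteq> 0"
  using assms
proof (induction \<Phi> rule: finite_induct)
  case empty
  have "0 \<in> \<Lambda>" using inI_0 by (simp add: \<Lambda>_def)
  then show ?case by blast
next
  case (insert \<phi> \<Phi>)
  then obtain f where f: "f \<in> \<Lambda>" "\<forall>\<phi>\<in>\<Phi>. \<phi> f \<noteq> 0" by blast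
  obtain h where h: "h \<in> \<Lambda>" "\<phi> h \<noteq> 0" using insert.prems by blast
  have lin: "\<phi>' (f + smult [:c:] h) = \<phi>' f + c * \<phi>' h" if "\<phi>' \<in> insert \<phi> \<Phi>" for \<phi>' c
    using insert.prems[OF that] by (simp add: plane_linear_def)
  have "finite {c. \<phi>' (f + smult [:c:] h) = 0}" if "\<phi>' \<in> \<Phi>" for \<phi>'
    using finite_linear_zeros[of "\<phi>' f" "\<phi>' h"] f(2) that by (simp add: lin)
  moreover have "{c. \<phi> (f + smult [:c:] h) = 0} = {- \<phi> f / \<phi> h}"
    using h(2) by (auto simp: lin field_simps add_eq_0_iff)
  ultimately have "finite (\<Union>\<phi>'\<in>insert \<phi> \<Phi>. {c. \<phi>' (f + smult [:c:] h) = 0})" using insert.hyps by auto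
  then obtain c where "c \<notin> (\<Union>\<phi>'\<in>insert \<phi> \<Phi>. {c. \<phi>' (f + smult [:c:] h) = 0})"
    using ex_new_if_finite infinite_UNIV_char_0 by blast
  then show ?case using f(1) h(1) by (intro bexI[of _ "f + smult [:c:] h"]) (auto intro: \<Lambda>_add \<Lambda>_smult)
qed

definition tangent_form :: "nat \<Rightarrow> 'k poly poly \<Rightarrow> 'k poly" where
  "tangent_form j f = [:cA j f, cB j f, cC j f:]"

definition singular_at :: "'k poly poly \<Rightarrow> 'k \<Rightarrow> 'k \<Rightarrow> bool" where
  "singular_at f a b \<longleftrightarrow> eval2 f a b = 0 \<and> eval2 (pdx f) a b = 0 \<and> eval2 (pderiv f) a b = 0"

text \<open>Double at every point of the scheme, with nonvanishing lowest term at the cusps, and not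
  passing through the vertical point at infinity. The last makes the equation monic in y up to a
  constant, as elimination requires.\<close>

definition regular :: "'k poly poly \<Rightarrow> bool" where
  "regular f \<longleftrightarrow> f \<in> \<Lambda> \<and> coeff (top_form d f) d \<noteq> 0 \<and>
     (\<forall>j<n. cC j f \<noteq> 0 \<and> (m j + 1 = 2 * r j \<longrightarrow> cA j f \<noteq> 0))"

text \<open>Simple roots of the leading form mean that the curve is transversal to the line at
  infinity; simple roots of a tangent form mean that the two branches of the tacnode separate after
  r j blow-ups.\<close>

definition nodal :: "'k poly poly \<Rightarrow> bool" where
  "nodal f \<longleftrightarrow> regular f \<and>
     (\<forall>y. poly (top_form d f) y = 0 \<longrightarrow> poly (pderiv (top_form d f)) y \<noteq> 0) \<and>
     (\<forall>j<n. m j = 2 * r j \<longrightarrow> (\<forall>v. poly (tangent_form j f) v = 0 \<longrightarrow> poly (pderiv (tangent_form j f)) v \<noteq> 0))"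

lemma exists_regular: "\<exists>f. regular f"
proof -
  let ?\<Phi> = "{\<lambda>f. coeff (top_form d f) d} \<union> (\<lambda>j. cC j) ` {..<n} \<union> (\<lambda>j. cA j) ` {j. j < n \<and> m j + 1 = 2 * r j}"
  have "\<exists>f\<in>\<Lambda>. \<forall>\<phi>\<in>?\<Phi>. \<phi> f \<noteq> 0"
  proof (rule generic_member)
    show "plane_linear \<phi> \<and> (\<exists>f\<in>\<Lambda>. \<phi> f \<noteq> 0)" if "\<phi> \<in> ?\<Phi>" for \<phi>
      using that top_nonzero_vertical second_derivative_coefficient cusp_coefficient
      by (auto simp: plane_linear_def top_form_add top_form_smult cABC_add cABC_smult)
  qed simp
  then show ?thesis unfolding regular_def by fastforce
qed

lemma tangent_form_add: "tangent_form j (f + h) = tangent_form j f + tangent_form j h"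
  and tangent_form_smult: "tangent_form j (smult [:c:] f) = smult c (tangent_form j f)"
  by (simp_all add: tangent_form_def cABC_add cABC_smult)

text \<open>H is taken nonzero at the roots of the leading form and of the tangent forms of F, and
  on T. No common point at infinity makes the affine base points finite in number, and each kind of
  degeneration then excludes finitely many values of c.\<close>

lemma pencil_step:
  assumes F: "regular F" and T: "finite T" "\<And>a b j. (a, b) \<in> T \<Longrightarrow> j < n \<Longrightarrow> \<not> (a = x j \<and> b = poly \<psi> (x j))"
  obtains H where "H \<in> \<Lambda>" "finite {(a, b). eval2 F a b = 0 \<and> eval2 H a b = 0}"
    "\<And>a b. (a, b) \<in> T \<Longrightarrow> eval2 H a b \<noteq> 0"
    "finite {c. \<not> nodal (F + smult [:c:] H)}"
    "finite {c. \<exists>a b. singular_at (F + smult [:c:] H) a b \<and> eval2 H a b \<noteq> 0}"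
proof -
  define Phi where "Phi = (\<lambda>y f. poly (top_form d f) y) ` {y. poly (top_form d F) y = 0}
    \<union> (\<Union>j\<in>{j. j < n \<and> m j = 2 * r j}. (\<lambda>v f. poly (tangent_form j f) v) ` {v. poly (tangent_form j F) v = 0})
    \<union> (\<lambda>(a, b) f. eval2 f a b) ` T"
  have F': "F \<in> \<Lambda>" "coeff (top_form d F) d \<noteq> 0" "\<And>j. j < n \<Longrightarrow> cC j F \<noteq> 0"
    "\<And>j. j < n \<Longrightarrow> m j + 1 = 2 * r j \<Longrightarrow> cA j F \<noteq> 0" using F by (auto simp: regular_def)
  have topnz: "top_form d F \<noteq> 0" using F'(2) by auto
  have tannz: "tangent_form j F \<noteq> 0" if "j < n" for j using F'(3)[OF that] by (simp add: tangent_form_def)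
  have "\<exists>H\<in>\<Lambda>. \<forall>\<phi>\<in>Phi. \<phi> H \<noteq> 0"
  proof (rule generic_member)
    show "finite Phi" unfolding Phi_def using T(1) poly_roots_finite[OF topnz] poly_roots_finite[OF tannz] by auto
    fix \<phi> assume "\<phi> \<in> Phi"
    then consider y where "\<phi> = (\<lambda>f. poly (top_form d f) y)"
      | j v where "j < n" "m j = 2 * r j" "\<phi> = (\<lambda>f. poly (tangent_form j f) v)"
      | a b where "(a, b) \<in> T" "\<phi> = (\<lambda>f. eval2 f a b)"
      unfolding Phi_def by auto
    then show "plane_linear \<phi> \<and> (\<exists>f\<in>\<Lambda>. \<phi> f \<noteq> 0)"
    proof cases
      case 1 with top_nonzero_slope show ?thesis by (auto simp: plane_linear_def top_form_add top_form_smult)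
    next
      case 2
      have "poly (tangent_form j f) v = cA j f + cB j f * v + cC j f * v\<^sup>2" for f
        by (simp add: tangent_form_def power2_eq_square algebra_simps)
      then have "\<exists>f\<in>\<Lambda>. poly (tangent_form j f) v \<noteq> 0" using tangent_coefficient[OF 2(1,2), of v] by simp
      then show ?thesis unfolding 2(3) plane_linear_def tangent_form_add tangent_form_smult by simp
    next
      case 3
      with T(2) base_point_free[of a b] show ?thesis by (auto simp: plane_linear_def)
    qed
  qed
  then obtain H where H: "H \<in> \<Lambda>" "\<And>\<phi>. \<phi> \<in> Phi \<Longrightarrow> \<phi> H \<noteq> 0" by blast
  have H1: "poly (top_form d H) y \<noteq> 0" if "poly (top_form d F) y = 0" for y
    using that by (intro H(2)[of "\<lambda>f. poly (top_form d f) y"]) (simp add: Phi_def)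
  have H2: "poly (tangent_form j H) v \<noteq> 0" if "j < n" "m j = 2 * r j" "poly (tangent_form j F) v = 0" for j v
    using that by (intro H(2)[of "\<lambda>f. poly (tangent_form j f) v"]) (auto simp: Phi_def)
  have H3: "eval2 H a b \<noteq> 0" if "(a, b) \<in> T" for a b
    using that by (intro H(2)[of "\<lambda>f. eval2 f a b"]) (force simp: Phi_def)
  have td: "tdeg_le d F" "tdeg_le d H" using F' H by (auto simp: \<Lambda>_def)
  have V: "finite {(a, b). eval2 F a b = 0 \<and> eval2 H a b = 0}"
    using td F'(2) H1 d6 by (intro finite_common_zeros) auto
  have degtop: "0 < degree (top_form d F)" using F'(2) d6 le_degree by fastforce
  have degtan: "0 < degree (tangent_form j F)" if "j < n" for j
    using F'(3)[OF that] by (simp add: tangent_form_def)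
  have const: "\<exists>c. coeff f d = [:c:] \<and> c = coeff (coeff f d) 0" if "tdeg_le d f" for f :: "'k poly poly"
    using that by (intro exI conjI poly_eqI) (auto simp: coeff_pCons intro: tdeg_leD split: nat.split)
  have S: "finite {c. \<exists>a b. singular_at (F + smult [:c:] H) a b \<and> eval2 H a b \<noteq> 0}"
  proof -
    obtain c0 where c0: "coeff F d = [:c0:]" "c0 = coeff (coeff F d) 0" using const[OF td(1)] by blast
    obtain c1 where c1: "coeff H d = [:c1:]" using const[OF td(2)] by blast
    have "c0 \<noteq> 0" using c0(2) F'(2) by (simp add: coeff_top_form)
    from pencil_singular_points[OF c0(1) this c1] show ?thesis by (simp add: singular_at_def conj_assoc)
  qed
  define bad1 where "bad1 = {c. coeff (top_form d F) d + c * coeff (top_form d H) d = 0}"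
  define bad2 where "bad2 = (\<Union>j<n. {c. cC j F + c * cC j H = 0})"
  define bad3 where "bad3 = (\<Union>j\<in>{j. j < n \<and> m j + 1 = 2 * r j}. {c. cA j F + c * cA j H = 0})"
  define bad4 where "bad4 = {c. \<exists>y. poly (top_form d F + smult c (top_form d H)) y = 0
    \<and> poly (pderiv (top_form d F + smult c (top_form d H))) y = 0}"
  define bad5 where "bad5 = (\<Union>j\<in>{j. j < n \<and> m j = 2 * r j}. {c. \<exists>y. poly (tangent_form j F + smult c (tangent_form j H)) y = 0
    \<and> poly (pderiv (tangent_form j F + smult c (tangent_form j H))) y = 0})"
  have "finite bad1" "finite bad2" "finite bad3"
    unfolding bad1_def bad2_def bad3_def using F' by (auto intro!: finite_linear_zeros)
  moreover have "finite bad4" unfolding bad4_def by (rule pencil_double_roots[OF degtop H1])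
  moreover have "finite bad5" unfolding bad5_def
  proof (rule finite_UN_I)
    show "finite {c. \<exists>y. poly (tangent_form j F + smult c (tangent_form j H)) y = 0
      \<and> poly (pderiv (tangent_form j F + smult c (tangent_form j H))) y = 0}"
      if "j \<in> {j. j < n \<and> m j = 2 * r j}" for j
      using that by (intro pencil_double_roots degtan H2) simp_all
  qed simp
  ultimately have "finite (bad1 \<union> bad2 \<union> bad3 \<union> bad4 \<union> bad5)" by simp
  moreover have "{c. \<not> nodal (F + smult [:c:] H)} \<subseteq> bad1 \<union> bad2 \<union> bad3 \<union> bad4 \<union> bad5"
  proof
    fix c assume "c \<in> {c. \<not> nodal (F + smult [:c:] H)}"
    moreover have "F + smult [:c:] H \<in> \<Lambda>" using F' H by (intro \<Lambda>_add \<Lambda>_smult)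
    ultimately show "c \<in> bad1 \<union> bad2 \<union> bad3 \<union> bad4 \<union> bad5"
      unfolding nodal_def regular_def bad1_def bad2_def bad3_def bad4_def bad5_def top_form_add top_form_smult
        tangent_form_add tangent_form_smult cABC_add cABC_smult by auto
  qed
  ultimately have "finite {c. \<not> nodal (F + smult [:c:] H)}" using finite_subset by blast
  then show thesis using that H(1) V H3 S by blast
qed

text \<open>Two pencils. A general member F' of the first is singular at most in its finitely many
  base points. The second avoids those outside the scheme, so F' is smooth at its own base points
  outside the scheme, and each of these is singular on at most one further member.\<close>

lemma exists_nodal_curve:
  "\<exists>f. nodal f \<and> (\<forall>a b. singular_at f a b \<longrightarrow> (\<exists>j<n. a = x j \<and> b = poly \<psi> (x j)))"
proof -
  have avoid: "\<exists>c. c \<notin> A" if "finite A" for A :: "'k set"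
    using that ex_new_if_finite infinite_UNIV_char_0 by blast
  obtain F where F: "regular F" using exists_regular by blast
  define Z where "Z = {(x j, poly \<psi> (x j)) | j. j < n}"
  obtain H where H: "H \<in> \<Lambda>" "finite {(a, b). eval2 F a b = 0 \<and> eval2 H a b = 0}"
    "finite {c. \<not> nodal (F + smult [:c:] H)}"
    "finite {c. \<exists>a b. singular_at (F + smult [:c:] H) a b \<and> eval2 H a b \<noteq> 0}"
    by (rule pencil_step[OF F, of "{}"]) auto
  obtain c where c: "c \<notin> {c. \<not> nodal (F + smult [:c:] H)} \<union> {c. \<exists>a b. singular_at (F + smult [:c:] H) a b \<and> eval2 H a b \<noteq> 0}"
    by (rule exE[OF avoid[OF finite_UnI[OF H(3,4)]]])
  define F' where "F' = F + smult [:c:] H"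
  have F': "nodal F'" "\<And>a b. singular_at F' a b \<Longrightarrow> eval2 H a b = 0" using c by (auto simp: F'_def)
  have sing: "(a, b) \<in> {(a, b). eval2 F a b = 0 \<and> eval2 H a b = 0}" if "singular_at F' a b" for a b
    using F'(2)[OF that] that by (simp add: singular_at_def F'_def)
  \<comment> \<open>The possible unwanted singular points of F'; H' is made nonzero there.\<close>
  define T where "T = {(a, b). eval2 F a b = 0 \<and> eval2 H a b = 0} - Z"
  have "regular F'" using F'(1) by (simp add: nodal_def)
  moreover have "finite T" using H(2) by (simp add: T_def)
  moreover have "\<not> (a = x j \<and> b = poly \<psi> (x j))" if "(a, b) \<in> T" "j < n" for a b j
    using that by (auto simp: T_def Z_def)
  ultimately obtain H' where H': "H' \<in> \<Lambda>" "finite {(a, b). eval2 F' a b = 0 \<and> eval2 H' a b = 0}"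
    "\<And>a b. (a, b) \<in> T \<Longrightarrow> eval2 H' a b \<noteq> 0"
    "finite {c. \<not> nodal (F' + smult [:c:] H')}"
    "finite {c. \<exists>a b. singular_at (F' + smult [:c:] H') a b \<and> eval2 H' a b \<noteq> 0}"
    by (rule pencil_step) auto
  define V where "V = {(a, b). eval2 F' a b = 0 \<and> eval2 H' a b = 0} - Z"
  have V: "\<not> singular_at F' a b" if "(a, b) \<in> V" for a b
  proof
    assume "singular_at F' a b"
    then have "(a, b) \<in> T" using sing that by (auto simp: T_def V_def)
    with H'(3) that show False by (auto simp: V_def)
  qed
  define bad where "bad = (\<Union>(a, b)\<in>V. {c. singular_at (F' + smult [:c:] H') a b})"
  have "finite {c. singular_at (F' + smult [:c:] H') a b}" if ab: "(a, b) \<in> V" for a b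
  proof -
    have "eval2 F' a b = 0" using ab by (auto simp: V_def)
    then have "eval2 (pdx F') a b \<noteq> 0 \<or> eval2 (pderiv F') a b \<noteq> 0"
      using V[OF ab] by (auto simp: singular_at_def)
    moreover have "{c. singular_at (F' + smult [:c:] H') a b} \<subseteq> {c. eval2 (pdx F') a b + c * eval2 (pdx H') a b = 0}"
      "{c. singular_at (F' + smult [:c:] H') a b} \<subseteq> {c. eval2 (pderiv F') a b + c * eval2 (pderiv H') a b = 0}"
      by (auto simp: singular_at_def pdx_add pdx_smult pderiv_add pderiv_smult pderiv_pCons)
    ultimately show ?thesis using finite_linear_zeros finite_subset by metis
  qed
  then have "finite bad" unfolding bad_def using H'(2) by (intro finite_UN_I) (auto simp: V_def)
  then obtain c' where c': "c' \<notin> bad \<union> {c. \<not> nodal (F' + smult [:c:] H')}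
      \<union> {c. \<exists>a b. singular_at (F' + smult [:c:] H') a b \<and> eval2 H' a b \<noteq> 0}"
    by (rule exE[OF avoid[OF finite_UnI[OF finite_UnI[OF _ H'(4)] H'(5)]]])
  have "\<exists>j<n. a = x j \<and> b = poly \<psi> (x j)" if s: "singular_at (F' + smult [:c':] H') a b" for a b
  proof -
    have "eval2 H' a b = 0" using c' s by blast
    moreover from this have "eval2 F' a b = 0" using s by (simp add: singular_at_def)
    ultimately have "(a, b) \<in> V \<or> (a, b) \<in> Z" by (simp add: V_def)
    moreover have "(a, b) \<notin> V" using c' s by (auto simp: bad_def)
    ultimately show ?thesis by (auto simp: Z_def)
  qed
  moreover have "nodal (F' + smult [:c':] H')" using c' by blast
  ultimately show ?thesis by blast
qed

end

section \<open>Irreducibility\<close>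

lemma slice_map_const: "slice a (map_poly (\<lambda>c. [:c:]) q) = q"
  by (rule poly_eqI) (simp add: coeff_slice coeff_map_poly)

lemma slice_decomp: "\<exists>s'. s = map_poly (\<lambda>c. [:c:]) (slice a s) + [:[:- a, 1:]:] * s'"
proof (induction s)
  case 0
  then show ?case by (intro exI[of _ 0]) (simp add: slice_def)
next
  case (pCons c s)
  then obtain s' where s': "s = map_poly (\<lambda>c. [:c:]) (slice a s) + [:[:- a, 1:]:] * s'" by blast
  have c: "c = [:poly c a:] + [:- a, 1:] * synthetic_div c a"
    using synthetic_div_correct'[of a c] by (simp add: add.commute)
  have "pCons c s = map_poly (\<lambda>c. [:c:]) (slice a (pCons c s)) + smult [:- a, 1:] (pCons (synthetic_div c a) s')"
  proof (rule poly_eqI)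
    fix i
    show "coeff (pCons c s) i = coeff (map_poly (\<lambda>c. [:c:]) (slice a (pCons c s)) + smult [:- a, 1:] (pCons (synthetic_div c a) s')) i"
    proof (cases i)
      case 0 with c show ?thesis by (simp add: coeff_map_poly coeff_slice)
    next
      case (Suc k)
      have "coeff s k = coeff (map_poly (\<lambda>c. [:c:]) (slice a s) + [:[:- a, 1:]:] * s') k" using s' by simp
      with Suc show ?thesis by (simp add: coeff_map_poly coeff_slice)
    qed
  qed
  then show ?case by (intro exI[of _ "pCons (synthetic_div c a) s'"]) simp
qed

text \<open>A Nullstellensatz in two steps. Let P(x) in I have least degree and P = (x - a) P1. The
  quotient I' of I by P1 contains I and x - a but not 1, so restricted to x = a it is a proper
  nonzero ideal of k[y]; its generator has a root b.\<close>

lemma exists_common_zero: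
  fixes I :: "'k::alg_closed_field poly poly set"
  assumes add: "\<And>u v. u \<in> I \<Longrightarrow> v \<in> I \<Longrightarrow> u + v \<in> I" and mult: "\<And>u v. v \<in> I \<Longrightarrow> u * v \<in> I"
    and P: "[:P:] \<in> I" "P \<noteq> 0" and h: "h \<in> I" "\<And>a. slice a h \<noteq> 0" and "1 \<notin> I"
  shows "\<exists>a b. \<forall>s\<in>I. eval2 s a b = 0"
proof -
  have unit: False if "[:[:c:]:] * s \<in> I" "c \<noteq> 0" "s \<notin> I" for c s
  proof -
    have "[:[:1 / c:]:] * ([:[:c:]:] * s) \<in> I" using that(1) by (rule mult)
    moreover have "[:[:1 / c:]:] * ([:[:c:]:] * s) = s"
      unfolding mult.assoc[symmetric] using \<open>c \<noteq> 0\<close> by (simp add: one_pCons[symmetric])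
    ultimately show False using \<open>s \<notin> I\<close> by simp
  qed
  define T where "T = {P. P \<noteq> 0 \<and> [:P:] \<in> I}"
  have "P \<in> T" using P by (simp add: T_def)
  then obtain P where P: "P \<in> T" and minP: "\<And>P'. P' \<in> T \<Longrightarrow> degree P \<le> degree P'"
    using ex_has_least_nat[of "\<lambda>R. R \<in> T" _ degree] by metis
  have "degree P \<noteq> 0"
  proof
    assume "degree P = 0"
    then obtain c where c: "P = [:c:]" using degree0_coeffs by blast
    with P unit[of c 1] \<open>1 \<notin> I\<close> show False by (simp add: T_def)
  qed
  then obtain a where "poly P a = 0" using alg_closed_imp_poly_has_root by blast
  then obtain P1 where P1: "P = [:- a, 1:] * P1" by (metis dvdE poly_eq_0_iff_dvd)
  have "P1 \<noteq> 0" using P P1 by (auto simp: T_def)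
  then have "degree P = Suc (degree P1)" unfolding P1 by (subst degree_mult_eq) auto
  then have P1I: "[:P1:] \<notin> I" using minP[of P1] \<open>P1 \<noteq> 0\<close> by (auto simp: T_def)
  define I' where "I' = {s. s * [:P1:] \<in> I}"
  have I_sub: "I \<subseteq> I'"
  proof
    fix s assume "s \<in> I"
    then have "[:P1:] * s \<in> I" by (rule mult)
    then show "s \<in> I'" by (simp only: I'_def mem_Collect_eq mult.commute[of s])
  qed
  have I'_mult: "u * v \<in> I'" if "v \<in> I'" for u v
    using mult[of "v * [:P1:]" u] that by (simp only: I'_def mem_Collect_eq mult.assoc)
  have I'_add: "u + v \<in> I'" if "u \<in> I'" "v \<in> I'" for u v
    using add[of "u * [:P1:]" "v * [:P1:]"] that by (simp only: I'_def mem_Collect_eq distrib_right)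
  have I'_diff: "u - v \<in> I'" if "u \<in> I'" "v \<in> I'" for u v
    using I'_add[of u "(- 1) * v"] I'_mult[of v "- 1"] that by simp
  have xa: "[:[:- a, 1:]:] \<in> I'" using P P1 by (simp add: I'_def T_def)
  define S where "S = {s \<in> I'. slice a s \<noteq> 0}"
  have "h \<in> S" using h I_sub by (auto simp: S_def)
  then obtain s0 where s0: "s0 \<in> S" and mins: "\<And>s. s \<in> S \<Longrightarrow> degree (slice a s0) \<le> degree (slice a s)"
    using ex_has_least_nat[of "\<lambda>R. R \<in> S" _ "\<lambda>s. degree (slice a s)"] by metis
  have "degree (slice a s0) \<noteq> 0"
  proof
    assume "degree (slice a s0) = 0"
    then obtain c where c: "slice a s0 = [:c:]" using degree0_coeffs by blast
    obtain s' where s': "s0 = map_poly (\<lambda>c. [:c:]) (slice a s0) + [:[:- a, 1:]:] * s'" using slice_decomp by blast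
    then have "[:[:c:]:] = s0 - s' * [:[:- a, 1:]:]" by (simp add: c map_poly_pCons mult.commute)
    also have "\<dots> \<in> I'" using s0 by (intro I'_diff I'_mult xa) (simp add: S_def)
    finally have "[:[:c:]:] \<in> I'" .
    moreover have "c \<noteq> 0" using c s0 by (auto simp: S_def)
    ultimately show False using unit[of c "[:P1:]"] P1I by (simp add: I'_def)
  qed
  then obtain b where b: "poly (slice a s0) b = 0" using alg_closed_imp_poly_has_root by blast
  have "eval2 s a b = 0" if s: "s \<in> I" for s
  proof -
    define q where "q = slice a s div slice a s0"
    define s' where "s' = s - map_poly (\<lambda>c. [:c:]) q * s0"
    have s': "slice a s' = slice a s mod slice a s0"
      by (simp add: s'_def q_def slice_diff slice_mult slice_map_const minus_div_mult_eq_mod)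
    have "s' \<in> I'" unfolding s'_def using s s0 I_sub by (intro I'_diff I'_mult) (auto simp: S_def)
    have "slice a s' = 0"
    proof (rule ccontr)
      assume nz: "slice a s' \<noteq> 0"
      then have "degree (slice a s0) \<le> degree (slice a s')" using mins \<open>s' \<in> I'\<close> by (simp add: S_def)
      moreover have "degree (slice a s') < degree (slice a s0)"
        using degree_mod_less[of "slice a s0" "slice a s"] s0 nz unfolding s' by (auto simp: S_def)
      ultimately show False by simp
    qed
    then have "slice a s0 dvd slice a s" using s' by (simp add: mod_eq_0_iff_dvd)
    then show ?thesis using b by (metis dvdE mult_zero_left poly_mult poly_slice)
  qed
  then show ?thesis by blast
qed

text \<open>The inverse of \<open>top_form\<close>: a binary form recovered from its values at x =
  1.\<close>

definition form :: "nat \<Rightarrow> 'a::field poly \<Rightarrow> 'a poly poly" where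
  "form e U = (\<Sum>j\<le>e. monom (monom (coeff U j) (e - j)) j)"

lemma tdeg_le_form: "tdeg_le e (form e U)"
  unfolding form_def by (intro tdeg_le_sum tdeg_le_monom) simp

lemma coeff_form: "coeff (form e U) j = (if j \<le> e then monom (coeff U j) (e - j) else 0)"
proof -
  have "coeff (form e U) j = (\<Sum>i\<le>e. if i = j then monom (coeff U i) (e - i) else 0)"
    unfolding form_def coeff_sum coeff_monom by simp
  also have "\<dots> = (if j \<le> e then monom (coeff U j) (e - j) else 0)" by simp
  finally show ?thesis .
qed

lemma top_form_form:
  assumes "degree U \<le> e"
  shows "top_form e (form e U) = U"
  using assms by (intro poly_eqI) (auto simp: coeff_top_form coeff_form coeff_eq_0)

lemma top_form_diff: "top_form e (f - h) = top_form e f - top_form e h"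
  by (rule poly_eqI) (simp add: coeff_top_form)

lemma dvd_of_coprime_relation:
  fixes A B U V :: "'a::comm_ring_1"
  assumes "\<alpha> * A + \<beta> * B = 1" "U * A + V * B = 0"
  shows "B dvd U"
proof -
  have "U = U * (\<alpha> * A + \<beta> * B)" by (simp add: assms(1))
  also have "\<dots> = \<alpha> * (U * A) + U * \<beta> * B" by (simp add: algebra_simps)
  also have "U * A = - (V * B)" using assms(2) by (simp add: add_eq_0_iff2)
  also have "\<alpha> * (- (V * B)) + U * \<beta> * B = B * (U * \<beta> - \<alpha> * V)" by (simp add: algebra_simps)
  finally show ?thesis by (rule dvdI)
qed

text \<open>Syzygies of the coprime top forms are used to lower the degrees of the multipliers.\<close>

lemma reduce_multipliers:
  fixes a b :: "'k::field poly poly"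
  assumes a: "tdeg_le p a" "degree (top_form p a) = p" and b: "tdeg_le q b" "degree (top_form q b) = q"
    and pq: "0 < p" "0 < q" and bez: "\<alpha> * top_form p a + \<beta> * top_form q b = 1"
    and F: "F = u * a + v * b" "tdeg_le (p + q - 2) F" "tdeg_le (q - 1 + k) u" "tdeg_le (p - 1 + k) v"
  shows "\<exists>u v. F = u * a + v * b \<and> tdeg_le (q - 1) u \<and> top_form (q - 1) u = 0 \<and> tdeg_le (p - 1) v \<and> top_form (p - 1) v = 0"
  using F(1,3,4)
proof (induction k arbitrary: u v)
  case (0 u v)
  let ?U = "top_form (q - 1) u" and ?V = "top_form (p - 1) v"
  have "top_form (p + q - 1) F = 0" using pq by (intro top_form_0[OF F(2)]) simp
  moreover have "top_form (p + q - 1) (u * a) = ?U * top_form p a"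
    using top_form_mult[of "q - 1" u p a] 0 a pq by (simp add: algebra_simps)
  moreover have "top_form (p + q - 1) (v * b) = ?V * top_form q b"
    using top_form_mult[of "p - 1" v q b] 0 b pq by (simp add: algebra_simps)
  ultimately have rel: "?U * top_form p a + ?V * top_form q b = 0" using 0(1) by (simp add: top_form_add)
  have bnz: "top_form q b \<noteq> 0" using b pq by auto
  have "?U = 0"
  proof (rule ccontr)
    assume "?U \<noteq> 0"
    then have "q \<le> degree ?U" using dvd_imp_degree_le[OF dvd_of_coprime_relation[OF bez rel]] b by simp
    with degree_top_form[of "q - 1" u] pq show False by linarith
  qed
  moreover from this have "?V = 0" using rel bnz by simp
  ultimately show ?case using 0 by auto
next
  case (Suc k u v)
  let ?U = "top_form (q + k) u" and ?V = "top_form (p + k) v"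
  have e: "q - 1 + Suc k = q + k" "p - 1 + Suc k = p + k" using pq by auto
  have uv: "tdeg_le (q + k) u" "tdeg_le (p + k) v" using Suc.prems unfolding e by simp_all
  have "top_form (p + q + k) F = 0" using pq by (intro top_form_0[OF F(2)]) simp
  moreover have "top_form (p + q + k) (u * a) = ?U * top_form p a"
    using top_form_mult[OF uv(1) a(1)] by (simp add: algebra_simps)
  moreover have "top_form (p + q + k) (v * b) = ?V * top_form q b"
    using top_form_mult[OF uv(2) b(1)] by (simp add: algebra_simps)
  ultimately have rel: "?U * top_form p a + ?V * top_form q b = 0" using Suc.prems(1) by (simp add: top_form_add)
  obtain U' where U': "?U = top_form q b * U'" using dvd_of_coprime_relation[OF bez rel] by blast
  have bnz: "top_form q b \<noteq> 0" using b pq by auto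
  have "top_form q b * (U' * top_form p a + ?V) = 0" using rel unfolding U' by (simp add: algebra_simps)
  then have V': "?V = - (U' * top_form p a)" using bnz by (simp add: add_eq_0_iff)
  have degU': "degree U' \<le> k"
  proof (cases "U' = 0")
    case False
    then have "degree ?U = q + degree U'" unfolding U' using bnz b by (simp add: degree_mult_eq)
    then show ?thesis using degree_top_form[of "q + k" u] by simp
  qed simp
  define w where "w = form k U'"
  have w: "tdeg_le k w" "top_form k w = U'" using tdeg_le_form top_form_form[OF degU'] by (simp_all add: w_def)
  have wb: "tdeg_le (q + k) (w * b)" "top_form (q + k) (w * b) = U' * top_form q b"
    and wa: "tdeg_le (p + k) (w * a)" "top_form (p + k) (w * a) = U' * top_form p a"
    using tdeg_le_mult[OF w(1) b(1)] tdeg_le_mult[OF w(1) a(1)] top_form_mult[OF w(1) b(1)] top_form_mult[OF w(1) a(1)] w(2)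
    by (simp_all add: add.commute)
  have "tdeg_le (q + k - 1) (u - w * b)"
    by (rule tdeg_le_pred(1)) (use uv wb in \<open>simp_all add: tdeg_le_diff top_form_diff U'\<close>)
  moreover have "tdeg_le (p + k - 1) (v + w * a)"
    by (rule tdeg_le_pred(1)) (use uv wa in \<open>simp_all add: tdeg_le_add top_form_add V'\<close>)
  moreover have "F = (u - w * b) * a + (v + w * a) * b" using Suc.prems(1) by (simp add: algebra_simps)
  moreover have "q + k - 1 = q - 1 + k" "p + k - 1 = p - 1 + k" using pq by simp_all
  ultimately show ?case using Suc.IH by simp
qed

text \<open>For coprime binary forms of degrees p and q, p + q - 2 is the last degree in which their
  ideal is not everything. C satisfies, as forms, x C = lead(B) y^(q-1) A - lead(A) y^(p-1) B, where
  the leading terms cancel. If C itself were U A + V B, then B would divide a nonzero polynomial of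
  degree at most q - 1.\<close>

lemma not_spanned_below:
  fixes a b :: "'k::field poly poly"
  assumes a: "tdeg_le p a" "degree (top_form p a) = p" and b: "tdeg_le q b" "degree (top_form q b) = q"
    and pq: "0 < p" "0 < q" "3 \<le> p + q" and bez: "\<alpha> * top_form p a + \<beta> * top_form q b = 1"
  shows "\<exists>F. \<forall>f u v. tdeg_le (p + q - 3) f \<longrightarrow> F \<noteq> f + (u * a + v * b)"
proof -
  let ?A = "top_form p a" and ?B = "top_form q b"
  define C where "C = monom (lead_coeff ?B) (q - 1) * ?A - monom (lead_coeff ?A) (p - 1) * ?B"
  have anz: "?A \<noteq> 0" and bnz: "?B \<noteq> 0" using a b pq by auto
  have "degree C \<le> p + q - 2"
  proof (rule degree_le, intro allI impI)
    fix i assume i: "p + q - 2 < i"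
    have "degree C \<le> p + q - 1" unfolding C_def
    proof (rule degree_diff_le)
      show "degree (monom (lead_coeff ?B) (q - 1) * ?A) \<le> p + q - 1"
        using degree_mult_le[of "monom (lead_coeff ?B) (q - 1)" ?A] degree_monom_le[of "lead_coeff ?B" "q - 1"] a pq by linarith
      show "degree (monom (lead_coeff ?A) (p - 1) * ?B) \<le> p + q - 1"
        using degree_mult_le[of "monom (lead_coeff ?A) (p - 1)" ?B] degree_monom_le[of "lead_coeff ?A" "p - 1"] b pq by linarith
    qed
    moreover have "coeff C (p + q - 1) = 0"
    proof -
      have "p + q - 1 - (q - 1) = p" "p + q - 1 - (p - 1) = q" "\<not> p + q - 1 < q - 1" "\<not> p + q - 1 < p - 1"
        using pq by auto
      then show ?thesis using a b by (simp only: C_def coeff_diff coeff_monom_mult if_False) (simp add: mult.commute)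
    qed
    ultimately show "coeff C i = 0"
      using i by (cases "i = p + q - 1") (auto intro: coeff_eq_0)
  qed
  note C = tdeg_le_form[of "p + q - 2" C] top_form_form[OF this]
  have False if f: "tdeg_le (p + q - 3) f" and F: "form (p + q - 2) C = f + (u * a + v * b)" for f u v
  proof -
    have f': "tdeg_le (p + q - 2) f" using f by (rule tdeg_le_mono) simp
    have F': "form (p + q - 2) C - f = u * a + v * b" "tdeg_le (p + q - 2) (form (p + q - 2) C - f)"
      using F tdeg_le_diff[OF C(1) f'] by simp_all
    obtain k1 k2 where "tdeg_le k1 u" "tdeg_le k2 v" using tdeg_le_exists by blast
    then have "tdeg_le (q - 1 + (k1 + k2)) u" "tdeg_le (p - 1 + (k1 + k2)) v" by (auto elim: tdeg_le_mono)
    then obtain u v where uv: "form (p + q - 2) C - f = u * a + v * b" "tdeg_le (q - 1) u" "top_form (q - 1) u = 0"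
        "tdeg_le (p - 1) v" "top_form (p - 1) v = 0"
      using reduce_multipliers[OF a b pq(1,2) bez F'] by metis
    \<comment> \<open>After the reduction the multiplier has degree at most q' - 2. For q' = 1 this
      means that it is 0, a case that truncated subtraction would hide.\<close>
    have lower: "\<exists>U. top_form (p' + q' - 2) (w * c) = U * top_form p' c \<and> coeff U (q' - 1) = 0 \<and> degree U \<le> q' - 1"
      if w: "tdeg_le (q' - 1) w" "top_form (q' - 1) w = 0" "tdeg_le p' c" "0 < q'" "0 < p'" for p' q' and w c :: "'k poly poly"
    proof (cases "q' = 1")
      case True
      then have "w = 0" using tdeg_le_pred(2)[OF w(1,2)] by simp
      then show ?thesis by (intro exI[of _ 0]) (simp add: top_form_def)
    next
      case False
      have "q' - 2 + p' = p' + q' - 2" "q' - 1 - 1 = q' - 2" using False w by auto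
      then have "top_form (p' + q' - 2) (w * c) = top_form (q' - 2) w * top_form p' c"
        using top_form_mult[OF tdeg_le_pred(1)[OF w(1,2)] w(3)] by simp
      moreover have "coeff (top_form (q' - 2) w) (q' - 1) = 0" using False w by (simp add: coeff_top_form)
      moreover have "degree (top_form (q' - 2) w) \<le> q' - 1" using degree_top_form[of "q' - 2" w] by simp
      ultimately show ?thesis by blast
    qed
    obtain U where U: "top_form (p + q - 2) (u * a) = U * ?A" "coeff U (q - 1) = 0" "degree U \<le> q - 1"
      using lower[OF uv(2,3) a(1) pq(2,1)] by blast
    obtain V where V: "top_form (p + q - 2) (v * b) = V * ?B"
      using lower[OF uv(4,5) b(1) pq(1,2)] by (auto simp: add.commute)
    have "C = top_form (p + q - 2) (form (p + q - 2) C - f)"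
      using C(2) top_form_0[OF f, of "p + q - 2"] pq by (simp add: top_form_diff)
    also have "\<dots> = U * ?A + V * ?B" by (simp add: uv(1) top_form_add U V)
    finally have "(monom (lead_coeff ?B) (q - 1) - U) * ?A + (- monom (lead_coeff ?A) (p - 1) - V) * ?B = 0"
      by (simp add: C_def algebra_simps)
    from dvd_of_coprime_relation[OF bez this] have dvd: "?B dvd monom (lead_coeff ?B) (q - 1) - U" .
    have "coeff (monom (lead_coeff ?B) (q - 1) - U) (q - 1) \<noteq> 0" using U(2) bnz by simp
    then have "monom (lead_coeff ?B) (q - 1) - U \<noteq> 0" by auto
    from dvd_imp_degree_le[OF dvd this] b have "q \<le> degree (monom (lead_coeff ?B) (q - 1) - U)" by simp
    also have "\<dots> \<le> q - 1" using U(3) by (intro degree_diff_le degree_monom_le)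
    finally show False using pq by simp
  qed
  then show ?thesis by blast
qed

section \<open>Splittings of a nodal member\<close>

context scheme
begin

text \<open>Both factors are smooth and not vertical, as \<open>cC\<close> is nonzero. Let k be
  their common order of contact with the arc. If k < r j, the condition on the derivative makes both
  leading terms nonzero, and the product has order only 2 k < m j. At a cusp order 2 r j would make
  \<open>cA\<close> vanish, so the point is a tacnode. Equality in the last conclusion would give
  its tangent form a double root.\<close>

lemma factors_at_common_zero:
  assumes f: "nodal (a * b)" and j: "j < n"
    and a0: "eval2 a (x j) (poly \<psi> (x j)) = 0" and b0: "eval2 b (x j) (poly \<psi> (x j)) = 0"
  obtains A1 B1 where "poly a \<psi> = X j ^ r j * A1" "poly b \<psi> = X j ^ r j * B1"
    "poly (poly (pderiv a) \<psi>) (x j) * poly B1 (x j) \<noteq> poly (poly (pderiv b) \<psi>) (x j) * poly A1 (x j)"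
proof -
  define A0 B0 ay bY where "A0 = poly a \<psi>" and "B0 = poly b \<psi>"
    and "ay = poly (pderiv a) \<psi>" and "bY = poly (pderiv b) \<psi>"
  have reg: "regular (a * b)" using f by (simp add: nodal_def)
  have inI: "inI (a * b)" using reg by (simp add: regular_def \<Lambda>_def)
  have root: "poly A0 (x j) = 0" "poly B0 (x j) = 0" using a0 b0 by (simp_all add: A0_def B0_def poly_poly_eq_eval2)
  obtain q0 q1 where q: "poly (a * b) \<psi> = X j ^ m j * q0" "poly (pderiv (a * b)) \<psi> = X j ^ r j * q1"
    using inI_at[OF inI j] by metis
  have F0: "A0 * B0 = X j ^ m j * q0" using q(1) by (simp only: A0_def B0_def poly_mult)
  have F1: "ay * B0 + bY * A0 = X j ^ r j * q1"
    using q(2) by (simp only: A0_def B0_def ay_def bY_def poly_mult pderiv_mult poly_add ac_simps)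
  have "cC j (a * b) = poly (ay * bY) (x j)"
  proof -
    have "poly (pderiv (pderiv (a * b))) \<psi> = A0 * poly (pderiv (pderiv b)) \<psi> + B0 * poly (pderiv (pderiv a)) \<psi> + 2 * (ay * bY)"
      by (simp add: pderiv_mult pderiv_add A0_def B0_def ay_def bY_def algebra_simps)
    then show ?thesis using root by (simp add: cC_def)
  qed
  then have ab: "poly ay (x j) \<noteq> 0" "poly bY (x j) \<noteq> 0" using reg j by (auto simp: regular_def)
  have mrj: "0 < r j" "r j < m j" "m j = 2 * r j \<or> m j + 1 = 2 * r j" using mr[OF j] by auto
  define K where "K = {k. k \<le> r j \<and> X j ^ k dvd A0 \<and> X j ^ k dvd B0}"
  have "0 \<in> K" "finite K" by (auto simp: K_def intro: finite_subset[of _ "{..r j}"])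
  define k where "k = Max K"
  have "k \<in> K" using \<open>0 \<in> K\<close> \<open>finite K\<close> unfolding k_def by (intro Max_in) auto
  then obtain A1 B1 where A1: "A0 = X j ^ k * A1" and B1: "B0 = X j ^ k * B1" and k: "k \<le> r j"
    by (auto simp: K_def elim!: dvdE)
  have "k = r j"
  proof (rule ccontr)
    assume "k \<noteq> r j"
    then have k: "k < r j" using k by simp
    have not_both: "\<not> (poly A1 (x j) = 0 \<and> poly B1 (x j) = 0)"
    proof
      assume "poly A1 (x j) = 0 \<and> poly B1 (x j) = 0"
      then obtain A2 B2 where "A1 = X j * A2" "B1 = X j * B2" by (metis dvdE poly_eq_0_iff_dvd)
      then have "A0 = X j ^ Suc k * A2" "B0 = X j ^ Suc k * B2" unfolding A1 B1 by (simp_all only: power_Suc2 mult.assoc)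
      then have "Suc k \<in> K" using k by (simp add: K_def)
      then have "Suc k \<le> k" unfolding k_def using \<open>finite K\<close> by (rule Max_ge[rotated])
      then show False by simp
    qed
    have "X j ^ k * (ay * B1 + bY * A1) = X j ^ k * (X j ^ (r j - k) * q1)"
      using F1 k unfolding A1 B1 by (simp add: algebra_simps flip: power_add)
    then have "ay * B1 + bY * A1 = X j ^ (r j - k) * q1" by (subst (asm) mult_cancel_left) simp
    then have "poly ay (x j) * poly B1 (x j) + poly bY (x j) * poly A1 (x j) = 0"
      using k by (simp flip: poly_mult poly_add) (simp add: power_0_left)
    then have nz: "poly (A1 * B1) (x j) \<noteq> 0" using not_both ab by auto
    have "A0 * B0 = X j ^ (2 * k) * (A1 * B1)" unfolding A1 B1 mult_2 by (simp only: power_add ac_simps)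
    moreover have "m j = 2 * k + Suc (m j - 2 * k - 1)" using mrj k by linarith
    then obtain e where "m j = 2 * k + Suc e" by blast
    ultimately have "X j ^ (2 * k) * (A1 * B1) = X j ^ (2 * k) * (X j * (X j ^ e * q0))"
      using F0 by (simp only: power_add power_Suc mult.assoc)
    then have "A1 * B1 = X j * (X j ^ e * q0)" by (subst (asm) mult_cancel_left) simp
    then have "poly (A1 * B1) (x j) = 0" by (simp only: poly_mult) simp
    with nz show False by simp
  qed
  note A1 = A1[unfolded this] and B1 = B1[unfolded this]
  have prod: "A0 * B0 = X j ^ (2 * r j) * (A1 * B1)" unfolding A1 B1 mult_2 by (simp only: power_add ac_simps)
  have m: "m j = 2 * r j"
  proof (rule ccontr)
    assume "m j \<noteq> 2 * r j"
    then have c: "m j + 1 = 2 * r j" using mrj by simp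
    have "poly (a * b) \<psi> = X j ^ m j * (X j * (A1 * B1))"
      using prod unfolding c[symmetric] A0_def B0_def by (simp only: poly_mult power_add power_one_right ac_simps)
    from cA_eq[OF this] have "cA j (a * b) = 0" by simp
    with reg j c show False by (simp add: regular_def)
  qed
  define \<alpha> \<beta> s t where "\<alpha> = poly ay (x j)" and "\<beta> = poly bY (x j)" and "s = poly A1 (x j)" and "t = poly B1 (x j)"
  have "cA j (a * b) = s * t"
    using cA_eq[of "a * b" j "A1 * B1"] prod by (simp add: m A0_def B0_def s_def t_def)
  moreover have "cB j (a * b) = \<alpha> * t + \<beta> * s"
  proof -
    have "poly (pderiv (a * b)) \<psi> = ay * B0 + bY * A0" by (simp only: F1 q(2))
    also have "\<dots> = X j ^ r j * (ay * B1 + bY * A1)" unfolding A1 B1 by (simp only: distrib_left distrib_right ac_simps)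
    finally show ?thesis using cB_eq[of "a * b" j] by (simp add: \<alpha>_def \<beta>_def s_def t_def)
  qed
  moreover have "cC j (a * b) = \<alpha> * \<beta>"
    using \<open>cC j (a * b) = poly (ay * bY) (x j)\<close> by (simp add: \<alpha>_def \<beta>_def)
  ultimately have tf: "tangent_form j (a * b) = [:s * t, \<alpha> * t + \<beta> * s, \<alpha> * \<beta>:]" by (simp add: tangent_form_def)
  have "\<alpha> * t \<noteq> \<beta> * s"
  proof
    assume eq: "\<alpha> * t = \<beta> * s"
    define v where "v = - s / \<alpha>"
    have v: "\<alpha> * v = - s" using ab by (simp add: v_def \<alpha>_def)
    have "poly (tangent_form j (a * b)) v = (s + \<alpha> * v) * (t + \<beta> * v)" by (simp add: tf algebra_simps)
    moreover have "poly (pderiv (tangent_form j (a * b))) v = \<alpha> * t + \<beta> * s + 2 * \<beta> * (\<alpha> * v)"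
      by (simp add: tf pderiv_pCons algebra_simps)
    ultimately show False using f j m v eq by (auto simp: nodal_def)
  qed
  then show thesis using that[OF A1[unfolded A0_def] B1[unfolded B0_def]]
    by (simp add: \<alpha>_def \<beta>_def s_def t_def ay_def bY_def)
qed

text \<open>Cayley--Bacharach: if \<open>f = a b\<close>, then the forms of degree \<open>d - 2\<close> are not all in \<open>(a, b)\<close> modulo lower
  degree, but \<open>(a, b)\<close> contains the scheme of its common zeros, which degree \<open>d - 3\<close> interpolates.\<close>

lemma nodal_irreducible:
  assumes f: "nodal f" and sing: "\<And>a b. singular_at f a b \<Longrightarrow> \<exists>j<n. a = x j \<and> b = poly \<psi> (x j)"
    and low: "interp (d - 3) \<psi> g 1"
  shows "irreducible f"
proof (rule irreducibleI)
  have td: "tdeg_le d f" and lc: "coeff (top_form d f) d \<noteq> 0" using f by (auto simp: nodal_def regular_def \<Lambda>_def)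
  then have cd: "coeff f d \<noteq> 0" using d6 by (auto simp: coeff_top_form)
  show "f \<noteq> 0" using cd by auto
  show "\<not> is_unit f"
  proof
    assume "is_unit f"
    then have "degree f = 0" by (auto simp: is_unit_poly_iff)
    with cd d6 le_degree[of f d] show False by simp
  qed
  fix a b assume fab: "f = a * b"
  show "is_unit a \<or> is_unit b"
  proof (rule ccontr)
    assume nu: "\<not> ?thesis"
    have nz: "a \<noteq> 0" "b \<noteq> 0" using \<open>f \<noteq> 0\<close> fab by auto
    obtain p where p: "tdeg_le p a" "top_form p a \<noteq> 0" using exact_degree nz by blast
    obtain q where q: "tdeg_le q b" "top_form q b \<noteq> 0" using exact_degree nz by blast
    have top: "top_form (p + q) f = top_form p a * top_form q b" unfolding fab by (rule top_form_mult[OF p(1) q(1)])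
    have "top_form d f \<noteq> 0" using lc by auto
    then have d: "d = p + q"
      using exact_degree_unique[OF td _ tdeg_le_mult[OF p(1) q(1), folded fab]] top p(2) q(2) by simp
    have "d \<le> degree (top_form p a * top_form q b)" using lc top d by (simp add: le_degree)
    then have deg: "degree (top_form p a) = p" "degree (top_form q b) = q"
      using degree_top_form[of p a] degree_top_form[of q b] p(2) q(2) d by (simp_all add: degree_mult_eq)
    have unit: "is_unit c" if c: "tdeg_le 0 c" "c \<noteq> 0" for c :: "'k poly poly"
    proof -
      have "c = [:[:coeff (coeff c 0) 0:]:]"
        using c(1) by (intro poly_eqI) (auto simp: coeff_pCons intro: tdeg_leD split: nat.split)
      then obtain s where s: "c = [:[:s:]:]" by blast
      then have "s \<noteq> 0" using c by auto
      then have "1 = c * [:[:1 / s:]:]" by (simp add: s one_pCons)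
      then show ?thesis by (rule dvdI)
    qed
    have pq: "0 < p" "0 < q" using unit[of a] unit[of b] p q nu nz by (auto intro: ccontr)
    have coprime: "\<not> (poly (top_form p a) y = 0 \<and> poly (top_form q b) y = 0)" for y
    proof
      assume y: "poly (top_form p a) y = 0 \<and> poly (top_form q b) y = 0"
      then have "poly (top_form d f) y = 0" "poly (pderiv (top_form d f)) y = 0"
        unfolding d top by (simp_all add: pderiv_mult)
      with f show False by (auto simp: nodal_def)
    qed
    from bezout_of_no_common_root[OF this]
    obtain \<alpha> \<beta> where bez: "\<alpha> * top_form p a + \<beta> * top_form q b = 1" by blast
    define J where "J = {u * a + v * b | u v. True}"
    have Jadd: "u + v \<in> J" if uv: "u \<in> J" "v \<in> J" for u v
    proof -
      obtain u1 u2 v1 v2 where "u = u1 * a + u2 * b" "v = v1 * a + v2 * b" using uv by (auto simp: J_def)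
      then have "u + v = (u1 + v1) * a + (u2 + v2) * b" by (simp add: algebra_simps)
      then show ?thesis unfolding J_def by blast
    qed
    have Jmult: "u * v \<in> J" if v: "v \<in> J" for u v
    proof -
      obtain v1 v2 where "v = v1 * a + v2 * b" using v by (auto simp: J_def)
      then have "u * v = (u * v1) * a + (u * v2) * b" by (simp add: algebra_simps)
      then show ?thesis unfolding J_def by blast
    qed
    have aJ: "a \<in> J" and bJ: "b \<in> J"
    proof -
      have "a = 1 * a + 0 * b" "b = 0 * a + 1 * b" by simp_all
      then show "a \<in> J" "b \<in> J" unfolding J_def by blast+
    qed
    \<comment> \<open>At such a point both factors contain the part of the half scheme
      \<open>g\<close> lying there; \<gamma> collects these parts.\<close>
    define D where "D = {j. j < n \<and> eval2 a (x j) (poly \<psi> (x j)) = 0 \<and> eval2 b (x j) (poly \<psi> (x j)) = 0}"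
    define \<gamma> where "\<gamma> = (\<Prod>j\<in>D. X j ^ r j)"
    have finD: "finite D" and injD: "inj_on x D" using inj by (auto simp: D_def intro: inj_on_subset)
    have dvd: "X j ^ r j dvd poly a \<psi>" "X j ^ r j dvd poly b \<psi>" if jD: "j \<in> D" for j
    proof -
      obtain A1 B1 where "poly a \<psi> = X j ^ r j * A1" "poly b \<psi> = X j ^ r j * B1"
        by (rule factors_at_common_zero[OF f[unfolded fab], of j]) (use jD in \<open>auto simp: D_def\<close>)
      then show "X j ^ r j dvd poly a \<psi>" "X j ^ r j dvd poly b \<psi>" by simp_all
    qed
    obtain A' where A': "poly a \<psi> = \<gamma> * A'"
      using prod_linear_power_dvd[OF finD injD dvd(1)] unfolding \<gamma>_def by blast
    obtain B' where B': "poly b \<psi> = \<gamma> * B'"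
      using prod_linear_power_dvd[OF finD injD dvd(2)] unfolding \<gamma>_def by blast
    define w where "w = [:- \<psi>, 1:]"
    obtain a1 where a1: "a = [:poly a \<psi>:] + w * a1" using division_by_graph unfolding w_def by blast
    obtain b1 where b1: "b = [:poly b \<psi>:] + w * b1" using division_by_graph unfolding w_def by blast
    have a1': "a = [:\<gamma>:] * [:A':] + w * a1" and b1': "b = [:\<gamma>:] * [:B':] + w * b1" using a1 b1 A' B' by simp_all
    \<comment> \<open>The determinant expressing a, b through \<gamma>, w. By Cramer's rule it
      multiplies both \<gamma> and w into the ideal of a and b, and it is nonzero on D because the
      two branches differ.\<close>
    define \<Delta> where "\<Delta> = a1 * [:B':] - b1 * [:A':]"
    have \<Delta>: "eval2 \<Delta> (x j) (poly \<psi> (x j)) \<noteq> 0" if jD: "j \<in> D" for j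
    proof -
      obtain A1 B1 where 1: "poly a \<psi> = X j ^ r j * A1" "poly b \<psi> = X j ^ r j * B1"
        "poly (poly (pderiv a) \<psi>) (x j) * poly B1 (x j) \<noteq> poly (poly (pderiv b) \<psi>) (x j) * poly A1 (x j)"
        by (rule factors_at_common_zero[OF f[unfolded fab], of j]) (use jD in \<open>auto simp: D_def\<close>)
      have "\<gamma> = X j ^ r j * (\<Prod>j\<in>D - {j}. X j ^ r j)" unfolding \<gamma>_def using finD jD by (rule prod.remove)
      then obtain \<gamma>' where \<gamma>': "\<gamma> = X j ^ r j * \<gamma>'" by blast
      have "X j ^ r j * A1 = X j ^ r j * (\<gamma>' * A')" "X j ^ r j * B1 = X j ^ r j * (\<gamma>' * B')"
        using 1(1,2) A' B' unfolding \<gamma>' by (simp_all only: mult.assoc)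
      then have AB: "A1 = \<gamma>' * A'" "B1 = \<gamma>' * B'" by (subst (asm) mult_cancel_left; simp)+
      have dw: "pderiv w = 1" by (simp add: w_def pderiv_pCons)
      have "poly (pderiv a) \<psi> = poly a1 \<psi>" "poly (pderiv b) \<psi> = poly b1 \<psi>"
        by (subst a1 b1, simp add: pderiv_add pderiv_mult dw pderiv_pCons, simp add: w_def)+
      moreover have "poly (poly \<Delta> \<psi>) (x j) = poly (poly a1 \<psi>) (x j) * poly B' (x j) - poly (poly b1 \<psi>) (x j) * poly A' (x j)"
        by (simp add: \<Delta>_def)
      ultimately have "poly (poly \<Delta> \<psi>) (x j) \<noteq> 0" using 1(3) unfolding AB by (auto simp: algebra_simps)
      then show ?thesis by (simp add: poly_poly_eq_eval2)
    qed
    \<comment> \<open>The quotient of J by w and \<gamma>. A common zero of I would be a common zero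
      of a and b, hence singular on f and a point of D; but \<Delta> lies in I and does not vanish
      there.\<close>
    define I where "I = {s. s * w \<in> J \<and> s * [:\<gamma>:] \<in> J}"
    have "1 \<in> I"
    proof (rule ccontr)
      assume "1 \<notin> I"
      obtain P u v where P: "P \<noteq> 0" "[:P:] = u * a + v * b"
        using eliminant[OF p(1) _ q(1) pq(1)] deg(1) p(2) coprime by (metis leading_coeff_0_iff)
      have JI: "s \<in> I" if "s \<in> J" for s
        using Jmult[OF that, of w] Jmult[OF that, of "[:\<gamma>:]"] by (simp only: I_def mem_Collect_eq mult.commute[of s])
      have "\<exists>a0 b0. \<forall>s\<in>I. eval2 s a0 b0 = 0"
      proof (rule exists_common_zero[OF _ _ _ P(1) _ _ \<open>1 \<notin> I\<close>])
        show "u + v \<in> I" if "u \<in> I" "v \<in> I" for u v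
          using Jadd[of "u * w" "v * w"] Jadd[of "u * [:\<gamma>:]" "v * [:\<gamma>:]"] that
          by (simp only: I_def mem_Collect_eq distrib_right)
        show "u * v \<in> I" if "v \<in> I" for u v
          using Jmult[of "v * w" u] Jmult[of "v * [:\<gamma>:]" u] that by (simp only: I_def mem_Collect_eq mult.assoc)
        show "[:P:] \<in> I" using P(2) by (intro JI) (auto simp: J_def)
        show "a \<in> I" using aJ by (rule JI)
        show "slice c a \<noteq> 0" for c using deg(1) p by (intro slice_nonzero[OF p(1)]) (metis leading_coeff_0_iff)
      qed
      then obtain a0 b0 where z: "\<And>s. s \<in> I \<Longrightarrow> eval2 s a0 b0 = 0" by blast
      have ab0: "eval2 a a0 b0 = 0" "eval2 b a0 b0 = 0" using z JI aJ bJ by blast+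
      then have "singular_at f a0 b0" unfolding fab singular_at_def by (simp add: pdx_mult pderiv_mult)
      then obtain j where j: "j < n" "a0 = x j" "b0 = poly \<psi> (x j)" using sing by blast
      then have "j \<in> D" using ab0 by (simp add: D_def)
      moreover have "\<Delta> \<in> I"
      proof -
        have 1: "(u * B - v * A) * w = B * (G * A + w * u) + (- A) * (G * B + w * v)"
          and 2: "(u * B - v * A) * G = (- v) * (G * A + w * u) + u * (G * B + w * v)" for u v A B G :: "'k poly poly"
          by (simp_all add: algebra_simps)
        have "\<Delta> * w = [:B':] * a + (- [:A':]) * b" unfolding a1' b1' \<Delta>_def by (rule 1)
        moreover have "\<Delta> * [:\<gamma>:] = (- b1) * a + a1 * b" unfolding a1' b1' \<Delta>_def by (rule 2)
        ultimately show ?thesis unfolding I_def J_def by blast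
      qed
      ultimately show False using \<Delta> z j by blast
    qed
    then have wJ: "w \<in> J" and \<gamma>J: "[:\<gamma>:] \<in> J" by (auto simp: I_def)
    \<comment> \<open>No polynomial of degree d - 3 agrees with this F modulo J. Interpolation
      supplies one: \<open>low\<close> matches F on the arc modulo g, hence modulo \<gamma>, and J
      contains w and \<gamma>.\<close>
    obtain F where F: "\<And>f u v. tdeg_le (p + q - 3) f \<Longrightarrow> F \<noteq> f + (u * a + v * b)"
      using not_spanned_below[OF p(1) deg(1) q(1) deg(2) pq _ bez] d d6 by auto
    obtain f0 where f0: "tdeg_le (d - 3) f0" "g dvd poly f0 \<psi> - poly F \<psi>" using low unfolding interp_def by blast
    have "D \<subseteq> {..<n}" by (auto simp: D_def)
    then have "\<gamma> dvd g" unfolding \<gamma>_def g_def by (intro prod_dvd_prod_subset) auto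
    with f0(2) obtain e where "poly f0 \<psi> - poly F \<psi> = \<gamma> * e" by (meson dvd_trans dvdE)
    then have e: "poly (F - f0) \<psi> = - e * \<gamma>" by (simp add: algebra_simps)
    obtain s where s: "F - f0 = [:poly (F - f0) \<psi>:] + w * s" using division_by_graph unfolding w_def by blast
    have "F - f0 = [:- e:] * [:\<gamma>:] + s * w" using s unfolding e by (simp add: mult.commute)
    also have "\<dots> \<in> J" by (intro Jadd Jmult wJ \<gamma>J)
    finally have "F - f0 \<in> J" .
    then obtain u v where "F - f0 = u * a + v * b" by (auto simp: J_def)
    then have "F = f0 + (u * a + v * b)" by (simp add: algebra_simps)
    with F[of f0 u v] f0(1) d show False by simp
  qed
qed

end

section \<open>Infinitely near points\<close>

declare strict_transform.simps [simp del]

lemma coeff_0_0: "coeff (coeff f 0) 0 = eval2 f 0 0"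
  by (simp add: eval2_def poly_0_coeff_0)

lemma coeff_1_0: "coeff (coeff f (Suc 0)) 0 = eval2 (pderiv f) 0 0"
  by (simp add: coeff_0_0[symmetric] coeff_pderiv)

lemma coeff_0_1: "coeff (coeff f 0) (Suc 0) = eval2 (pdx f) 0 0"
  by (simp add: coeff_0_0[symmetric] coeff_pderiv coeff_map_poly)

lemma coeff_2_0: "2 * coeff (coeff f 2) 0 = eval2 (pderiv (pderiv f)) 0 0"
proof -
  have "coeff (coeff (pderiv (pderiv f)) 0) 0 = 2 * coeff (coeff f 2) 0"
    by (simp add: coeff_pderiv numeral_2_eq_2 of_nat_poly)
  then show ?thesis by (simp add: coeff_0_0)
qed

lemma mult0_eqI:
  assumes "\<And>i j. i + j < k \<Longrightarrow> coeff (coeff f j) i = 0" "top_form k f \<noteq> 0"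
  shows "mult0 f = k"
  unfolding mult0_def
proof (rule Least_equality)
  obtain j where "coeff (top_form k f) j \<noteq> 0" using assms(2) by (metis leading_coeff_0_iff)
  then have "k - j + j = k" "coeff (coeff f j) (k - j) \<noteq> 0" by (auto simp: coeff_top_form split: if_splits)
  then show "\<exists>i j. i + j = k \<and> coeff (coeff f j) i \<noteq> 0" by blast
  show "k \<le> y" if "\<exists>i j. i + j = y \<and> coeff (coeff f j) i \<noteq> 0" for y
    using assms(1) that by (metis not_le)
qed

lemma subst2_varx: "subst2 f varx Y = pcompose f Y"
proof -
  have "poly (map_poly const2 a) varx = [:a:]" for a :: "'a::field poly"
    by (induction a) (auto simp: map_poly_pCons)
  then show ?thesis by (simp add: subst2_def pcompose_altdef)
qed

text \<open>A term x^i y^j becomes x^(i+j) (y + c)^j, so after division by x^k exactly the terms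
  with i + j = k survive on the exceptional line x = 0.\<close>

lemma blow_up_slope:
  assumes van: "\<And>i j. i + j < k \<Longrightarrow> coeff (coeff f j) i = 0"
  obtains g where "subst2 f varx (varx * (vary + const2 c)) = varx ^ k * g"
    "\<And>y. eval2 g 0 y = poly (top_form k f) (y + c)"
    "\<And>y. eval2 (pderiv g) 0 y = poly (pderiv (top_form k f)) (y + c)"
proof -
  define N where "N = max k (degree f)"
  have const_mult: "[:u * v:] = [:u:] * [:v:]" for u v :: "'a poly" by simp
  have const_power: "[:u ^ j:] = [:u:] ^ j" for u :: "'a poly" and j
  proof (induction j)
    case (Suc j)
    then show ?case by (simp only: power_Suc const_mult)
  qed (simp add: one_pCons)
  have "\<exists>b. coeff f j * [:0, 1:] ^ j = [:0, 1:] ^ k * b \<and> poly b 0 = coeff (top_form k f) j" for j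
  proof (cases "j \<le> k")
    case True
    have "monom 1 (k - j) dvd coeff f j"
      using van[of _ j] by (auto simp: monom_1_dvd_iff')
    then obtain b where b: "coeff f j = monom 1 (k - j) * b" by blast
    then have "coeff (coeff f j) (k - j) = coeff b 0" by (simp add: coeff_monom_mult)
    moreover have "coeff f j * [:0, 1:] ^ j = [:0, 1:] ^ k * b"
      using True by (simp add: b monom_altdef ac_simps flip: power_add)
    ultimately show ?thesis using True by (intro exI[of _ b]) (simp add: coeff_top_form poly_0_coeff_0)
  next
    case False
    then have "coeff f j * [:0, 1:] ^ j = [:0, 1:] ^ k * (coeff f j * [:0, 1:] ^ (j - k))"
      by (simp add: ac_simps flip: power_add)
    moreover have "poly (coeff f j * [:0, 1:] ^ (j - k)) 0 = 0" using False by (simp add: power_0_left)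
    ultimately show ?thesis
      using False by (intro exI[of _ "coeff f j * [:0, 1:] ^ (j - k)"] conjI) (simp_all only: coeff_top_form if_False)
  qed
  then obtain b where b: "\<And>j. coeff f j * [:0, 1:] ^ j = [:0, 1:] ^ k * b j" "\<And>j. poly (b j) 0 = coeff (top_form k f) j"
    by metis
  define g where "g = (\<Sum>j\<le>N. [:b j:] * (vary + const2 c) ^ j)"
  have "subst2 f varx (varx * (vary + const2 c)) = (\<Sum>j\<le>N. [:coeff f j:] * (varx * (vary + const2 c)) ^ j)"
    unfolding subst2_varx pcompose_altdef poly_altdef N_def
    by (intro sum.mono_neutral_cong_left) (auto simp: coeff_map_poly coeff_eq_0 degree_map_poly)
  also have "\<dots> = (\<Sum>j\<le>N. [:coeff f j * [:0, 1:] ^ j:] * (vary + const2 c) ^ j)"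
  proof (rule sum.cong[OF refl])
    fix j
    have "[:coeff f j:] * varx ^ j = [:coeff f j * [:0, 1:] ^ j:]" unfolding const_mult const_power ..
    then show "[:coeff f j:] * (varx * (vary + const2 c)) ^ j = [:coeff f j * [:0, 1:] ^ j:] * (vary + const2 c) ^ j"
      by (simp only: power_mult_distrib mult.assoc[symmetric])
  qed
  also have "\<dots> = varx ^ k * g"
  proof -
    have v: "[:[:0, 1:] ^ k * p:] = varx ^ k * [:p:]" for p :: "'a poly"
      unfolding const_mult const_power ..
    show ?thesis unfolding b(1) v g_def sum_distrib_left by (simp only: mult.assoc)
  qed
  finally have 1: "subst2 f varx (varx * (vary + const2 c)) = varx ^ k * g" .
  have top: "top_form k f = (\<Sum>j\<le>N. monom (coeff (top_form k f) j) j)"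
  proof -
    have "degree (top_form k f) \<le> N" using degree_top_form[of k f] by (simp add: N_def)
    then show ?thesis by (simp add: poly_as_sum_of_monoms')
  qed
  have eval_sum: "eval2 (sum h A) 0 y = (\<Sum>j\<in>A. eval2 (h j) 0 y)" for h :: "nat \<Rightarrow> 'a poly poly" and A y
    by (induction A rule: infinite_finite_induct) auto
  have 2: "eval2 g 0 y = poly (top_form k f) (y + c)" for y
  proof -
    have "eval2 g 0 y = (\<Sum>j\<le>N. coeff (top_form k f) j * (y + c) ^ j)"
      unfolding g_def eval_sum by (simp add: b(2) add.commute)
    also have "\<dots> = poly (top_form k f) (y + c)"
      by (subst (2) top) (simp add: poly_sum poly_monom)
    finally show ?thesis .
  qed
  have sl: "slice 0 g = pcompose (top_form k f) [:c, 1:]"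
  proof (rule poly_eqI)
    fix i
    have "slice 0 g = (\<Sum>j\<le>N. smult (coeff (top_form k f) j) ([:c, 1:] ^ j))"
    proof -
      have s1: "slice 0 (sum h A) = (\<Sum>j\<in>A. slice 0 (h j))" for h :: "nat \<Rightarrow> 'a poly poly" and A
        by (induction A rule: infinite_finite_induct) (auto simp: slice_add slice_def[of _ 0])
      have s2: "slice 0 (h ^ j) = slice 0 h ^ j" for h :: "'a poly poly" and j
        by (induction j) (auto simp: slice_mult slice_def[of _ 1])
      have "slice 0 ([:b j:] * (vary + const2 c) ^ j) = smult (coeff (top_form k f) j) ([:c, 1:] ^ j)" for j
        unfolding slice_mult s2 by (simp add: slice_def map_poly_pCons b(2))
      then show ?thesis unfolding g_def s1 by simp
    qed
    also have "\<dots> = pcompose (top_form k f) [:c, 1:]"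
    proof -
      have "degree (top_form k f) \<le> N" using degree_top_form[of k f] by (simp add: N_def)
      then show ?thesis unfolding pcompose_altdef poly_altdef
        by (intro sum.mono_neutral_cong_right) (auto simp: coeff_map_poly coeff_eq_0 degree_map_poly)
    qed
    finally show "coeff (slice 0 g) i = coeff (pcompose (top_form k f) [:c, 1:]) i" by simp
  qed
  have 3: "eval2 (pderiv g) 0 y = poly (pderiv (top_form k f)) (y + c)" for y
    unfolding poly_slice[symmetric] pderiv_slice[symmetric] sl
    by (simp add: pderiv_pcompose poly_pcompose pderiv_pCons add.commute)
  show thesis by (rule that[OF 1 2 3])
qed

text \<open>In this chart x^i y^j goes to x^i y^(i+j), so coefficients are only rearranged.\<close>

lemma coeff_blow_up_vertical:
  "coeff (coeff (subst2 f (varx * vary) vary) l) i = (if i \<le> l then coeff (coeff f (l - i)) i else 0)"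
proof -
  have A: "coeff (coeff (poly (map_poly const2 a) (varx * vary)) l) i = (if i = l then coeff a i else 0)" for a :: "'a poly" and l i
  proof (induction a arbitrary: l i)
    case (pCons c a)
    show ?case
    proof (cases l)
      case 0
      then show ?thesis by (cases i) (simp_all add: map_poly_pCons)
    next
      case (Suc k)
      then show ?thesis using pCons.IH[of k] by (cases i) (simp_all add: map_poly_pCons)
    qed
  qed simp
  show ?thesis
  proof (induction f arbitrary: l i)
    case (pCons a f)
    have "subst2 (pCons a f) (varx * vary) vary = poly (map_poly const2 a) (varx * vary) + vary * subst2 f (varx * vary) vary"
      by (simp add: subst2_def map_poly_pCons)
    then show ?case
      using pCons.IH[of "l - 1" i] A[of a l i]
      by (cases l) (auto simp: coeff_pCons Suc_diff_le split: nat.splits)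
  qed (simp add: subst2_def)
qed

lemma strict_transform_slope:
  assumes "mult0 f = k" "\<And>i j. i + j < k \<Longrightarrow> coeff (coeff f j) i = 0"
  shows "pcompose f (varx * (vary + const2 c)) = varx ^ k * strict_transform (Slope c) f"
    "eval2 (strict_transform (Slope c) f) 0 y = poly (top_form k f) (y + c)"
    "eval2 (pderiv (strict_transform (Slope c) f)) 0 y = poly (pderiv (top_form k f)) (y + c)"
proof -
  obtain g where g: "subst2 f varx (varx * (vary + const2 c)) = varx ^ k * g"
    "\<And>y. eval2 g 0 y = poly (top_form k f) (y + c)"
    "\<And>y. eval2 (pderiv g) 0 y = poly (pderiv (top_form k f)) (y + c)"
    using blow_up_slope[OF assms(2)] by metis
  have "varx ^ k * g div varx ^ k = g" by (rule nonzero_mult_div_cancel_left) simp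
  then have st: "strict_transform (Slope c) f = g"
    by (simp only: strict_transform.simps assms(1) g(1))
  show "pcompose f (varx * (vary + const2 c)) = varx ^ k * strict_transform (Slope c) f"
    unfolding st using g(1) by (simp only: subst2_varx)
  show "eval2 (strict_transform (Slope c) f) 0 y = poly (top_form k f) (y + c)"
    "eval2 (pderiv (strict_transform (Slope c) f)) 0 y = poly (pderiv (top_form k f)) (y + c)"
    unfolding st by (rule g)+
qed

lemma strict_transform_vertical:
  assumes "mult0 f = k" "\<And>i j. i + j < k \<Longrightarrow> coeff (coeff f j) i = 0"
  shows "coeff (coeff (strict_transform Vertical f) l) i = (if i \<le> l + k then coeff (coeff f (l + k - i)) i else 0)"
proof -
  let ?F = "subst2 f (varx * vary) vary"
  have "coeff ?F l = 0" if "l < k" for l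
    using assms(2) that by (intro poly_eqI) (simp only: coeff_blow_up_vertical coeff_0, simp)
  then have "monom 1 k dvd ?F" by (simp add: monom_1_dvd_iff')
  then obtain g where g: "?F = monom 1 k * g" by blast
  have m: "vary ^ k = (monom 1 k :: 'a poly poly)" by (simp add: monom_altdef)
  have "monom 1 k * g div monom 1 k = g" by (rule nonzero_mult_div_cancel_left) simp
  then have st: "strict_transform Vertical f = g"
    by (simp only: strict_transform.simps assms(1) m g)
  have "coeff g l = coeff ?F (l + k)" unfolding g by (simp add: coeff_monom_mult)
  then show ?thesis unfolding st by (simp only: coeff_blow_up_vertical)
qed

section \<open>Multiplicities at infinitely near points\<close>

lemma mult_at_Nil: "mult_at f [] = mult0 f"
  and mult_at_Cons: "mult_at f (D # p) = mult_at (strict_transform D f) p"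
  by (simp_all add: mult_at_def)

abbreviation unit_germ :: "'a::field poly poly \<Rightarrow> bool" where
  "unit_germ f \<equiv> eval2 f 0 0 \<noteq> 0"

lemma mult0_unit_germ: "unit_germ f \<Longrightarrow> mult0 f = 0"
  by (rule mult0_eqI) (auto simp: coeff_0_0[symmetric] coeff_top_form dest: arg_cong[of _ _ "\<lambda>p. coeff p 0"])

lemma mult0_smooth_germ:
  assumes "eval2 f 0 0 = 0" "eval2 (pdx f) 0 0 \<noteq> 0 \<or> eval2 (pderiv f) 0 0 \<noteq> 0"
  shows "mult0 f = 1"
proof (rule mult0_eqI)
  show "coeff (coeff f j) i = 0" if "i + j < 1" for i j using assms(1) that by (simp add: coeff_0_0)
  have "coeff (top_form 1 f) 0 = eval2 (pdx f) 0 0" "coeff (top_form 1 f) 1 = eval2 (pderiv f) 0 0"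
    by (simp_all add: coeff_top_form coeff_0_1 coeff_1_0)
  then show "top_form 1 f \<noteq> 0" using assms(2) by (metis coeff_0)
qed

lemma unit_germ_strict_transform:
  assumes "unit_germ f"
  shows "unit_germ (strict_transform D f)"
proof (cases D)
  case (Slope c)
  have "eval2 (strict_transform (Slope c) f) 0 0 = poly (top_form 0 f) (0 + c)"
    by (rule strict_transform_slope(2)[OF mult0_unit_germ[OF assms]]) simp
  also have "\<dots> = eval2 f 0 0" by (simp add: top_form_def monom_0 coeff_0_0)
  finally show ?thesis using assms Slope by simp
next
  case Vertical
  have "coeff (coeff (strict_transform Vertical f) 0) 0 = coeff (coeff f 0) 0"
    by (subst strict_transform_vertical[OF mult0_unit_germ[OF assms]]) simp_all
  then show ?thesis using assms Vertical by (simp add: coeff_0_0)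
qed

lemma mult_at_unit_germ: "unit_germ f \<Longrightarrow> mult_at f p = 0"
  by (induction p arbitrary: f) (simp_all add: mult_at_Nil mult_at_Cons mult0_unit_germ unit_germ_strict_transform)

text \<open>A smooth branch transversal to \<open>x = 0\<close> stays transversal to the exceptional divisor.\<close>

lemma mult_at_transversal:
  assumes "eval2 f 0 0 \<noteq> 0 \<or> eval2 (pderiv f) 0 0 \<noteq> 0"
  shows "mult_at f p \<le> 1 \<and> (0 < mult_at f p \<longrightarrow> Vertical \<notin> set p)"
  using assms
proof (induction p arbitrary: f)
  case Nil
  then show ?case
    by (cases "eval2 f 0 0 = 0") (auto simp: mult_at_Nil mult0_unit_germ mult0_smooth_germ)
next
  case (Cons D p)
  show ?case
  proof (cases "eval2 f 0 0 = 0")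
    case False
    then show ?thesis using mult_at_unit_germ[of f "D # p"] by simp
  next
    case True
    with Cons.prems have d: "eval2 (pderiv f) 0 0 \<noteq> 0" by simp
    then have m: "mult0 f = 1" using True by (simp add: mult0_smooth_germ)
    have v: "coeff (coeff f j) i = 0" if "i + j < 1" for i j using True that by (simp add: coeff_0_0)
    show ?thesis
    proof (cases D)
      case (Slope c)
      have "pderiv (top_form 1 f) = [:eval2 (pderiv f) 0 0:]"
        by (rule poly_eqI) (auto simp: coeff_pderiv coeff_top_form coeff_1_0 coeff_pCons split: nat.split)
      then have "eval2 (pderiv (strict_transform (Slope c) f)) 0 0 \<noteq> 0"
        using strict_transform_slope(3)[OF m v, of c 0] d by simp
      then show ?thesis using Cons.IH[of "strict_transform (Slope c) f"] Slope by (simp add: mult_at_Cons)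
    next
      case Vertical
      have "coeff (coeff (strict_transform Vertical f) 0) 0 = coeff (coeff f (Suc 0)) 0"
        by (subst strict_transform_vertical[OF m v]) simp_all
      then have "unit_germ (strict_transform Vertical f)" using d by (simp add: coeff_0_0 coeff_1_0)
      then show ?thesis using Vertical by (simp add: mult_at_Cons mult_at_unit_germ)
    qed
  qed
qed

text \<open>To leading order f is \<alpha> x^m + \<beta> x^r (y - \<phi>) + \<gamma> (y - \<phi>)^2
  along a smooth arc y = \<phi>(x). The arc is quantified away because each blow-up replaces it by
  its strict transform.\<close>

definition normal_form :: "nat \<Rightarrow> nat \<Rightarrow> 'a::field \<Rightarrow> 'a \<Rightarrow> 'a \<Rightarrow> 'a poly poly \<Rightarrow> bool" where
  "normal_form m r \<alpha> \<beta> \<gamma> f \<longleftrightarrow> (\<exists>\<phi> A B. poly \<phi> 0 = 0 \<and>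
     poly f \<phi> = [:0, 1:] ^ m * A \<and> poly A 0 = \<alpha> \<and>
     poly (pderiv f) \<phi> = [:0, 1:] ^ r * B \<and> poly B 0 = \<beta> \<and>
     poly (poly (pderiv (pderiv f)) \<phi>) 0 = 2 * \<gamma>)"

lemma normal_form_values:
  fixes f :: "'a::field_char_0 poly poly"
  assumes "normal_form m r \<alpha> \<beta> \<gamma> f"
  shows "eval2 f 0 0 = \<alpha> * 0 ^ m" "eval2 (pderiv f) 0 0 = \<beta> * 0 ^ r" "coeff (coeff f 2) 0 = \<gamma>"
    "0 < r \<Longrightarrow> m = Suc k \<Longrightarrow> eval2 (pdx f) 0 0 = \<alpha> * 0 ^ k"
proof -
  obtain \<phi> A B where N: "poly \<phi> 0 = 0" "poly f \<phi> = [:0, 1:] ^ m * A" "poly A 0 = \<alpha>"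
    "poly (pderiv f) \<phi> = [:0, 1:] ^ r * B" "poly B 0 = \<beta>" "poly (poly (pderiv (pderiv f)) \<phi>) 0 = 2 * \<gamma>"
    using assms by (auto simp: normal_form_def)
  have ev: "eval2 h 0 0 = poly (poly h \<phi>) 0" for h by (simp add: poly_poly_eq_eval2 N(1))
  show "eval2 f 0 0 = \<alpha> * 0 ^ m" unfolding ev N(2) by (simp add: N(3))
  show d: "eval2 (pderiv f) 0 0 = \<beta> * 0 ^ r" unfolding ev N(4) by (simp add: N(5))
  show "coeff (coeff f 2) 0 = \<gamma>" using coeff_2_0[of f] unfolding ev N(6) by simp
  assume r: "0 < r" and m: "m = Suc k"
  have "pderiv (poly f \<phi>) = [:0, 1:] ^ Suc k * pderiv A + smult (of_nat (Suc k)) ([:0, 1:] ^ k * A)"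
    unfolding N(2) m pderiv_mult pderiv_power_Suc by (simp add: pderiv_pCons mult.commute)
  then have "poly (pderiv (poly f \<phi>)) 0 = of_nat (Suc k) * 0 ^ k * \<alpha>" by (simp add: N(3))
  also have "\<dots> = \<alpha> * 0 ^ k" by (cases k) simp_all
  finally have "eval2 (pdx f) 0 0 + eval2 (pderiv f) 0 0 * poly (pderiv \<phi>) 0 = \<alpha> * 0 ^ k"
    unfolding pderiv_poly by (simp add: ev)
  then show "eval2 (pdx f) 0 0 = \<alpha> * 0 ^ k" using d r by (simp add: power_0_left)
qed

text \<open>Blowing up in the direction c of the arc divides f by x^2, f_y by x, and leaves f_yy
  unchanged; so (m, r) drops by (2, 1) and the leading coefficients stay. The other directions are
  governed by the quadratic tangent cone, expanded around c.\<close>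

lemma normal_form_blow_up:
  fixes f :: "'a::field_char_0 poly poly"
  assumes nf: "normal_form (Suc (Suc m)) (Suc r) \<alpha> \<beta> \<gamma> f" and "\<gamma> \<noteq> 0"
  obtains c where "mult0 f = 2" "normal_form m r \<alpha> \<beta> \<gamma> (strict_transform (Slope c) f)"
    "\<And>c'. eval2 (strict_transform (Slope c') f) 0 0 = \<alpha> * 0 ^ m + \<beta> * 0 ^ r * (c' - c) + \<gamma> * (c' - c)\<^sup>2"
    "\<And>c'. eval2 (pderiv (strict_transform (Slope c') f)) 0 0 = \<beta> * 0 ^ r + 2 * \<gamma> * (c' - c)"
    "unit_germ (strict_transform Vertical f)"
proof -
  note v = normal_form_values[OF nf]
  have "eval2 (pdx f) 0 0 = 0" using v(4)[of "Suc m"] by simp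
  then have van: "coeff (coeff f j) i = 0" if "i + j < 2" for i j
  proof -
    consider "i = 0" "j = 0" | "i = Suc 0" "j = 0" | "i = 0" "j = Suc 0" using \<open>i + j < 2\<close> by linarith
    then show ?thesis using v \<open>eval2 (pdx f) 0 0 = 0\<close> by cases (simp_all add: coeff_0_0 coeff_0_1 coeff_1_0)
  qed
  define Q where "Q = top_form 2 f"
  have Q2: "coeff Q 2 = \<gamma>" using v(3) by (simp add: Q_def coeff_top_form)
  then have "Q \<noteq> 0" using \<open>\<gamma> \<noteq> 0\<close> by auto
  then have mult: "mult0 f = 2" unfolding Q_def by (intro mult0_eqI van)
  note S = strict_transform_slope[OF mult van, folded Q_def]
  obtain \<phi> A B where N: "poly \<phi> 0 = 0" "poly f \<phi> = [:0, 1:] ^ Suc (Suc m) * A" "poly A 0 = \<alpha>"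
    "poly (pderiv f) \<phi> = [:0, 1:] ^ Suc r * B" "poly B 0 = \<beta>" "poly (poly (pderiv (pderiv f)) \<phi>) 0 = 2 * \<gamma>"
    using nf by (auto simp: normal_form_def)
  obtain \<phi>0 where \<phi>0: "\<phi> = [:0, 1:] * \<phi>0" using N(1) by (metis dvdE minus_zero poly_eq_0_iff_dvd)
  define c where "c = poly \<phi>0 0"
  define \<phi>1 where "\<phi>1 = \<phi>0 - [:c:]"
  define g where "g = strict_transform (Slope c) f"
  define Y where "Y = varx * (vary + const2 c)"
  have Y: "poly Y \<phi>1 = \<phi>" "pderiv Y = varx"
    by (simp_all add: Y_def \<phi>1_def \<phi>0 pderiv_mult pderiv_pCons pderiv_add algebra_simps)
  have g: "pcompose f Y = varx\<^sup>2 * g" unfolding Y_def g_def by (rule S(1))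
  then have "pderiv (pcompose f Y) = pderiv (varx\<^sup>2 * g)" by (rule arg_cong)
  moreover have Pv: "pderiv (varx * h) = varx * pderiv h" for h :: "'a poly poly" by (simp add: pderiv_smult)
  ultimately have "pcompose (pderiv f) Y * varx = varx\<^sup>2 * pderiv g"
    by (simp only: pderiv_pcompose Y(2) power2_eq_square mult.assoc Pv)
  then have "varx * pcompose (pderiv f) Y = varx * (varx * pderiv g)"
    by (simp only: power2_eq_square ac_simps)
  then have g1: "pcompose (pderiv f) Y = varx * pderiv g" by (subst (asm) mult_cancel_left) simp
  then have "pderiv (pcompose (pderiv f) Y) = pderiv (varx * pderiv g)" by simp
  then have "pcompose (pderiv (pderiv f)) Y * varx = varx * pderiv (pderiv g)"
    by (simp only: pderiv_pcompose Y(2) Pv)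
  then have "varx * pcompose (pderiv (pderiv f)) Y = varx * pderiv (pderiv g)" by (simp only: mult.commute)
  then have g2: "pcompose (pderiv (pderiv f)) Y = pderiv (pderiv g)" by (subst (asm) mult_cancel_left) simp
  have ev: "poly (pcompose h Y) \<phi>1 = poly h \<phi>" for h by (simp only: poly_pcompose Y(1))
  have vx: "poly varx \<phi>1 = [:0, 1:]" by simp
  have "[:0, 1:]\<^sup>2 * poly g \<phi>1 = [:0, 1:]\<^sup>2 * ([:0, 1:] ^ m * A)"
    using ev[of f] unfolding g N(2) poly_mult poly_power vx by (simp only: power2_eq_square power_Suc mult.assoc)
  then have E0: "poly g \<phi>1 = [:0, 1:] ^ m * A" by (subst (asm) mult_cancel_left) simp
  have "[:0, 1:] * poly (pderiv g) \<phi>1 = [:0, 1:] * ([:0, 1:] ^ r * B)"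
    using ev[of "pderiv f"] unfolding g1 N(4) poly_mult vx by (simp only: power_Suc mult.assoc)
  then have E1: "poly (pderiv g) \<phi>1 = [:0, 1:] ^ r * B" by (subst (asm) mult_cancel_left) simp
  have E2: "poly (poly (pderiv (pderiv g)) \<phi>1) 0 = 2 * \<gamma>"
    using ev[of "pderiv (pderiv f)"] N(6) unfolding g2 by simp
  have "poly \<phi>1 0 = 0" by (simp add: \<phi>1_def c_def)
  then have nf': "normal_form m r \<alpha> \<beta> \<gamma> g" unfolding normal_form_def using E0 E1 E2 N(3,5) by blast
  have Qc: "poly Q c = \<alpha> * 0 ^ m" "poly (pderiv Q) c = \<beta> * 0 ^ r"
    using normal_form_values(1,2)[OF nf'] S(2,3)[of c 0] by (simp_all add: g_def)
  have "Q = [:coeff Q 0, coeff Q 1, \<gamma>:]"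
    by (rule poly_eqI) (use Q2 in \<open>auto simp: Q_def coeff_top_form coeff_pCons numeral_2_eq_2 split: nat.split\<close>)
  then obtain q0 q1 where Q: "Q = [:q0, q1, \<gamma>:]" by blast
  have q: "\<alpha> * 0 ^ m = q0 + c * (q1 + c * \<gamma>)" "\<beta> * 0 ^ r = q1 + 2 * c * \<gamma>"
    using Qc unfolding Q by (simp_all add: pderiv_pCons algebra_simps)
  have "poly Q c' = \<alpha> * 0 ^ m + \<beta> * 0 ^ r * (c' - c) + \<gamma> * (c' - c)\<^sup>2"
    "poly (pderiv Q) c' = \<beta> * 0 ^ r + 2 * \<gamma> * (c' - c)" for c'
    unfolding q Q by (simp_all add: pderiv_pCons power2_eq_square algebra_simps)
  then have val: "eval2 (strict_transform (Slope c') f) 0 0 = \<alpha> * 0 ^ m + \<beta> * 0 ^ r * (c' - c) + \<gamma> * (c' - c)\<^sup>2"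
    "eval2 (pderiv (strict_transform (Slope c') f)) 0 0 = \<beta> * 0 ^ r + 2 * \<gamma> * (c' - c)" for c'
    using S(2,3)[of c' 0] by simp_all
  have "coeff (coeff (strict_transform Vertical f) 0) 0 = coeff (coeff f 2) 0"
    by (subst strict_transform_vertical[OF mult van]) (simp_all add: numeral_2_eq_2)
  then have "unit_germ (strict_transform Vertical f)" using v(3) \<open>\<gamma> \<noteq> 0\<close> by (simp add: coeff_0_0)
  then show thesis using that[OF mult nf'[unfolded g_def] val] by blast
qed

text \<open>Before the last blow-up the tangent cone is a double line, and only the direction of the
  arc stays on the curve. After t blow-ups the curve meets the exceptional line in simple zeros of
  \<alpha> + \<beta> v + \<gamma> v^2, where \<open>mult_at_transversal\<close> applies.\<close>

lemma normal_form_tacnode_points: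
  fixes f :: "'a::field_char_0 poly poly"
  assumes "normal_form (2 * t) t \<alpha> \<beta> \<gamma> f" "0 < t" "\<gamma> \<noteq> 0"
    and disc: "\<And>v. \<alpha> + \<beta> * v + \<gamma> * v\<^sup>2 = 0 \<Longrightarrow> \<beta> + 2 * \<gamma> * v \<noteq> 0"
  shows "\<exists>q. length q + 1 = t \<and> Vertical \<notin> set q \<and> (\<forall>p. prefix p q \<longrightarrow> mult_at f p = 2) \<and>
    (\<forall>p. (2 \<le> mult_at f p \<longrightarrow> prefix p q) \<and> (0 < mult_at f p \<longrightarrow> Vertical \<notin> set p))"
  using assms(1,2)
proof (induction t arbitrary: f)
  case (Suc t)
  have "normal_form (Suc (Suc (2 * t))) (Suc t) \<alpha> \<beta> \<gamma> f" using Suc.prems by simp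
  then obtain c where c: "mult0 f = 2" "normal_form (2 * t) t \<alpha> \<beta> \<gamma> (strict_transform (Slope c) f)"
    "\<And>c'. eval2 (strict_transform (Slope c') f) 0 0 = \<alpha> * 0 ^ (2 * t) + \<beta> * 0 ^ t * (c' - c) + \<gamma> * (c' - c)\<^sup>2"
    "\<And>c'. eval2 (pderiv (strict_transform (Slope c') f)) 0 0 = \<beta> * 0 ^ t + 2 * \<gamma> * (c' - c)"
    "unit_germ (strict_transform Vertical f)"
    using normal_form_blow_up[OF _ \<open>\<gamma> \<noteq> 0\<close>] by metis
  show ?case
  proof (cases "t = 0")
    case True
    have tr: "mult_at f (Slope c' # p) \<le> 1 \<and> (0 < mult_at f (Slope c' # p) \<longrightarrow> Vertical \<notin> set p)" for c' p
      unfolding mult_at_Cons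
      by (rule mult_at_transversal) (use c(3,4)[of c'] disc[of "c' - c"] True in auto)
    have "mult_at f (Vertical # p) = 0" for p unfolding mult_at_Cons by (rule mult_at_unit_germ[OF c(5)])
    then have all: "mult_at f p \<le> 1 \<and> (0 < mult_at f p \<longrightarrow> Vertical \<notin> set p)" if "p \<noteq> []" for p
      using that tr by (cases p; cases "hd p") auto
    show ?thesis
    proof (intro exI[of _ "[]"] conjI allI impI)
      show "prefix p []" if "2 \<le> mult_at f p" for p using all[of p] that by (cases "p = []") auto
      show "Vertical \<notin> set p" if "0 < mult_at f p" for p using all[of p] that by (cases "p = []") auto
    qed (use True c(1) in \<open>auto simp: mult_at_Nil\<close>)
  next
    case False
    then obtain q where q: "length q + 1 = t" "Vertical \<notin> set q"
      "\<And>p. prefix p q \<Longrightarrow> mult_at (strict_transform (Slope c) f) p = 2"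
      "\<And>p. 2 \<le> mult_at (strict_transform (Slope c) f) p \<Longrightarrow> prefix p q"
      "\<And>p. 0 < mult_at (strict_transform (Slope c) f) p \<Longrightarrow> Vertical \<notin> set p"
      using Suc.IH[OF c(2)] by auto
    have off: "mult_at f (D # p) = 0" if "D \<noteq> Slope c" for D p
      unfolding mult_at_Cons
    proof (rule mult_at_unit_germ)
      show "unit_germ (strict_transform D f)"
        using that c(3,5) False \<open>\<gamma> \<noteq> 0\<close> by (cases D) (auto simp: power_0_left)
    qed
    show ?thesis
    proof (intro exI[of _ "Slope c # q"] conjI allI impI)
      show "mult_at f p = 2" if "prefix p (Slope c # q)" for p
        using that q(3) c(1) by (cases p) (auto simp: mult_at_Nil mult_at_Cons)
      show "prefix p (Slope c # q)" if "2 \<le> mult_at f p" for p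
      proof (cases p)
        case (Cons D p')
        then have "D = Slope c" using off that by fastforce
        then show ?thesis using that q(4) Cons by (simp add: mult_at_Cons)
      qed simp
      show "Vertical \<notin> set p" if "0 < mult_at f p" for p
      proof (cases p)
        case (Cons D p')
        then have "D = Slope c" using off that by fastforce
        then show ?thesis using that q(5) Cons by (simp add: mult_at_Cons)
      qed simp
    qed (use q in auto)
  qed
qed simp

lemma exc_without_vertical:
  "Vertical \<notin> set p \<Longrightarrow> fold exc_step p (ex, False) = (ex \<or> p \<noteq> [], False)"
proof (induction p arbitrary: ex)
  case (Cons D p)
  then show ?case by (cases D) auto
qed simp

lemma satellite_vertical: "satellite p \<Longrightarrow> Vertical \<in> set p"
  using exc_without_vertical[of p False] by (auto simp: satellite_def)

lemma is_tacnode_of_normal_form: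
  fixes f :: "'a::field_char_0 poly poly"
  assumes "normal_form (2 * t) t \<alpha> \<beta> \<gamma> f" "0 < t" "\<gamma> \<noteq> 0"
    and "\<And>v. \<alpha> + \<beta> * v + \<gamma> * v\<^sup>2 = 0 \<Longrightarrow> \<beta> + 2 * \<gamma> * v \<noteq> 0"
  shows "is_tacnode t f"
proof -
  obtain q where q: "length q + 1 = t" "Vertical \<notin> set q" "\<And>p. prefix p q \<Longrightarrow> mult_at f p = 2"
    "\<And>p. 2 \<le> mult_at f p \<Longrightarrow> prefix p q" "\<And>p. 0 < mult_at f p \<Longrightarrow> Vertical \<notin> set p"
    using normal_form_tacnode_points[OF assms] by blast
  have "singular_cluster f = {p. prefix p q}"
    unfolding singular_cluster_def using q(3,4,5) satellite_vertical by fastforce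
  moreover have "\<not> satellite p" if "prefix p q" for p
    using satellite_vertical[of p] that q(2) set_mono_prefix by blast
  ultimately show ?thesis unfolding is_tacnode_def using q(1,3) by blast
qed

text \<open>After n blow-ups the normal form is (1, 1): a smooth germ tangent to x = 0, whose next
  point is therefore \<open>Vertical\<close>. There its tangent is \<alpha> x + \<gamma> y = 0,
  different from both axes, so it continues with a nonzero slope and is transversal from then
  on.\<close>

lemma normal_form_cusp_points:
  fixes f :: "'a::field_char_0 poly poly"
  assumes "normal_form (2 * n + 1) (n + 1) \<alpha> \<beta> \<gamma> f" "\<alpha> \<noteq> 0" "\<gamma> \<noteq> 0"
  shows "\<exists>s. length s = n \<and> Vertical \<notin> set s \<and>
    (\<forall>p. prefix p (s @ [Vertical]) \<longrightarrow> mult_at f p = (if length p < n then 2 else 1)) \<and>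
    (\<forall>p. \<not> prefix p (s @ [Vertical]) \<longrightarrow> 0 < mult_at f p \<longrightarrow> mult_at f p = 1 \<and>
      (\<exists>c p'. p = s @ [Vertical, Slope c] @ p' \<and> c \<noteq> 0 \<and> Vertical \<notin> set p'))"
  using assms(1)
proof (induction n arbitrary: f)
  case 0
  then have nf: "normal_form (Suc 0) (Suc 0) \<alpha> \<beta> \<gamma> f" by simp
  have v: "eval2 f 0 0 = 0" "eval2 (pderiv f) 0 0 = 0" "eval2 (pdx f) 0 0 = \<alpha>" "coeff (coeff f 2) 0 = \<gamma>"
    using normal_form_values(1-3)[OF nf] normal_form_values(4)[OF nf, of 0] by simp_all
  have m: "mult0 f = 1" using v \<open>\<alpha> \<noteq> 0\<close> by (intro mult0_smooth_germ) auto
  have van: "coeff (coeff f j) i = 0" if "i + j < 1" for i j using v that by (simp add: coeff_0_0)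
  have "top_form 1 f = [:\<alpha>:]"
    by (rule poly_eqI) (use v in \<open>auto simp: coeff_top_form coeff_pCons coeff_0_1 coeff_1_0 split: nat.split\<close>)
  then have slope: "mult_at f (Slope c # p) = 0" for c p
    unfolding mult_at_Cons using strict_transform_slope(2)[OF m van, of c 0] \<open>\<alpha> \<noteq> 0\<close>
    by (intro mult_at_unit_germ) simp
  define g where "g = strict_transform Vertical f"
  note st = strict_transform_vertical[OF m van, folded g_def]
  have g: "eval2 g 0 0 = 0" "eval2 (pdx g) 0 0 = \<alpha>" "eval2 (pderiv g) 0 0 = \<gamma>"
    using st[of 0 0] st[of 0 "Suc 0"] st[of "Suc 0" 0] v
    by (simp_all add: coeff_0_0 coeff_0_1 coeff_1_0 numeral_2_eq_2)
  have mg: "mult0 g = 1" using g \<open>\<alpha> \<noteq> 0\<close> by (intro mult0_smooth_germ) auto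
  have vang: "coeff (coeff g j) i = 0" if "i + j < 1" for i j using g that by (simp add: coeff_0_0)
  have topg: "top_form 1 g = [:\<alpha>, \<gamma>:]"
    by (rule poly_eqI) (use g in \<open>auto simp: coeff_top_form coeff_pCons coeff_0_1 coeff_1_0 split: nat.split\<close>)
  note sg = strict_transform_slope(2,3)[OF mg vang, unfolded topg]
  have gV: "mult_at g (Vertical # p) = 0" for p
  proof -
    have "coeff (coeff (strict_transform Vertical g) 0) 0 = coeff (coeff g (Suc 0)) 0"
      by (subst strict_transform_vertical[OF mg vang]) simp_all
    then show ?thesis unfolding mult_at_Cons using g \<open>\<gamma> \<noteq> 0\<close>
      by (intro mult_at_unit_germ) (simp add: coeff_0_0 coeff_1_0)
  qed
  have gS: "mult_at g (Slope c # p) \<le> 1 \<and> (0 < mult_at g (Slope c # p) \<longrightarrow> c \<noteq> 0 \<and> Vertical \<notin> set p)" for c p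
  proof -
    have "mult_at (strict_transform (Slope c) g) p \<le> 1 \<and> (0 < mult_at (strict_transform (Slope c) g) p \<longrightarrow> Vertical \<notin> set p)"
      using sg(2)[of c 0] \<open>\<gamma> \<noteq> 0\<close> by (intro mult_at_transversal) (simp add: pderiv_pCons)
    moreover have "mult_at (strict_transform (Slope 0) g) p = 0"
      using sg(1)[of 0 0] \<open>\<alpha> \<noteq> 0\<close> by (intro mult_at_unit_germ) simp
    ultimately show ?thesis by (auto simp: mult_at_Cons)
  qed
  show ?case
  proof (intro exI[of _ "[]"] conjI allI impI)
    show "mult_at f p = (if length p < 0 then 2 else 1)" if "prefix p ([] @ [Vertical])" for p
      using that m mg by (cases p) (auto simp: mult_at_Nil mult_at_Cons g_def)
    fix p assume p: "\<not> prefix p ([] @ [Vertical])" "0 < mult_at f p"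
    then obtain D p1 where "p = D # p1" by (cases p) auto
    moreover have "D = Vertical" using p slope \<open>p = D # p1\<close> by (cases D) auto
    ultimately obtain D' p' where p': "p = Vertical # D' # p'" using p by (cases p1) auto
    then have "0 < mult_at g (D' # p')" using p by (simp add: mult_at_Cons g_def)
    moreover from this obtain c where "D' = Slope c" using gV by (cases D') auto
    ultimately have "mult_at g (D' # p') = 1" "c \<noteq> 0 \<and> Vertical \<notin> set p'" using gS[of c p'] by auto
    then show "mult_at f p = 1" "\<exists>c p'. p = [] @ [Vertical, Slope c] @ p' \<and> c \<noteq> 0 \<and> Vertical \<notin> set p'"
      using p' \<open>D' = Slope c\<close> by (auto simp: mult_at_Cons g_def)
  qed auto
next
  case (Suc n)
  have "normal_form (Suc (Suc (2 * n + 1))) (Suc (n + 1)) \<alpha> \<beta> \<gamma> f" using Suc.prems by simp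
  then obtain c where c: "mult0 f = 2" "normal_form (2 * n + 1) (n + 1) \<alpha> \<beta> \<gamma> (strict_transform (Slope c) f)"
    "\<And>c'. eval2 (strict_transform (Slope c') f) 0 0 = \<alpha> * 0 ^ (2 * n + 1) + \<beta> * 0 ^ (n + 1) * (c' - c) + \<gamma> * (c' - c)\<^sup>2"
    "unit_germ (strict_transform Vertical f)"
    using normal_form_blow_up[OF _ \<open>\<gamma> \<noteq> 0\<close>] by metis
  have off: "mult_at f (D # p) = 0" if "D \<noteq> Slope c" for D p
    unfolding mult_at_Cons
  proof (rule mult_at_unit_germ)
    show "unit_germ (strict_transform D f)"
      using that c(3,4) \<open>\<gamma> \<noteq> 0\<close> by (cases D) auto
  qed
  obtain s where s: "length s = n" "Vertical \<notin> set s"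
    "\<And>p. prefix p (s @ [Vertical]) \<Longrightarrow> mult_at (strict_transform (Slope c) f) p = (if length p < n then 2 else 1)"
    "\<And>p. \<not> prefix p (s @ [Vertical]) \<Longrightarrow> 0 < mult_at (strict_transform (Slope c) f) p \<Longrightarrow>
      mult_at (strict_transform (Slope c) f) p = 1 \<and>
      (\<exists>c p'. p = s @ [Vertical, Slope c] @ p' \<and> c \<noteq> 0 \<and> Vertical \<notin> set p')"
    using Suc.IH[OF c(2)] by blast
  show ?case
  proof (intro exI[of _ "Slope c # s"] conjI allI impI)
    show "mult_at f p = (if length p < Suc n then 2 else 1)" if "prefix p ((Slope c # s) @ [Vertical])" for p
      using that s(3) c(1) by (cases p) (auto simp: mult_at_Nil mult_at_Cons)
    fix p assume p: "\<not> prefix p ((Slope c # s) @ [Vertical])" "0 < mult_at f p"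
    then obtain D p1 where p1: "p = D # p1" by (cases p) auto
    then have D: "D = Slope c" using p off by fastforce
    have "mult_at (strict_transform (Slope c) f) p1 = 1 \<and> (\<exists>c p'. p1 = s @ [Vertical, Slope c] @ p' \<and> c \<noteq> 0 \<and> Vertical \<notin> set p')"
      using s(4)[of p1] p unfolding p1 D by (simp add: mult_at_Cons)
    then show "mult_at f p = 1" "\<exists>c' p'. p = (Slope c # s) @ [Vertical, Slope c'] @ p' \<and> c' \<noteq> 0 \<and> Vertical \<notin> set p'"
      unfolding p1 D by (simp_all add: mult_at_Cons)
  qed (use s in auto)
qed

lemma is_cusp_of_normal_form:
  fixes f :: "'a::field_char_0 poly poly"
  assumes "normal_form (2 * n + 1) (n + 1) \<alpha> \<beta> \<gamma> f" "0 < n" "\<alpha> \<noteq> 0" "\<gamma> \<noteq> 0"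
  shows "is_cusp n f"
proof -
  obtain s where s: "length s = n" "Vertical \<notin> set s"
    "\<And>p. prefix p (s @ [Vertical]) \<Longrightarrow> mult_at f p = (if length p < n then 2 else 1)"
    "\<And>p. \<not> prefix p (s @ [Vertical]) \<Longrightarrow> 0 < mult_at f p \<Longrightarrow> mult_at f p = 1 \<and>
      (\<exists>c p'. p = s @ [Vertical, Slope c] @ p' \<and> c \<noteq> 0 \<and> Vertical \<notin> set p')"
    using normal_form_cusp_points[OF assms(1,3,4)] by blast
  define q where "q = s @ [Vertical]"
  have exc_s: "fold exc_step s (False, False) = (True, False)"
    using exc_without_vertical[OF s(2), of False] s(1) assms(2) by auto
  then have sat_q: "satellite q" by (simp add: satellite_def q_def)
  have sat: "satellite p \<longleftrightarrow> p = q" if "prefix p q" for p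
  proof
    assume "satellite p"
    then have "Vertical \<in> set p" by (rule satellite_vertical)
    show "p = q"
    proof (rule ccontr)
      assume "p \<noteq> q"
      then have "prefix p s" using that by (auto simp: q_def)
      then show False using \<open>Vertical \<in> set p\<close> s(2) set_mono_prefix by blast
    qed
  qed (use sat_q in simp)
  have not_sat: "\<not> satellite p" if off: "\<not> prefix p q" "0 < mult_at f p" for p
  proof -
    obtain c p' where p: "p = s @ [Vertical, Slope c] @ p'" "c \<noteq> 0" "Vertical \<notin> set p'"
      using s(4)[of p] off by (auto simp: q_def)
    \<comment> \<open>A nonzero slope after the satellite leaves the exceptional component y = 0, so
      the second flag is cleared and stays cleared.\<close>
    have "fold exc_step p (False, False) = (True, False)"
      using exc_without_vertical[OF p(3), of True] by (simp add: p exc_s)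
    then show ?thesis by (simp add: satellite_def)
  qed
  have "singular_cluster f = {p. prefix p q}"
  proof (intro equalityI subsetI)
    fix p assume "p \<in> singular_cluster f"
    then consider "2 \<le> mult_at f p" | q' where "prefix p q'" "satellite q'" "1 \<le> mult_at f q'"
      by (auto simp: singular_cluster_def)
    then show "p \<in> {p. prefix p q}"
    proof cases
      case 1 then show ?thesis using s(4)[of p] by (force simp: q_def)
    next
      case 2 then show ?thesis using not_sat[of q'] prefix_order.trans by fastforce
    qed
  next
    fix p assume "p \<in> {p. prefix p q}"
    moreover have "1 \<le> mult_at f q" using s(3)[of q] by (simp add: q_def)
    ultimately show "p \<in> singular_cluster f" using sat_q by (auto simp: singular_cluster_def)
  qed
  then show ?thesis unfolding is_cusp_def
    using s(1,3) sat by (intro exI[of _ q]) (auto simp: q_def)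
qed

section \<open>Homogenization\<close>

lemma slice_form:
  assumes "degree U \<le> e"
  shows "slice 1 (form e U) = U"
  using assms by (intro poly_eqI) (auto simp: coeff_slice coeff_form poly_monom coeff_eq_0)

lemma pderiv_form:
  fixes U :: "'a::field_char_0 poly"
  assumes "degree U \<le> e"
  shows "pderiv (form e U) = form (e - 1) (pderiv U)"
proof (rule poly_eqI)
  fix j
  show "coeff (pderiv (form e U)) j = coeff (form (e - 1) (pderiv U)) j"
    using coeff_eq_0[of U "Suc j"] assms
    by (cases "Suc j \<le> e") (auto simp: coeff_pderiv coeff_form of_nat_poly smult_monom)
qed

lemma eval2_sum: "eval2 (sum h A) a b = (\<Sum>j\<in>A. eval2 (h j) a b)"
  by (induction A rule: infinite_finite_induct) auto

lemma eval2_monom: "eval2 (monom c j) a b = poly c a * b ^ j"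
  by (simp add: eval2_def poly_monom)

lemma eval2_form: "eval2 (form e U) a b = (\<Sum>j\<le>e. coeff U j * a ^ (e - j) * b ^ j)"
  unfolding form_def eval2_sum by (simp add: eval2_monom poly_monom)

lemma eval2_form_scale: "eval2 (form e U) (s * a) (s * b) = s ^ e * eval2 (form e U) a b"
proof -
  have "(s * a) ^ (e - j) * (s * b) ^ j = s ^ e * (a ^ (e - j) * b ^ j)" if "j \<le> e" for j
  proof -
    have "s ^ e = s ^ (e - j) * s ^ j" using that by (simp flip: power_add)
    then show ?thesis by (simp add: power_mult_distrib)
  qed
  then show ?thesis unfolding eval2_form sum_distrib_left by (intro sum.cong) (auto simp: algebra_simps)
qed

lemma euler_identity:
  fixes U :: "'a::field poly"
  shows "a * eval2 (pdx (form e U)) a b + b * eval2 (pderiv (form e U)) a b = of_nat e * eval2 (form e U) a b"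
proof -
  have 1: "pdx (form e U) = (\<Sum>j\<le>e. monom (pderiv (monom (coeff U j) (e - j))) j)"
  proof -
    have "pdx (sum h A) = (\<Sum>j\<in>A. pdx (h j))" for h :: "nat \<Rightarrow> 'a poly poly" and A
      by (induction A rule: infinite_finite_induct) (auto simp: pdx_add)
    then show ?thesis by (simp add: form_def map_poly_monom)
  qed
  have 2: "pderiv (form e U) = (\<Sum>j\<le>e. pderiv (monom (monom (coeff U j) (e - j)) j))"
  proof -
    have "pderiv (sum h A) = (\<Sum>j\<in>A. pderiv (h j))" for h :: "nat \<Rightarrow> 'a poly poly" and A
      by (induction A rule: infinite_finite_induct) (auto simp: pderiv_add)
    then show ?thesis by (simp add: form_def)
  qed
  have "a * (poly (pderiv (monom c i)) a * b ^ j) + b * eval2 (pderiv (monom (monom c i) j)) a b = of_nat (i + j) * (c * a ^ i * b ^ j)"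
    for c i j
    by (cases i; cases j) (simp_all add: pderiv_monom eval2_monom poly_monom of_nat_poly algebra_simps)
  from this[of "coeff U _" "e - _" _] show ?thesis
    unfolding 1 2 eval2_sum eval2_form sum_distrib_left sum.distrib[symmetric]
    by (intro sum.cong) (auto simp: eval2_monom)
qed

section \<open>Substitution and the chain rule\<close>

lemma subst2_pCons: "subst2 (pCons c g) X Y = poly (map_poly const2 c) X + Y * subst2 g X Y"
  by (simp add: subst2_def map_poly_pCons)

lemma subst2_0: "subst2 0 X Y = 0"
  by (simp add: subst2_def)

lemma subst2_add: "subst2 (f + g) X Y = subst2 f X Y + subst2 g X Y"
proof -
  have "poly (map_poly const2 (p + q)) X = poly (map_poly const2 p) X + poly (map_poly const2 q) X" for p q :: "'a poly"
    by (subst map_poly_hom_add) simp_all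
  then show ?thesis unfolding subst2_def by (subst map_poly_hom_add) simp_all
qed

lemma eval2_subst2: "eval2 (subst2 g X Y) s t = eval2 g (eval2 X s t) (eval2 Y s t)"
proof -
  have "eval2 (poly (map_poly const2 c) X) s t = poly c (eval2 X s t)" for c :: "'a poly"
    by (induction c) (auto simp: map_poly_pCons)
  then show ?thesis by (induction g) (auto simp: subst2_0 subst2_pCons)
qed

lemma pdx_subst2: "pdx (subst2 g X Y) = subst2 (pdx g) X Y * pdx X + subst2 (pderiv g) X Y * pdx Y"
proof -
  have c: "pdx (poly (map_poly const2 c) X) = poly (map_poly const2 (pderiv c)) X * pdx X" for c :: "'a poly"
  proof (induction c)
    case (pCons s c)
    have "map_poly const2 (c + pCons 0 (pderiv c)) = map_poly const2 c + pCons 0 (map_poly const2 (pderiv c))"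
      by (subst map_poly_hom_add) (simp_all add: map_poly_pCons)
    then show ?case using pCons by (simp add: map_poly_pCons pdx_add pdx_mult pderiv_pCons algebra_simps)
  qed simp
  show ?thesis
  proof (induction g)
    case (pCons c g)
    have "pdx (subst2 (pCons c g) X Y) = poly (map_poly const2 (pderiv c)) X * pdx X
        + (Y * (subst2 (pdx g) X Y * pdx X + subst2 (pderiv g) X Y * pdx Y) + subst2 g X Y * pdx Y)"
      by (simp only: subst2_pCons pdx_add pdx_mult c pCons.IH)
    then show ?case by (simp add: subst2_pCons map_poly_pCons pderiv_pCons subst2_add algebra_simps)
  qed (simp add: subst2_0)
qed

lemma pderiv_subst2: "pderiv (subst2 g X Y) = subst2 (pdx g) X Y * pderiv X + subst2 (pderiv g) X Y * pderiv Y"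
proof -
  have c: "pderiv (poly (map_poly const2 c) X) = poly (map_poly const2 (pderiv c)) X * pderiv X" for c :: "'a poly"
  proof (induction c)
    case (pCons s c)
    have "map_poly const2 (c + pCons 0 (pderiv c)) = map_poly const2 c + pCons 0 (map_poly const2 (pderiv c))"
      by (subst map_poly_hom_add) (simp_all add: map_poly_pCons)
    then show ?case using pCons by (simp add: map_poly_pCons pderiv_add pderiv_mult pderiv_pCons algebra_simps)
  qed simp
  show ?thesis
  proof (induction g)
    case (pCons c g)
    have "pderiv (subst2 (pCons c g) X Y) = poly (map_poly const2 (pderiv c)) X * pderiv X
        + (Y * (subst2 (pdx g) X Y * pderiv X + subst2 (pderiv g) X Y * pderiv Y) + subst2 g X Y * pderiv Y)"
      by (simp only: subst2_pCons pderiv_add pderiv_mult c pCons.IH)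
    then show ?case by (simp add: subst2_pCons map_poly_pCons pderiv_pCons subst2_add algebra_simps)
  qed (simp add: subst2_0)
qed

lemma subst3_pCons: "subst3 (pCons g F) X Y Z = subst2 g X Y + Z * subst3 F X Y Z"
  by (simp add: subst3_def map_poly_pCons subst2_0)

lemma subst3_1: "subst3 F X Y 1 = subst2 (poly F 1) X Y"
proof (induction F)
  case 0
  then show ?case by (simp add: subst3_def subst2_0)
next
  case (pCons g F)
  then show ?case by (simp add: subst3_pCons subst2_add)
qed

lemma pdx_1: "pdx (1 :: 'a::field poly poly) = 0"
  by (simp add: one_pCons map_poly_pCons)

lemma eval2_subst3_vary:
  "eval2 (subst3 F X Y vary) s 0 = eval2 (subst2 (coeff F 0) X Y) s 0"
  "eval2 (pdx (subst3 F X Y vary)) s 0 = eval2 (pdx (subst2 (coeff F 0) X Y)) s 0"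
  by (cases F; simp add: subst3_pCons pdx_add pdx_mult map_poly_pCons)+

definition homogenize :: "nat \<Rightarrow> 'a::field poly poly \<Rightarrow> 'a poly poly poly" where
  "homogenize d f = (\<Sum>l\<le>d. monom (form (d - l) (top_form (d - l) f)) l)"

lemma coeff_homogenize: "coeff (homogenize d f) l = (if l \<le> d then form (d - l) (top_form (d - l) f) else 0)"
proof -
  have "coeff (homogenize d f) l = (\<Sum>i\<le>d. if i = l then form (d - i) (top_form (d - i) f) else 0)"
    unfolding homogenize_def coeff_sum coeff_monom by simp
  also have "\<dots> = (if l \<le> d then form (d - l) (top_form (d - l) f) else 0)" by simp
  finally show ?thesis .
qed

lemma coeff3_homogenize:
  "coeff (coeff (coeff (homogenize d f) l) j) i = (if i + j + l = d then coeff (coeff f j) i else 0)"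
  by (auto simp: coeff_homogenize coeff_form coeff_top_form)

lemma homogeneous_homogenize: "homogeneous d (homogenize d f)"
  by (simp add: homogeneous_def coeff3_homogenize)

lemma poly_homogenize:
  assumes "tdeg_le d f"
  shows "poly (homogenize d f) 1 = f"
proof (rule poly_eqI, rule poly_eqI)
  fix j i
  have "poly (homogenize d f) 1 = (\<Sum>l\<le>d. coeff (homogenize d f) l)"
    by (simp add: homogenize_def poly_sum poly_monom coeff_homogenize[unfolded homogenize_def])
  then have "coeff (coeff (poly (homogenize d f) 1) j) i = (\<Sum>l\<le>d. if i + j + l = d then coeff (coeff f j) i else 0)"
    by (simp add: coeff_sum coeff3_homogenize)
  also have "\<dots> = coeff (coeff f j) i"
  proof (cases "i + j \<le> d")
    case True
    then have "(\<Sum>l\<le>d. if i + j + l = d then coeff (coeff f j) i else 0) = (\<Sum>l\<le>d. if l = d - i - j then coeff (coeff f j) i else 0)"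
      by (intro sum.cong) auto
    then show ?thesis using True by simp
  next
    case False
    then have 0: "coeff (coeff f j) i = 0" using tdeg_leD[OF assms] by simp
    show ?thesis unfolding 0 by (intro sum.neutral) simp
  qed
  finally show "coeff (coeff (poly (homogenize d f) 1) j) i = coeff (coeff f j) i" .
qed

text \<open>\<open>dilate A\<close> is \<open>A(\<lambda>x, \<lambda>y, \<lambda>)\<close> as a polynomial in \<open>\<lambda>\<close>, so that its degree is the total degree of \<open>A\<close>.\<close>

definition dilate1 :: "'a::field poly \<Rightarrow> 'a poly poly poly" where
  "dilate1 c = poly (map_poly (\<lambda>s. [:const2 s:]) c) [:0, varx:]"
definition dilate2 :: "'a::field poly poly \<Rightarrow> 'a poly poly poly" where
  "dilate2 g = poly (map_poly dilate1 g) [:0, vary:]"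
definition dilate :: "'a::field poly poly poly \<Rightarrow> 'a poly poly poly" where
  "dilate A = poly (map_poly dilate2 A) [:0, 1:]"

lemma dilate1_hom: "dilate1 0 = 0" "dilate1 (p + q) = dilate1 p + dilate1 q" "dilate1 (p * q) = dilate1 p * dilate1 q"
  unfolding dilate1_def by (simp, subst map_poly_hom_add, simp_all, subst map_poly_hom_mult, simp_all)

lemma dilate2_hom: "dilate2 0 = 0" "dilate2 (p + q) = dilate2 p + dilate2 q" "dilate2 (p * q) = dilate2 p * dilate2 q"
  unfolding dilate2_def
  by (simp, subst map_poly_hom_add, simp_all add: dilate1_hom, subst map_poly_hom_mult, simp_all add: dilate1_hom)

lemma dilate_mult: "dilate (A * B) = dilate A * dilate B"
  unfolding dilate_def by (subst map_poly_hom_mult) (simp_all add: dilate2_hom)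

lemma coeff_dilate1: "coeff (coeff (coeff (dilate1 c) N) j) i = (if j = 0 \<and> i = N then coeff c i else 0)"
proof (induction c arbitrary: N i)
  case (pCons s c)
  have "dilate1 (pCons s c) = [:const2 s:] + [:0, varx:] * dilate1 c"
    by (simp add: dilate1_def map_poly_pCons)
  then show ?case using pCons.IH[of "N - 1" "i - 1"]
    by (cases N; cases i; cases j) (simp_all add: coeff_pCons)
qed (simp add: dilate1_hom)

lemma coeff_dilate2: "coeff (coeff (coeff (dilate2 g) N) j) i = (if i + j = N then coeff (coeff g j) i else 0)"
proof (induction g arbitrary: N j)
  case (pCons c g)
  have "dilate2 (pCons c g) = dilate1 c + [:0, vary:] * dilate2 g"
    by (simp add: dilate2_def map_poly_pCons dilate1_hom)
  then show ?case using pCons.IH[of "N - 1" "j - 1"]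
    by (cases N; cases j) (auto simp: coeff_pCons coeff_dilate1)
qed (simp add: dilate2_hom)

lemma coeff_dilate:
  "coeff (coeff (coeff (dilate A) N) j) i = (if i + j \<le> N then coeff (coeff (coeff A (N - i - j)) j) i else 0)"
proof (induction A arbitrary: N)
  case 0
  then show ?case by (simp add: dilate_def)
next
  case (pCons g A)
  have "dilate (pCons g A) = dilate2 g + [:0, 1:] * dilate A"
    by (simp add: dilate_def map_poly_pCons dilate2_hom)
  then have eq: "coeff (dilate (pCons g A)) N = coeff (dilate2 g) N + (case N of 0 \<Rightarrow> 0 | Suc k \<Rightarrow> coeff (dilate A) k)"
    by (simp add: coeff_pCons)
  show ?case
  proof (cases N)
    case 0
    then show ?thesis unfolding eq by (auto simp: coeff_dilate2)
  next
    case (Suc k)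
    have IH: "coeff (coeff (coeff (dilate A) k) j) i = (if i + j \<le> k then coeff (coeff (coeff A (k - i - j)) j) i else 0)"
      by (rule pCons.IH)
    consider "i + j \<le> k" | "i + j = Suc k" | "Suc k < i + j" by linarith
    then show ?thesis
    proof cases
      case 1
      then have "Suc k - i - j = Suc (k - i - j)" by linarith
      with 1 show ?thesis unfolding Suc eq[unfolded Suc] by (simp add: coeff_dilate2 IH)
    next
      case 2
      then have "Suc k - i - j = 0" by linarith
      with 2 show ?thesis unfolding Suc eq[unfolded Suc] by (simp add: coeff_dilate2 IH)
    next
      case 3
      then show ?thesis unfolding Suc eq[unfolded Suc] by (simp add: coeff_dilate2 IH)
    qed
  qed
qed

lemma coeff_le_degree_dilate:
  assumes "coeff (coeff (coeff A l) j) i \<noteq> 0"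
  shows "i + j + l \<le> degree (dilate A)"
proof (rule le_degree)
  have "coeff (coeff (coeff (dilate A) (i + j + l)) j) i \<noteq> 0" using assms by (simp add: coeff_dilate)
  then show "coeff (dilate A) (i + j + l) \<noteq> 0" by auto
qed

lemma tdeg_le_dehomogenize: "tdeg_le (degree (dilate A)) (poly A 1)"
proof -
  have "poly A 1 = (\<Sum>l\<le>degree A. coeff A l)" by (simp add: poly_altdef)
  moreover have "tdeg_le (degree (dilate A)) (coeff A l)" for l
    using coeff_le_degree_dilate[of A l] unfolding tdeg_le_def by fastforce
  ultimately show ?thesis by (simp add: tdeg_le_sum)
qed

text \<open>A factorization dehomogenizes to one of f, so one factor becomes constant at z = 1. The
  other then has total degree at least d; \<open>dilate\<close> makes total degree additive, which
  leaves the first factor constant. This also rules out a factor z.\<close>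

lemma irreducible_homogenize:
  assumes irr: "irreducible f" and f: "tdeg_le d f" "top_form d f \<noteq> 0"
  shows "irreducible (homogenize d f)"
proof (rule irreducibleI)
  let ?F = "homogenize d f"
  have F1: "poly ?F 1 = f" using f(1) by (rule poly_homogenize)
  have "f \<noteq> 0" "\<not> is_unit f" using irr by (auto simp: irreducible_def)
  then show "?F \<noteq> 0" using F1 by auto
  have hom: "is_unit (poly A 1)" if A: "is_unit A" for A :: "'a poly poly poly"
  proof -
    obtain B where "1 = A * B" using A by blast
    then have "1 = poly A 1 * poly B 1" by (metis poly_1 poly_mult)
    then show ?thesis by (rule dvdI)
  qed
  show "\<not> is_unit ?F" using hom[of ?F] F1 \<open>\<not> is_unit f\<close> by auto
  have degF: "degree (dilate ?F) \<le> d"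
  proof (rule degree_le, intro allI impI poly_eqI)
    fix N j i assume "d < N"
    then show "coeff (coeff (coeff (dilate ?F) N) j) i = coeff (coeff 0 j) i"
      by (simp add: coeff_dilate coeff3_homogenize)
  qed
  have main: "is_unit A" if AB: "?F = A * B" and u: "is_unit (poly A 1)" for A B
  proof -
    have nz: "A \<noteq> 0" "B \<noteq> 0" using AB \<open>?F \<noteq> 0\<close> by auto
    have dnz: "dilate C \<noteq> 0" if C: "C \<noteq> 0" for C :: "'a poly poly poly"
    proof
      assume "dilate C = 0"
      obtain l where "coeff C l \<noteq> 0" using C by (metis leading_coeff_0_iff)
      then obtain j where "coeff (coeff C l) j \<noteq> 0" by (metis leading_coeff_0_iff)
      then obtain i where "coeff (coeff (coeff C l) j) i \<noteq> 0" by (metis leading_coeff_0_iff)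
      then have "coeff (coeff (coeff (dilate C) (i + j + l)) j) i \<noteq> 0" by (simp add: coeff_dilate)
      with \<open>dilate C = 0\<close> show False by simp
    qed
    have deg: "degree (dilate A) + degree (dilate B) \<le> d"
      using degF dnz[OF nz(1)] dnz[OF nz(2)] by (simp add: AB dilate_mult degree_mult_eq)
    obtain s where s: "poly A 1 = [:[:s:]:]" "s \<noteq> 0" using u by (auto simp: is_unit_poly_iff dvd_field_iff)
    have "f = smult [:s:] (poly B 1)" using F1 AB s by simp
    then have "tdeg_le (degree (dilate B)) f" using tdeg_le_dehomogenize[of B] by (simp add: tdeg_le_smult)
    then have "d \<le> degree (dilate B)" using f(2) top_form_0[of _ f d] by (meson not_le)
    with deg have "degree (dilate A) = 0" by simp
    then have 0: "i = 0 \<and> j = 0 \<and> l = 0" if "coeff (coeff (coeff A l) j) i \<noteq> 0" for i j l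
      using coeff_le_degree_dilate[OF that] by simp
    have "A = [:[:[:coeff (coeff (coeff A 0) 0) 0:]:]:]"
      by (intro poly_eqI) (use 0 in \<open>auto simp: coeff_pCons split: nat.split\<close>)
    then obtain c where c: "A = [:[:[:c:]:]:]" by blast
    then have "c \<noteq> 0" using nz by auto
    then have "1 = A * [:[:[:1 / c:]:]:]" by (simp add: c one_pCons)
    then show ?thesis by (rule dvdI)
  qed
  fix A B assume AB: "?F = A * B"
  then have "f = poly A 1 * poly B 1" using F1 by simp
  then have "is_unit (poly A 1) \<or> is_unit (poly B 1)" using irr irreducibleD by blast
  then show "is_unit A \<or> is_unit B" using main[of A B] main[of B A] AB by (auto simp: mult.commute)
qed

section \<open>Local equations, and the points at infinity\<close>

lemma local_eq_affine:
  assumes "tdeg_le d f"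
  shows "local_eq (homogenize d f) (a, b, 1) = subst2 f (varx + const2 a) (vary + const2 b)"
  by (simp add: subst3_1 poly_homogenize[OF assms])

lemma eval2_affine_germ:
  "eval2 (subst2 f (varx + const2 a) (vary + const2 b)) 0 0 = eval2 f a b"
  "eval2 (pdx (subst2 f (varx + const2 a) (vary + const2 b))) 0 0 = eval2 (pdx f) a b"
  "eval2 (pderiv (subst2 f (varx + const2 a) (vary + const2 b))) 0 0 = eval2 (pderiv f) a b"
  by (simp_all add: eval2_subst2 pdx_subst2 pderiv_subst2 map_poly_pCons pderiv_pCons)

lemma singular_germ:
  assumes "2 \<le> mult0 f"
  shows "eval2 f 0 0 = 0" "eval2 (pdx f) 0 0 = 0" "eval2 (pderiv f) 0 0 = 0"
proof -
  show 0: "eval2 f 0 0 = 0" using mult0_unit_germ[of f] assms by (cases "eval2 f 0 0 = 0") auto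
  show "eval2 (pdx f) 0 0 = 0" "eval2 (pderiv f) 0 0 = 0"
    using mult0_smooth_germ[OF 0] assms by fastforce+
qed

text \<open>On z = 0 the local equation is the leading form. At a singular point (a, 1, 0) its value
  and x-derivative vanish, and Euler's identity adds the y-derivative. For a \<noteq> 0 rescaling
  yields a double root 1/a; for a = 0 the value is the coefficient of y^d.\<close>

lemma smooth_at_infinity:
  fixes f :: "'a::field_char_0 poly poly"
  assumes d: "0 < d" and lc: "coeff (top_form d f) d \<noteq> 0"
    and simple: "\<And>y. poly (top_form d f) y = 0 \<Longrightarrow> poly (pderiv (top_form d f)) y \<noteq> 0"
  shows "mult0 (local_eq (homogenize d f) (a, 1, 0)) < 2" "mult0 (local_eq (homogenize d f) (1, 0, 0)) < 2"
proof -
  let ?U = "top_form d f"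
  have F0: "coeff (homogenize d f) 0 = form d ?U" by (simp add: coeff_homogenize)
  have U: "eval2 (form d ?U) 1 b = poly ?U b" "eval2 (pderiv (form d ?U)) 1 b = poly (pderiv ?U) b" for b
    by (simp_all add: poly_slice[symmetric] pderiv_slice[symmetric] slice_form degree_top_form)
  show "mult0 (local_eq (homogenize d f) (a, 1, 0)) < 2"
  proof (rule ccontr)
    assume "\<not> ?thesis"
    then have "2 \<le> mult0 (subst3 (homogenize d f) (varx + const2 a) 1 vary)" by simp
    from singular_germ[OF this] have z: "eval2 (form d ?U) a 1 = 0" "eval2 (pdx (form d ?U)) a 1 = 0"
      by (simp_all add: eval2_subst3_vary F0 eval2_subst2 pdx_subst2 map_poly_pCons pderiv_pCons pdx_1)
    then have z': "eval2 (pderiv (form d ?U)) a 1 = 0" using euler_identity[of a d ?U 1] by simp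
    show False
    proof (cases "a = 0")
      case True
      have "eval2 (form d ?U) 0 1 = (\<Sum>j\<le>d. if j = d then coeff ?U j else 0)"
        unfolding eval2_form by (intro sum.cong) (auto simp: power_0_left)
      with z(1) lc True show False by simp
    next
      case False
      have "a ^ d * poly ?U (1 / a) = 0" using z(1) eval2_form_scale[of d ?U a 1 "1 / a"] U(1) False by simp
      moreover have "a ^ (d - 1) * poly (pderiv ?U) (1 / a) = 0"
        using z' eval2_form_scale[of "d - 1" "pderiv ?U" a 1 "1 / a"] U(2) False
        by (simp add: pderiv_form degree_top_form)
      ultimately show False using simple False by auto
    qed
  qed
  show "mult0 (local_eq (homogenize d f) (1, 0, 0)) < 2"
  proof (rule ccontr)
    assume "\<not> ?thesis"
    then have "2 \<le> mult0 (subst3 (homogenize d f) 1 varx vary)" by simp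
    from singular_germ[OF this] have "poly ?U 0 = 0" "poly (pderiv ?U) 0 = 0"
      by (simp_all add: eval2_subst3_vary F0 eval2_subst2 pdx_subst2 map_poly_pCons pderiv_pCons pdx_1 U)
    with simple show False by blast
  qed
qed

lemma poly_affine_germ:
  "poly (subst2 f (varx + const2 a) (vary + const2 b)) (pcompose \<psi> [:a, 1:] - [:b:]) = pcompose (poly f \<psi>) [:a, 1:]"
proof (induction f)
  case (pCons c f)
  have "poly (poly (map_poly const2 c) (varx + const2 a)) \<phi> = pcompose c [:a, 1:]" for \<phi> and c :: "'a poly"
    by (induction c) (auto simp: map_poly_pCons pcompose_pCons)
  with pCons show ?case by (simp add: subst2_pCons pcompose_add pcompose_mult algebra_simps)
qed (simp add: subst2_0)

context scheme
begin

lemma normal_form_at: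
  assumes f: "inI f" and j: "j < n"
  shows "normal_form (m j) (r j) (cA j f) (cB j f) (cC j f) (subst2 f (varx + const2 (x j)) (vary + const2 (poly \<psi> (x j))))"
proof -
  obtain q0 q1 where q: "poly f \<psi> = X j ^ m j * q0" "poly (pderiv f) \<psi> = X j ^ r j * q1"
    "cA j f = poly q0 (x j)" "cB j f = poly q1 (x j)" using inI_at[OF f j] by metis
  define \<phi> where "\<phi> = pcompose \<psi> [:x j, 1:] - [:poly \<psi> (x j):]"
  define G where "G = (\<lambda>f. subst2 f (varx + const2 (x j)) (vary + const2 (poly \<psi> (x j))))"
  have G: "poly (G h) \<phi> = pcompose (poly h \<psi>) [:x j, 1:]" for h
    unfolding G_def \<phi>_def by (rule poly_affine_germ)
  have dG: "pderiv (G h) = G (pderiv h)" for h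
    by (simp add: G_def pderiv_subst2 pderiv_pCons)
  have lin: "pcompose (X j ^ k * p) [:x j, 1:] = [:0, 1:] ^ k * pcompose p [:x j, 1:]" for k p
  proof -
    have "pcompose (X j ^ k) [:x j, 1:] = [:0, 1:] ^ k"
    proof (induction k)
      case (Suc k)
      have "pcompose (X j) [:x j, 1:] = [:0, 1:]" by (simp add: pcompose_pCons)
      with Suc show ?case by (simp only: power_Suc pcompose_mult)
    qed (simp add: pcompose_1)
    then show ?thesis by (simp only: pcompose_mult)
  qed
  have "poly \<phi> 0 = 0" by (simp add: \<phi>_def poly_pcompose)
  moreover have "poly (G f) \<phi> = [:0, 1:] ^ m j * pcompose q0 [:x j, 1:]" by (simp only: G q lin)
  moreover have "poly (pderiv (G f)) \<phi> = [:0, 1:] ^ r j * pcompose q1 [:x j, 1:]" by (simp only: dG G q lin)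
  moreover have "poly (poly (pderiv (pderiv (G f))) \<phi>) 0 = 2 * cC j f"
    by (simp add: dG G poly_pcompose cC_def)
  moreover have "poly (pcompose p [:x j, 1:]) 0 = poly p (x j)" for p by (simp add: poly_pcompose)
  ultimately have "normal_form (m j) (r j) (cA j f) (cB j f) (cC j f) (G f)"
    unfolding normal_form_def q(3,4) by blast
  then show ?thesis by (simp only: G_def)
qed

theorem exists_curve:
  assumes low: "interp (d - 3) \<psi> g 1"
  defines "q \<equiv> \<lambda>j. (x j, poly \<psi> (x j), 1)"
  shows "\<exists>F. integral_curve d F \<and> singular_points F = q ` {..<n} \<and>
    (\<forall>j<n. m j = 2 * r j \<longrightarrow> is_tacnode (r j) (local_eq F (q j))) \<and>
    (\<forall>j<n. m j + 1 = 2 * r j \<longrightarrow> is_cusp (r j - 1) (local_eq F (q j)))"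
proof -
  obtain f where f: "nodal f" and sing: "\<And>a b. singular_at f a b \<Longrightarrow> \<exists>j<n. a = x j \<and> b = poly \<psi> (x j)"
    using exists_nodal_curve by blast
  have irr: "irreducible f" by (rule nodal_irreducible[OF f sing low])
  have td: "tdeg_le d f" and lc: "coeff (top_form d f) d \<noteq> 0" and inI: "inI f"
    using f by (auto simp: nodal_def regular_def \<Lambda>_def)
  have cC: "cC j f \<noteq> 0" if "j < n" for j using f that by (auto simp: nodal_def regular_def)
  define F where "F = homogenize d f"
  note loc = local_eq_affine[OF td, folded F_def]
  have nf: "normal_form (m j) (r j) (cA j f) (cB j f) (cC j f) (local_eq F (q j))" if "j < n" for j
    using normal_form_at[OF inI that] unfolding q_def loc .
  have tac: "is_tacnode (r j) (local_eq F (q j))" if j: "j < n" "m j = 2 * r j" for j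
  proof (rule is_tacnode_of_normal_form)
    show "normal_form (2 * r j) (r j) (cA j f) (cB j f) (cC j f) (local_eq F (q j))" using nf[OF j(1)] j(2) by simp
    fix v assume "cA j f + cB j f * v + cC j f * v\<^sup>2 = 0"
    then have "poly (tangent_form j f) v = 0" by (simp add: tangent_form_def power2_eq_square algebra_simps)
    then have "poly (pderiv (tangent_form j f)) v \<noteq> 0" using f j by (auto simp: nodal_def)
    then show "cB j f + 2 * cC j f * v \<noteq> 0" by (simp add: tangent_form_def pderiv_pCons algebra_simps)
  qed (use mr[OF j(1)] cC[OF j(1)] in auto)
  have cusp: "is_cusp (r j - 1) (local_eq F (q j))" if j: "j < n" "m j + 1 = 2 * r j" for j
  proof (rule is_cusp_of_normal_form)
    have "m j = 2 * (r j - 1) + 1" "r j = r j - 1 + 1" using mr[OF j(1)] j(2) by linarith+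
    then show "normal_form (2 * (r j - 1) + 1) (r j - 1 + 1) (cA j f) (cB j f) (cC j f) (local_eq F (q j))"
      using nf[OF j(1)] by simp
    show "0 < r j - 1" using mr[OF j(1)] j(2) by linarith
    show "cA j f \<noteq> 0" using f j by (auto simp: nodal_def regular_def)
  qed (rule cC[OF j(1)])
  have mult: "mult0 (local_eq F (q j)) = 2" if j: "j < n" for j
  proof (cases "m j = 2 * r j")
    case True
    from tac[OF j this] show ?thesis unfolding is_tacnode_def mult_at_Nil[symmetric] by auto
  next
    case False
    then have c: "m j + 1 = 2 * r j" using mr[OF j] by auto
    then have "0 < r j - 1" using mr[OF j] by linarith
    with cusp[OF j c] show ?thesis unfolding is_cusp_def mult_at_Nil[symmetric] by auto
  qed
  have "singular_points F = q ` {..<n}"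
  proof (intro equalityI subsetI)
    fix p assume p: "p \<in> singular_points F"
    have inf: "mult0 (local_eq F (a, 1, 0)) < 2" "mult0 (local_eq F (1, 0, 0)) < 2" for a
      unfolding F_def using smooth_at_infinity[of d f] d6 lc f by (auto simp: nodal_def simp del: local_eq.simps)
    have "2 \<le> mult0 (local_eq F p)" using p by (simp add: singular_points_def)
    then have "p \<noteq> (a, 1, 0)" "p \<noteq> (1, 0, 0)" for a using inf(1)[of a] inf(2) by auto
    then obtain a b where ab: "p = (a, b, 1)"
      using p unfolding singular_points_def proj_plane_def by blast
    then have "2 \<le> mult0 (subst2 f (varx + const2 a) (vary + const2 b))"
      using p loc by (simp add: singular_points_def del: local_eq.simps)
    from singular_germ[OF this, unfolded eval2_affine_germ] have "singular_at f a b" by (simp add: singular_at_def)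
    then show "p \<in> q ` {..<n}" using sing ab by (auto simp: q_def)
  next
    fix p assume "p \<in> q ` {..<n}"
    then obtain j where j: "j < n" "p = q j" by auto
    moreover have "q j \<in> proj_plane" by (auto simp: q_def proj_plane_def)
    ultimately show "p \<in> singular_points F" using mult[OF j(1)] by (simp add: singular_points_def)
  qed
  moreover have "integral_curve d F"
  proof -
    have "top_form d f \<noteq> 0" using lc by auto
    then show ?thesis unfolding integral_curve_def F_def
      using homogeneous_homogenize irreducible_homogenize[OF irr td] by blast
  qed
  ultimately show ?thesis using tac cusp by blast
qed

end

section \<open>Choice of the points\<close>

text \<open>Every distribution of total weight 4 over the points imposes its own genericity
  condition for conics, and only finitely many conditions can be avoided at once.\<close>

lemma finite_bounded_functions:
  "finite {k :: nat \<Rightarrow> nat. (\<forall>j\<ge>n. k j = 0) \<and> (\<Sum>j<n. k j) = s}"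
proof (rule finite_subset)
  show "{k. (\<forall>j\<ge>n. k j = 0) \<and> (\<Sum>j<n. k j) = s}
      \<subseteq> {k. \<forall>j. (j \<in> {..<n} \<longrightarrow> k j \<in> {..s}) \<and> (j \<notin> {..<n} \<longrightarrow> k j = 0)}"
  proof
    fix k :: "nat \<Rightarrow> nat" assume k: "k \<in> {k. (\<forall>j\<ge>n. k j = 0) \<and> (\<Sum>j<n. k j) = s}"
    have "k j \<le> s" if "j < n" for j using member_le_sum[of j "{..<n}" k] k that by simp
    then show "k \<in> {k. \<forall>j. (j \<in> {..<n} \<longrightarrow> k j \<in> {..s}) \<and> (j \<notin> {..<n} \<longrightarrow> k j = 0)}" using k by simp
  qed
  show "finite {k. \<forall>j. (j \<in> {..<n} \<longrightarrow> k j \<in> {..s}) \<and> (j \<notin> {..<n} \<longrightarrow> k j = (0 :: nat))}"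
    by (intro finite_set_of_finite_funs) auto
qed

text \<open>A dummy point of weight \<open>S - \<Sum>r\<close> makes the interpolation conditions on forms of degree
  \<open>d - 3\<close> and \<open>d - 1\<close> exactly those of the extremal case; \<open>e0\<close> accounts for the one
  condition by which the doubled scheme exceeds it.\<close>

lemma exists_scheme:
  fixes m r :: "nat \<Rightarrow> nat"
  assumes d6: "6 \<le> d" and mr: "\<And>j. j < n \<Longrightarrow> 0 < r j \<and> r j < m j \<and> (m j = 2 * r j \<or> m j + 1 = 2 * r j)"
    and ge4: "4 \<le> (\<Sum>j<n. r j)" and le: "(\<Sum>j<n. r j) \<le> d * (d + 1) div 6"
  obtains x \<psi> and e0 :: "'k::{alg_closed_field, field_char_0} poly poly"
  where "scheme d n m r x \<psi> e0" "interp (d - 3) \<psi> (\<Prod>j<n. [:- x j, 1:] ^ r j) 1"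
proof -
  define S where "S = d * (d + 1) div 6"
  define r' where "r' = (\<lambda>j. if j < n then r j else S - (\<Sum>j<n. r j))"
  have r'_eq: "r' j = r j" if "j < n" for j using that by (simp add: r'_def)
  have sum_r': "(\<Sum>j<Suc n. r' j) = S" using le by (simp add: r'_def S_def)
  have "0 < n" using ge4 by (cases n) auto
  \<comment> \<open>The point that gives up one condition: the dummy point if it has positive
    weight, otherwise a cusp, where only order 2 r - 1 is demanded, otherwise any point. This choice
    secures \<open>cusp_e0\<close>.\<close>
  obtain k where k: "k < Suc n" "0 < r' k" "\<And>j. j < n \<Longrightarrow> m j + 1 = 2 * r j \<Longrightarrow> k = n \<or> m k + 1 = 2 * r k"
  proof -
    consider "0 < r' n" | j where "j < n" "m j + 1 = 2 * r j" | "\<And>j. j < n \<Longrightarrow> m j + 1 \<noteq> 2 * r j" by blast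
    then show thesis
    proof cases
      case 1 then show thesis using that[of n] by simp
    next
      case 2 then show thesis using that[of j] mr[of j] by (simp add: r'_eq)
    next
      case 3 then show thesis using that[of 0] mr[of 0] \<open>0 < n\<close> by (simp add: r'_eq)
    qed
  qed
  define e where "e = (\<lambda>j. if j = k then 2 * r' j - 1 else 2 * r' j)"
  have sum_e: "(\<Sum>j<Suc n. e j) = 2 * S - 1"
  proof -
    have "(\<Sum>j<Suc n. 2 * r' j) = (\<Sum>j<Suc n. e j + (if j = k then 1 else 0))"
      using k(2) by (intro sum.cong) (auto simp: e_def)
    also have "\<dots> = (\<Sum>j<Suc n. e j) + 1" using k(1) by (simp add: sum.distrib)
    finally show ?thesis using sum_r' by (simp only: sum_distrib_left[symmetric])
  qed
  obtain \<psi> :: "'k poly" where \<psi>: "interp (d - 1) \<psi> ([:-1, 1:] ^ (2 * S - 1)) ([:-1, 1:] ^ S)"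
    "interp (d - 3) \<psi> ([:-1, 1:] ^ S) 1" "interp 2 \<psi> ([:-1, 1:] ^ 4) 1"
    using interp_exists[OF d6] unfolding S_def by blast
  define K where "K = {k :: nat \<Rightarrow> nat. (\<forall>j\<ge>Suc n. k j = 0) \<and> (\<Sum>j<Suc n. k j) = 4}"
  have one: "clusters N (\<lambda>j. 0) s = 1" for N and s :: 'k by (simp add: clusters_def)
  have "finite {s. \<not> interp (d - 1) \<psi> (clusters (Suc n) e s) (clusters (Suc n) r' s)}"
    by (rule interp_spread) (simp only: sum_e sum_r' \<psi>)
  moreover have "finite {s. \<not> interp (d - 3) \<psi> (clusters (Suc n) r' s) (clusters (Suc n) (\<lambda>j. 0) s)}"
    by (rule interp_spread) (simp add: sum_r'[unfolded sum.lessThan_Suc] \<psi>)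
  moreover have "finite (\<Union>k\<in>K. {s. \<not> interp 2 \<psi> (clusters (Suc n) k s) (clusters (Suc n) (\<lambda>j. 0) s)})"
  proof (rule finite_UN_I)
    show "finite K" unfolding K_def by (rule finite_bounded_functions)
    show "finite {s. \<not> interp 2 \<psi> (clusters (Suc n) k s) (clusters (Suc n) (\<lambda>j. 0) s)}" if "k \<in> K" for k
    proof (rule interp_spread)
      have "(\<Sum>j<Suc n. k j) = 4" using that by (simp add: K_def)
      then show "interp 2 \<psi> ([:-1, 1:] ^ (\<Sum>j<Suc n. k j)) ([:-1, 1:] ^ (\<Sum>j<Suc n. 0))"
        using \<psi>(3) by (simp only: sum.neutral_const power_0)
    qed
  qed
  ultimately have "finite ({0} \<union> {s. \<not> interp (d - 1) \<psi> (clusters (Suc n) e s) (clusters (Suc n) r' s)}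
      \<union> {s. \<not> interp (d - 3) \<psi> (clusters (Suc n) r' s) (clusters (Suc n) (\<lambda>j. 0) s)}
      \<union> (\<Union>k\<in>K. {s. \<not> interp 2 \<psi> (clusters (Suc n) k s) (clusters (Suc n) (\<lambda>j. 0) s)}))" (is "finite ?bad")
    by simp
  from ex_new_if_finite[OF infinite_UNIV_char_0 this] obtain s where "s \<notin> ?bad" ..
  then have s: "s \<noteq> 0" "interp (d - 1) \<psi> (clusters (Suc n) e s) (clusters (Suc n) r' s)"
    "interp (d - 3) \<psi> (clusters (Suc n) r' s) 1" "\<And>k. k \<in> K \<Longrightarrow> interp 2 \<psi> (clusters (Suc n) k s) 1"
    by (auto simp: one)
  define x where "x = (\<lambda>j. 1 + s * of_nat j)"
  have cl: "clusters N k s = (\<Prod>j<N. [:- x j, 1:] ^ k j)" for N k by (simp only: clusters_def x_def)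
  define G0 where "G0 = clusters (Suc n) e s"
  define g' where "g' = clusters (Suc n) r' s"
  have dvd_prod: "(\<Prod>j<n. [:- x j, 1:] ^ k j) dvd (\<Prod>j<Suc n. [:- x j, 1:] ^ k' j)" if "\<And>j. j < n \<Longrightarrow> k j \<le> k' j" for k k'
    using that by (simp only: prod.lessThan_Suc) (intro dvd_mult2 prod_dvd_prod le_imp_power_dvd, simp)
  have g_dvd: "(\<Prod>j<n. [:- x j, 1:] ^ r j) dvd g'" unfolding g'_def cl by (rule dvd_prod) (simp add: r'_eq)
  have G0_mult: "(\<Prod>j<n. [:- x j, 1:] ^ m j) dvd G0 * [:- x k, 1:]"
  proof -
    have "G0 * [:- x k, 1:] = (\<Prod>j<Suc n. [:- x j, 1:] ^ e j) * (\<Prod>j<Suc n. if j = k then [:- x j, 1:] else 1)"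
      unfolding G0_def cl using k(1) by (simp add: prod.delta del: prod.lessThan_Suc)
    also have "\<dots> = (\<Prod>j<Suc n. [:- x j, 1:] ^ (2 * r' j))"
      unfolding prod.distrib[symmetric]
    proof (rule prod.cong[OF refl])
      fix j
      have "2 * r' k = Suc (2 * r' k - 1)" using k(2) by simp
      then have "[:- x k, 1:] ^ (2 * r' k) = [:- x k, 1:] ^ (2 * r' k - 1) * [:- x k, 1:]" by (metis power_Suc2)
      then show "[:- x j, 1:] ^ e j * (if j = k then [:- x j, 1:] else 1) = [:- x j, 1:] ^ (2 * r' j)"
        by (simp only: e_def split: if_split) simp
    qed
    finally have eq: "G0 * [:- x k, 1:] = (\<Prod>j<Suc n. [:- x j, 1:] ^ (2 * r' j))" .
    show ?thesis unfolding eq using mr by (intro dvd_prod) (fastforce simp: r'_eq)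
  qed
  \<comment> \<open>\<open>e0\<close> is a polynomial in x alone, whose order falls short of twice
    the weight by one, at x k only; its scalar multiples absorb the missing condition.\<close>
  have "scheme d n m r x \<psi> [:G0:]"
  proof (rule scheme.intro[OF d6 _ mr ge4])
    show "inj_on x {..<n}" using s(1) by (auto simp: x_def inj_on_def)
    fix f :: "'k poly poly"
    obtain p where p: "tdeg_le (d - 1) p" "G0 dvd poly p \<psi> - poly f \<psi>" "g' dvd poly (pderiv p) \<psi> - poly (pderiv f) \<psi>"
      using s(2) unfolding interp_def G0_def g'_def by blast
    then obtain h where h: "poly p \<psi> - poly f \<psi> = G0 * h" by blast
    \<comment> \<open>With this value the cofactor of G0 vanishes at x k, which restores the missing
      factor.\<close>
    define c where "c = - poly h (x k)"
    define i where "i = f - p - [:[:c:] * G0:]"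
    have "poly (- h - [:c:]) (x k) = 0" by (simp add: c_def)
    then obtain h' where h': "- h - [:c:] = [:- x k, 1:] * h'" by (metis dvdE poly_eq_0_iff_dvd)
    have "poly i \<psi> = G0 * (- h - [:c:])" using h by (simp add: i_def algebra_simps)
    also have "\<dots> = (G0 * [:- x k, 1:]) * h'" unfolding h' by (simp only: mult.assoc)
    finally have "(\<Prod>j<n. [:- x j, 1:] ^ m j) dvd poly i \<psi>" using G0_mult by (metis dvd_mult2)
    moreover have "poly (pderiv i) \<psi> = - (poly (pderiv p) \<psi> - poly (pderiv f) \<psi>)"
      by (simp add: i_def pderiv_diff pderiv_pCons)
    then have "(\<Prod>j<n. [:- x j, 1:] ^ r j) dvd poly (pderiv i) \<psi>"
      using p(3) g_dvd by (metis dvd_minus_iff dvd_trans)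
    moreover have "f = p + i + smult [:c:] [:G0:]" by (simp add: i_def)
    ultimately show "\<exists>p i c. tdeg_le (d - 1) p \<and> (\<Prod>j<n. [:- x j, 1:] ^ m j) dvd poly i \<psi>
        \<and> (\<Prod>j<n. [:- x j, 1:] ^ r j) dvd poly (pderiv i) \<psi> \<and> f = p + i + smult [:c:] [:G0:]"
      using p(1) by blast
  next
    fix j assume j: "j < n" "m j + 1 = 2 * r j"
    have "(\<Prod>j<n. [:- x j, 1:] ^ m j) dvd G0" unfolding G0_def cl
    proof (rule dvd_prod)
      fix l assume l: "l < n"
      show "m l \<le> e l" using k(3)[OF j] mr[OF l] l by (auto simp: e_def r'_eq)
    qed
    then show "(\<Prod>j<n. [:- x j, 1:] ^ m j) dvd poly [:G0:] \<psi> \<and> (\<Prod>j<n. [:- x j, 1:] ^ r j) dvd poly (pderiv [:G0:]) \<psi>"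
      by simp
  next
    fix k :: "nat \<Rightarrow> nat" assume k: "\<And>j. j < n \<Longrightarrow> k j \<le> r j" "(\<Sum>j<n. k j) = 4"
    define k' where "k' = (\<lambda>j. if j < n then k j else 0)"
    have "k' \<in> K" using k(2) by (simp add: K_def k'_def)
    from s(4)[OF this] have "interp 2 \<psi> (\<Prod>j<Suc n. [:- x j, 1:] ^ k' j) 1" by (simp only: cl)
    then show "interp 2 \<psi> (\<Prod>j<n. [:- x j, 1:] ^ k j) 1"
      by (rule interp_dvd) (auto intro!: dvd_prod simp: k'_def simp del: prod.lessThan_Suc)
  qed
  moreover have "interp (d - 3) \<psi> (\<Prod>j<n. [:- x j, 1:] ^ r j) 1"
    using s(3) g_dvd unfolding g'_def by (rule interp_dvd) simp
  ultimately show thesis by (rule that)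
qed

theorem theorem4p12:
  fixes d \<tau> \<nu> :: nat and t n :: "nat \<Rightarrow> nat"
  assumes "d > 0"
    and "\<And>i. i \<in> {1..\<tau>} \<Longrightarrow> t i > 0"
    and "\<And>i. i \<in> {1..\<nu>} \<Longrightarrow> n i > 0"
    and "real d * (real d + 1) / 6 \<ge> real ((\<Sum>i=1..\<tau>. t i) + (\<Sum>i=1..\<nu>. (n i + 1)))"
    and "(\<Sum>i=1..\<tau>. t i) + (\<Sum>i=1..\<nu>. (n i + 1)) \<ge> 6"
  shows "\<exists>(F :: 'k::{alg_closed_field, field_char_0} poly poly poly) P Q.
           integral_curve d F \<and>
           inj_on P {1..\<tau>} \<and> inj_on Q {1..\<nu>} \<and> P ` {1..\<tau>} \<inter> Q ` {1..\<nu>} = {} \<and>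
           singular_points F = P ` {1..\<tau>} \<union> Q ` {1..\<nu>} \<and>
           (\<forall>i\<in>{1..\<tau>}. is_tacnode (t i) (local_eq F (P i))) \<and>
           (\<forall>i\<in>{1..\<nu>}. is_cusp (n i) (local_eq F (Q i)))"
proof -
  define r where "r = (\<lambda>j. if j < \<tau> then t (Suc j) else n (Suc (j - \<tau>)) + 1)"
  define m where "m = (\<lambda>j. if j < \<tau> then 2 * t (Suc j) else 2 * n (Suc (j - \<tau>)) + 1)"
  have sum_r: "(\<Sum>j<\<tau> + \<nu>. r j) = (\<Sum>i=1..\<tau>. t i) + (\<Sum>i=1..\<nu>. (n i + 1))"
  proof -
    have "(\<Sum>j<\<tau> + \<nu>. r j) = (\<Sum>j<\<tau>. r j) + (\<Sum>j<\<nu>. r (\<tau> + j))"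
      by (induction \<nu>) simp_all
    also have "(\<Sum>j<\<tau>. r j) = (\<Sum>i=1..\<tau>. t i)"
      by (simp add: r_def sum.atLeast1_atMost_eq)
    also have "(\<Sum>j<\<nu>. r (\<tau> + j)) = (\<Sum>i=1..\<nu>. (n i + 1))"
      by (simp add: r_def sum.atLeast1_atMost_eq del: sum.distrib)
    finally show ?thesis .
  qed
  have "real (6 * (\<Sum>j<\<tau> + \<nu>. r j)) \<le> real (d * (d + 1))" using assms(4) unfolding sum_r by (simp add: field_simps)
  then have le: "6 * (\<Sum>j<\<tau> + \<nu>. r j) \<le> d * (d + 1)" by (simp only: of_nat_le_iff)
  have ge: "6 \<le> (\<Sum>j<\<tau> + \<nu>. r j)" unfolding sum_r by (rule assms(5))
  \<comment> \<open>The lower bound on the total weight acts here: for d \<le> 5 the upper bound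
    would be at most 5.\<close>
  have d6: "6 \<le> d"
  proof (rule ccontr)
    assume "\<not> 6 \<le> d"
    then have "d * (d + 1) \<le> 5 * 6" by (intro mult_mono) auto
    with le ge show False by linarith
  qed
  have mr: "0 < r j \<and> r j < m j \<and> (m j = 2 * r j \<or> m j + 1 = 2 * r j)" if "j < \<tau> + \<nu>" for j
    using assms(2)[of "Suc j"] assms(3)[of "Suc (j - \<tau>)"] that by (auto simp: r_def m_def)
  have sums: "4 \<le> (\<Sum>j<\<tau> + \<nu>. r j)" "(\<Sum>j<\<tau> + \<nu>. r j) \<le> d * (d + 1) div 6"
    using ge le by linarith+
  obtain x \<psi> and e0 :: "'k poly poly" where sch: "scheme d (\<tau> + \<nu>) m r x \<psi> e0"
    and low: "interp (d - 3) \<psi> (\<Prod>j<\<tau> + \<nu>. [:- x j, 1:] ^ r j) 1"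
    by (rule exists_scheme[OF d6, where n = "\<tau> + \<nu>" and m = m and r = r, OF mr sums])
  define q where "q = (\<lambda>j. (x j, poly \<psi> (x j), 1 :: 'k))"
  obtain F where F: "integral_curve d F" "singular_points F = q ` {..<\<tau> + \<nu>}"
    "\<And>j. j < \<tau> + \<nu> \<Longrightarrow> m j = 2 * r j \<Longrightarrow> is_tacnode (r j) (local_eq F (q j))"
    "\<And>j. j < \<tau> + \<nu> \<Longrightarrow> m j + 1 = 2 * r j \<Longrightarrow> is_cusp (r j - 1) (local_eq F (q j))"
    using scheme.exists_curve[OF sch low] unfolding q_def by blast
  have inj: "inj_on q {..<\<tau> + \<nu>}" using sch by (auto simp: scheme_def q_def inj_on_def)
  define P where "P = (\<lambda>i. q (i - 1))"
  define Q where "Q = (\<lambda>i. q (\<tau> + i - 1))"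
  have imP: "P ` {1..\<tau>} = q ` {..<\<tau>}" unfolding P_def
    by (force simp: image_iff intro: bexI[of _ "Suc _"])
  have imQ: "Q ` {1..\<nu>} = q ` {\<tau>..<\<tau> + \<nu>}" unfolding Q_def
  proof (intro equalityI subsetI)
    fix y assume "y \<in> q ` {\<tau>..<\<tau> + \<nu>}"
    then obtain j where j: "\<tau> \<le> j" "j < \<tau> + \<nu>" "y = q j" by auto
    then have "Suc (j - \<tau>) \<in> {1..\<nu>}" "\<tau> + Suc (j - \<tau>) - 1 = j" by auto
    then show "y \<in> (\<lambda>i. q (\<tau> + i - 1)) ` {1..\<nu>}" using j(3) by (metis image_eqI)
  next
    fix y assume "y \<in> (\<lambda>i. q (\<tau> + i - 1)) ` {1..\<nu>}"
    then obtain i where "1 \<le> i" "i \<le> \<nu>" "y = q (\<tau> + i - 1)" by auto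
    then show "y \<in> q ` {\<tau>..<\<tau> + \<nu>}" by (intro image_eqI[of _ _ "\<tau> + i - 1"]) auto
  qed
  have "inj_on P {1..\<tau>}"
  proof (rule inj_onI)
    fix i j assume ij: "i \<in> {1..\<tau>}" "j \<in> {1..\<tau>}" "P i = P j"
    then have "i - 1 \<in> {..<\<tau> + \<nu>}" "j - 1 \<in> {..<\<tau> + \<nu>}" unfolding atLeastAtMost_iff lessThan_iff by linarith+
    then have "i - 1 = j - 1" using inj ij(3) by (auto simp: P_def dest: inj_onD)
    then show "i = j" using ij unfolding atLeastAtMost_iff by linarith
  qed
  moreover have "inj_on Q {1..\<nu>}"
  proof (rule inj_onI)
    fix i j assume ij: "i \<in> {1..\<nu>}" "j \<in> {1..\<nu>}" "Q i = Q j"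
    then have "\<tau> + i - 1 \<in> {..<\<tau> + \<nu>}" "\<tau> + j - 1 \<in> {..<\<tau> + \<nu>}" unfolding atLeastAtMost_iff lessThan_iff by linarith+
    then have "\<tau> + i - 1 = \<tau> + j - 1" using inj ij(3) by (auto simp: Q_def dest: inj_onD)
    then show "i = j" using ij unfolding atLeastAtMost_iff by linarith
  qed
  moreover have "P ` {1..\<tau>} \<inter> Q ` {1..\<nu>} = {}"
    unfolding imP imQ by (subst inj_on_image_Int[OF inj, symmetric]) auto
  moreover have "singular_points F = P ` {1..\<tau>} \<union> Q ` {1..\<nu>}"
    unfolding F(2) imP imQ image_Un[symmetric] by (simp add: ivl_disj_un)
  moreover have "is_tacnode (t i) (local_eq F (P i))" if "i \<in> {1..\<tau>}" for i
  proof -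
    have "i - 1 < \<tau> + \<nu>" "i - 1 < \<tau>" "Suc (i - 1) = i" using that unfolding atLeastAtMost_iff by linarith+
    then show ?thesis using F(3)[of "i - 1"] by (simp add: r_def m_def P_def del: local_eq.simps)
  qed
  moreover have "is_cusp (n i) (local_eq F (Q i))" if "i \<in> {1..\<nu>}" for i
  proof -
    have "\<tau> + i - 1 < \<tau> + \<nu>" "\<not> \<tau> + i - 1 < \<tau>" "Suc (\<tau> + i - 1 - \<tau>) = i"
      using that unfolding atLeastAtMost_iff by linarith+
    then show ?thesis using F(4)[of "\<tau> + i - 1"] by (simp add: r_def m_def Q_def del: local_eq.simps)
  qed
  ultimately show ?thesis using F(1) by blast
qed

end
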